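(* Let $1<p<+\infty$, let $a\in C[0,1]$ be positive, let $\alpha,\beta\in C[0,1]$, let $r\in\mathbb{R}$, and let $f:\mathbb{R}\to\mathbb{R}$ be a continuous function such that $sf(s)>0$ for $s\ne0$ and such that there exist $f_0,f_\infty\in(0,+\infty)$ with $$f_0=\lim_{|s|\to0}\frac{f(s)}{\varphi_p(s)},\qquad f_\infty=\lim_{|s|\to+\infty}\frac{f(s)}{\varphi_p(s)} .$$ Let $k\in\mathbb{N}$ and $\nu\in\{+,-\}$, and suppose that either $$\frac{\lambda_k^\nu}{f_\infty}<r<\frac{\lambda_k^\nu}{f_0}\qquad\text{or}\qquad \frac{\lambda_k^\nu}{f_0}<r<\frac{\lambda_k^\nu}{f_\infty}.$$ Then the problem $$\left(|u'|^{p-2}u'\right)'+r a(x)f(u)+\alpha(x)\varphi_p(u^+)+\beta(x)\varphi_p(u^-)=0,\ x\in(0,1),\qquad u(0)=u(1)=0$$ has a solution $u_k^\nu$ such that $u_k^\nu$ has exactly $k-1$ zeros in $(0,1)$ and $\nu u_k^\nu$ is positive near $0$.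
   Context: $\varphi_p(s)=|s|^{p-2}s$ (with $\varphi_p(0)=0$); $u^+=\max\{u,0\}$, $u^-=-\min\{u,0\}$. $E=\{u\in C^1[0,1] : u(0)=u(1)=0\}$; solutions are sought in $E$. For $k\in\mathbb{N}=\{1,2,\dots\}$, $S_k^+$ is the set of functions in $E$ which have exactly $k-1$ interior nodal (i.e. non-degenerate) zeros in $(0,1)$ (all zeros in $[0,1]$ being non-degenerate) and are positive near $x=0$; $S_k^-=-S_k^+$. For $k\in\mathbb{N}$ and $\nu\in\{+,-\}$, $\lambda_k^\nu$ denotes the half-eigenvalue of $$-\left(\varphi_p(u')\right)'=\lambda a(x)\varphi_p(u)+\alpha(x)\varphi_p(u^+)+\beta(x)\varphi_p(u^-),\ x\in(0,1),\qquad u(0)=u(1)=0$$ associated with $S_k^\nu$, i.e. the (existing and unique) real number $\lambda$ for which this problem has a solution $u\in S_k^\nu$; one has $\lambda_1^\nu<\lambda_2^\nu<\cdots$. *)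

theory Defs
  imports "HOL-Analysis.Analysis"
begin

definition phi :: "real \<Rightarrow> real \<Rightarrow> real" where
  "phi p s = \<bar>s\<bar> powr (p - 2) * s"

definition pos_part :: "real \<Rightarrow> real" where
  "pos_part s = max s 0"

definition neg_part :: "real \<Rightarrow> real" where
  "neg_part s = - min s 0"

text \<open>Functions on $[0,1]$ are total functions on the reals whose values outside $[0,1]$ are
  irrelevant; accordingly the derivative is one-sided at the two end points.\<close>

definition deriv01 :: "(real \<Rightarrow> real) \<Rightarrow> real \<Rightarrow> real" where
  "deriv01 u x = vector_derivative u (at x within {0..1})"

definition E :: "(real \<Rightarrow> real) set" where
  "E = {u. u differentiable_on {0..1} \<and> continuous_on {0..1} (deriv01 u) \<and> u 0 = 0 \<and> u 1 = 0}"

definition interior_zeros :: "(real \<Rightarrow> real) \<Rightarrow> real set" where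
  "interior_zeros u = {x \<in> {0<..<1}. u x = 0}"

definition S_plus :: "nat \<Rightarrow> (real \<Rightarrow> real) set" where
  "S_plus k = {u \<in> E.
     (\<forall>x\<in>{0..1}. u x = 0 \<longrightarrow> deriv01 u x \<noteq> 0) \<and>
     finite (interior_zeros u) \<and> card (interior_zeros u) = k - 1 \<and>
     (\<forall>\<^sub>F x in at_right 0. u x > 0)}"

text \<open>The sign $\nu$ is represented by the real number $1$ or $-1$.\<close>

definition S :: "real \<Rightarrow> nat \<Rightarrow> (real \<Rightarrow> real) set" where
  "S \<nu> k = (\<lambda>u x. \<nu> * u x) ` S_plus k"

text \<open>Solutions $u \in E$ of $(\varphi_p(u'))' + F(x,u) = 0$ on $(0,1)$, $u(0) = u(1) = 0$.\<close>

definition dirichlet_solution ::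
    "real \<Rightarrow> (real \<Rightarrow> real \<Rightarrow> real) \<Rightarrow> (real \<Rightarrow> real) \<Rightarrow> bool" where
  "dirichlet_solution p F u \<longleftrightarrow> u \<in> E \<and>
     (\<forall>x\<in>{0<..<1}. ((\<lambda>t. phi p (deriv01 u t)) has_real_derivative - F x (u x)) (at x))"

text \<open>The description is proper for $1 < p$, $k \ge 1$, $\nu = \pm 1$, continuous $a, \alpha, \beta$ and
  $a > 0$ on $[0,1]$, by the classical existence and uniqueness of half-eigenvalues.\<close>

definition half_eigenvalue ::
    "real \<Rightarrow> (real \<Rightarrow> real) \<Rightarrow> (real \<Rightarrow> real) \<Rightarrow> (real \<Rightarrow> real) \<Rightarrow> real \<Rightarrow> nat \<Rightarrow> real" where
  "half_eigenvalue p a \<alpha> \<beta> \<nu> k = (THE lam. \<exists>u \<in> S \<nu> k. dirichlet_solution p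
     (\<lambda>x s. lam * a x * phi p s + \<alpha> x * phi p (pos_part s) + \<beta> x * phi p (neg_part s)) u)"

end

theory Submission
  imports Defs "HOL-Complex_Analysis.Great_Picard"
begin

text \<open>
  The proof is a shooting argument in which no initial value problem has to be uniquely solvable.
  Write the equation as the planar system $u' = \varphi_q(w)$, $w' = -F(x,u)$ with $q = p/(p-1)$.
  Substituting $u = \delta v$ with $\delta > 0$ and dividing by $\varphi_p(\delta)$ replaces $f(s)$ by
  $f(\delta s)/\varphi_p(\delta) = h(\delta s)\,\varphi_p(s)$, where $h = f/\varphi_p$. The family extends
  continuously to $\delta = 0$ and $\delta = \infty$, where it becomes half-linear with the spectral
  parameter $r f_0$ and $r f_\infty$ respectively. The hypothesis says that $\lambda_k^\nu$ lies strictly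
  between these two numbers. So at one end of the family every solution with $v(0) = 0$, $w(0) = 1$ has
  fewer than $k$ zeros in $(0,1]$, and at the other end every such solution has at least $k$ zeros in
  $(0,1)$. In between there must be a parameter and a solution whose $k$-th zero is exactly $1$; scaling it
  back by $\delta$ gives the solution sought.

  That there is such a parameter follows from \<open>solution_funnel_connected\<close>, a form of Kneser's theorem: the set of
  all pairs of a parameter and a solution cannot be split into two disjoint closed parts, one holding the solutions
  for the parameter 0 and the other those for the parameter 1. It is derived from Euler polygons, which
  do depend continuously on the parameter, and from compactness. One of the two closed conditions to which it
  is applied is that $u$ does not change sign $k$ times on $[0,1)$ (\<open>alternates\<close>), the other is that
  $u$ has $k$ zeros in $(0,1]$ (\<open>zero_chain\<close>). Every solution satisfies one of them. As
  all zeros are simple by the energy estimate \<open>energy_gronwall\<close>, a solution that satisfies both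
  has its $k$-th zero at $1$ (\<open>exact_zeros\<close>). This is the lemma \<open>shooting\<close>.

  What happens at the ends of the family follows from Sturm's comparison theorem, proved with Picone's
  inequality (\<open>picone_comparison\<close>, \<open>sturm_comparison\<close>): a solution for a larger spectral parameter
  changes sign on every lobe of a solution for a smaller one. Comparison also shows that the half-eigenvalue
  is unique. Its existence is a second application of \<open>shooting\<close>, with the spectral parameter
  running from a large negative to a large positive value. The case $\nu = -1$ is reduced to
  $\nu = 1$ by the reflection $u \mapsto -u$, which exchanges $\alpha$ with $-\beta$.
\<close>

section \<open>The odd power function\<close>

lemma phi_0 [simp]: "phi p 0 = 0"
  by (simp add: phi_def)

lemma phi_1 [simp]: "phi p 1 = 1"
  by (simp add: phi_def)

lemma phi_minus [simp]: "phi p (- s) = - phi p s"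
  by (simp add: phi_def)

lemma abs_phi: "\<bar>phi p s\<bar> = \<bar>s\<bar> powr (p - 1)"
proof (cases "s = 0")
  case False
  then show ?thesis
    using powr_add[of "\<bar>s\<bar>" "p - 2" 1] by (simp add: phi_def abs_mult)
qed (simp add: phi_def)

lemma phi_eq_sgn: "phi p s = sgn s * \<bar>s\<bar> powr (p - 1)"
proof -
  have "phi p s = sgn s * \<bar>phi p s\<bar>"
    by (simp add: phi_def abs_mult sgn_if)
  then show ?thesis by (simp add: abs_phi)
qed

lemma phi_pos_iff [simp]: "0 < phi p s \<longleftrightarrow> 0 < s"
  by (auto simp: phi_def zero_less_mult_iff)

lemma phi_neg_iff [simp]: "phi p s < 0 \<longleftrightarrow> s < 0"
  by (auto simp: phi_def mult_less_0_iff)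

lemma phi_eq_0_iff [simp]: "phi p s = 0 \<longleftrightarrow> s = 0"
  by (simp add: phi_def)

lemma phi_mult: "phi p (s * t) = phi p s * phi p t"
  by (simp add: phi_def abs_mult powr_mult)

lemma phi_divide: "phi p (s / t) = phi p s / phi p t"
  by (simp add: phi_def abs_mult powr_divide)

lemma mult_phi: "s * phi p s = \<bar>s\<bar> powr p"
proof -
  have "s * phi p s = \<bar>s\<bar> * \<bar>s\<bar> powr (p - 1)"
    by (simp add: phi_eq_sgn sgn_if)
  then show ?thesis
    by (cases "s = 0") (simp_all add: powr_mult_base)
qed

lemma phi_strict_mono: "1 < p \<Longrightarrow> s < t \<Longrightarrow> phi p s < phi p t"
proof (cases "0 \<le> s")
  case True
  assume "1 < p" "s < t"
  then show ?thesis using True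
    by (auto simp: phi_eq_sgn sgn_if intro!: powr_less_mono2)
next
  case False
  assume p: "1 < p" "s < t"
  show ?thesis
  proof (cases "0 \<le> t")
    case True
    have "0 \<le> phi p t"
      using \<open>0 \<le> t\<close> by (simp add: phi_def)
    moreover have "phi p s < 0"
      using False by simp
    ultimately show ?thesis by linarith
  next
    case False
    have "(- t) powr (p - 1) < (- s) powr (p - 1)"
      using p False by (intro powr_less_mono2) auto
    then show ?thesis
      using p False by (simp add: phi_eq_sgn)
  qed
qed

lemma continuous_on_phi_UNIV: "1 < p \<Longrightarrow> continuous_on UNIV (phi p)"
proof -
  assume p: "1 < p"
  have "isCont (phi p) x" for x
  proof (cases "x = 0")
    case True
    have "((\<lambda>s. \<bar>s\<bar> powr (p - 1)) \<longlongrightarrow> \<bar>0::real\<bar> powr (p - 1)) (at 0)"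
      using p by (intro tendsto_intros) (auto intro: always_eventually)
    then have "((\<lambda>s. \<bar>phi p s\<bar>) \<longlongrightarrow> 0) (at 0)"
      by (simp add: abs_phi)
    then show ?thesis
      by (simp add: True isCont_def tendsto_rabs_zero_cancel)
  next
    case False
    then show ?thesis
      unfolding phi_def[abs_def] by (intro continuous_intros) auto
  qed
  then show ?thesis
    by (simp add: continuous_at_imp_continuous_on)
qed

lemma continuous_on_phi [continuous_intros]:
  "1 < p \<Longrightarrow> continuous_on A g \<Longrightarrow> continuous_on A (\<lambda>x. phi p (g x))"
  using continuous_on_compose2[OF continuous_on_phi_UNIV] by blast

lemma tendsto_phi [tendsto_intros]:
  "1 < p \<Longrightarrow> (g \<longlongrightarrow> l) Fl \<Longrightarrow> ((\<lambda>x. phi p (g x)) \<longlongrightarrow> phi p l) Fl"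
  using continuous_on_phi_UNIV[of p]
  by (simp add: continuous_on_eq_continuous_at isCont_tendsto_compose)

text \<open>The function \<open>phi\<close> for the conjugate exponent inverts \<open>phi p\<close>; this is what turns the
  second order equation into a planar system.\<close>

lemma phi_conj_phi: "1 < p \<Longrightarrow> phi (p / (p - 1)) (phi p s) = s"
proof -
  assume p: "1 < p"
  then have e: "(p - 1) * (p / (p - 1) - 1) = 1"
    by (simp add: field_simps)
  have "phi (p / (p - 1)) (phi p s) = sgn s * (\<bar>s\<bar> powr (p - 1)) powr (p / (p - 1) - 1)"
    unfolding phi_eq_sgn[of "p / (p - 1)"] abs_phi by (simp add: sgn_if)
  also have "\<dots> = s"
    by (simp add: powr_powr e sgn_if)
  finally show ?thesis .
qed

lemma phi_phi_conj: "1 < p \<Longrightarrow> phi p (phi (p / (p - 1)) s) = s"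
proof -
  assume p: "1 < p"
  have "p / (p - 1) / (p / (p - 1) - 1) = p"
    using p by (simp add: field_simps)
  then show ?thesis
    using phi_conj_phi[of "p / (p - 1)" s] p by simp
qed

lemma abs_deriv:
  fixes s :: real
  assumes "s \<noteq> 0"
  shows "(abs has_real_derivative sgn s) (at s)"
proof (cases "0 < s")
  case True
  show ?thesis
    by (rule has_field_derivative_transform_within_open[of "\<lambda>x. x" _ _ "{0<..}"])
      (use True in \<open>auto intro!: derivative_eq_intros\<close>)
next
  case False
  show ?thesis
    by (rule has_field_derivative_transform_within_open[of "\<lambda>x. - x" _ _ "{..<0}"])
      (use False assms in \<open>auto intro!: derivative_eq_intros\<close>)
qed

text \<open>At 0 the difference quotient of \<open>\<bar>s\<bar> powr p\<close> is \<open>phi p\<close> itself, which tends to 0 there.\<close>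

lemma abs_powr_deriv:
  assumes "1 < p"
  shows "((\<lambda>s. \<bar>s\<bar> powr p) has_real_derivative p * phi p s) (at s)"
proof (cases "s = 0")
  case True
  have "((\<lambda>h. phi p h) \<longlongrightarrow> phi p 0) (at 0)"
    using assms by (intro tendsto_intros)
  moreover have "(\<lambda>h. \<bar>h\<bar> powr p / h) = phi p"
  proof
    fix h :: real
    show "\<bar>h\<bar> powr p / h = phi p h"
      using mult_phi[of h p] by (cases "h = 0") (auto simp: field_simps)
  qed
  ultimately show ?thesis
    using True assms by (simp add: DERIV_def)
next
  case False
  have e: "\<bar>s\<bar> powr (p - 1) * sgn s = phi p s"
    by (simp add: phi_eq_sgn)
  have "((\<lambda>s. \<bar>s\<bar>) has_real_derivative sgn s) (at s)"
    using False by (rule abs_deriv)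
  from DERIV_fun_powr[OF this, of p] False e show ?thesis
    by (simp add: mult.assoc)
qed

lemma phi_deriv:
  assumes "s \<noteq> 0"
  shows "(phi p has_real_derivative (p - 1) * \<bar>s\<bar> powr (p - 2)) (at s)"
proof -
  have "((\<lambda>s. \<bar>s\<bar>) has_real_derivative sgn s) (at s)"
    using assms by (rule abs_deriv)
  from DERIV_fun_powr[OF this, of "p - 2"] assms
  have "((\<lambda>s. \<bar>s\<bar> powr (p - 2)) has_real_derivative (p - 2) * \<bar>s\<bar> powr (p - 2 - 1) * sgn s) (at s)"
    by simp
  from DERIV_mult[OF this DERIV_ident]
  have "((\<lambda>s. \<bar>s\<bar> powr (p - 2) * s) has_real_derivative
      ((p - 2) * \<bar>s\<bar> powr (p - 2 - 1) * sgn s) * s + 1 * \<bar>s\<bar> powr (p - 2)) (at s)" .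
  moreover have r: "\<bar>s\<bar> powr (p - 2 - 1) * (sgn s * s) = \<bar>s\<bar> powr (p - 2)"
    using assms powr_mult_base[of "\<bar>s\<bar>" "p - 2 - 1"]
    by (cases "0 < s") (simp_all add: mult.commute)
  have "(p - 2) * \<bar>s\<bar> powr (p - 2 - 1) * sgn s * s + 1 * \<bar>s\<bar> powr (p - 2)
      = (p - 1) * \<bar>s\<bar> powr (p - 2)"
    unfolding mult.assoc r by (simp add: algebra_simps)
  ultimately show ?thesis
    unfolding phi_def[abs_def] by simp
qed

lemma young_conj:
  fixes p x y :: real
  assumes "1 < p" "0 \<le> x" "0 \<le> y"
  shows "x * y \<le> x powr p / p + y powr (p / (p - 1)) / (p / (p - 1))"
  using Youngs_inequality[of p "p / (p - 1)" x y] assms by (simp add: field_simps)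

section \<open>The planar system and Picone's inequality\<close>

text \<open>The equation $(\varphi_p(u'))' = -F(x,u)$ as a system for $u$ and $w = \varphi_p(u')$. The
  derivative of $u$ is required on the closed interval because $u$ must belong to $C^1[0,1]$, the one of
  $w$ only in the interior because the equation is only posed there.\<close>

definition plane_sol :: "real \<Rightarrow> (real \<Rightarrow> real \<Rightarrow> real) \<Rightarrow> (real \<Rightarrow> real) \<Rightarrow> (real \<Rightarrow> real) \<Rightarrow> bool" where
  "plane_sol p F u w \<longleftrightarrow>
     (\<forall>x\<in>{0..1}. (u has_real_derivative phi (p / (p - 1)) (w x)) (at x within {0..1})) \<and>
     continuous_on {0..1} w \<and>
     (\<forall>x\<in>{0<..<1}. (w has_real_derivative - F x (u x)) (at x))"

lemma plane_solD:
  assumes "plane_sol p F u w"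
  shows "x \<in> {0..1} \<Longrightarrow> (u has_real_derivative phi (p / (p - 1)) (w x)) (at x within {0..1})"
    and "continuous_on {0..1} w"
    and "x \<in> {0<..<1} \<Longrightarrow> (w has_real_derivative - F x (u x)) (at x)"
    and "continuous_on {0..1} u"
    and "x \<in> {0<..<1} \<Longrightarrow> (u has_real_derivative phi (p / (p - 1)) (w x)) (at x)"
proof -
  show d: "x \<in> {0..1} \<Longrightarrow> (u has_real_derivative phi (p / (p - 1)) (w x)) (at x within {0..1})" for x
    using assms by (simp add: plane_sol_def)
  show "continuous_on {0..1} w" "x \<in> {0<..<1} \<Longrightarrow> (w has_real_derivative - F x (u x)) (at x)"
    using assms by (simp_all add: plane_sol_def)
  show "continuous_on {0..1} u"
    by (rule DERIV_continuous_on) (rule d)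
  show "x \<in> {0<..<1} \<Longrightarrow> (u has_real_derivative phi (p / (p - 1)) (w x)) (at x)"
    using d[of x] at_within_Icc_at[of 0 x 1] by simp
qed

text \<open>The derivative of Picone's function is
  $(R - Q)|u|^p + |u'|^p - p\,\varphi_p(u)\,u'\rho + (p-1)|u|^p|\rho|^q$ with $\rho = z/\varphi_p(v)$, and the last
  three terms have a nonnegative sum by Young's inequality for $|u'|$ and $|\varphi_p(u)\rho|$. Since $u$ may have
  any sign and may be constant, the choice $u = 1$, $w = 0$ contains the Riccati inequality for $-\rho$.\<close>

lemma picone_inequality:
  fixes p :: real
  assumes p: "1 < p" and v0: "v x \<noteq> 0"
    and u: "(u has_real_derivative phi (p / (p - 1)) (w x)) (at x)"
    and v: "(v has_real_derivative phi (p / (p - 1)) (z x)) (at x)"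
    and w: "(w has_real_derivative - (Q * phi p (u x))) (at x)"
    and z: "(z has_real_derivative - (R * phi p (v x))) (at x)"
  obtains D where
    "((\<lambda>x. u x * w x - \<bar>u x\<bar> powr p * (z x / phi p (v x))) has_real_derivative D) (at x)"
    and "(R - Q) * \<bar>u x\<bar> powr p \<le> D"
proof -
  define q where "q = p / (p - 1)"
  have q: "1 < q" "p / q = p - 1"
    using p by (simp_all add: q_def)
  define \<rho> where "\<rho> = z x / phi p (v x)"
  define u' where "u' = phi q (w x)"
  define v' where "v' = phi q (z x)"
  have w_eq: "w x = phi p u'" and z_eq: "z x = phi p v'"
    by (simp_all add: u'_def v'_def q_def phi_phi_conj p)
  define P where "P = p * phi p (u x) * u'"
  have dP: "((\<lambda>x. \<bar>u x\<bar> powr p) has_real_derivative P) (at x)"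
    unfolding P_def u'_def q_def by (rule DERIV_chain2[OF abs_powr_deriv[OF p] u])
  have dphi: "((\<lambda>x. phi p (v x)) has_real_derivative (p - 1) * \<bar>v x\<bar> powr (p - 2) * v') (at x)"
    unfolding v'_def q_def by (rule DERIV_chain2[OF phi_deriv[OF v0] v])
  have n0: "phi p (v x) \<noteq> 0"
    using v0 by simp
  define D where "D = (u x * (- (Q * phi p (u x))) + u' * w x)
     - (\<bar>u x\<bar> powr p * ((- (R * phi p (v x)) * phi p (v x) - z x * ((p - 1) * \<bar>v x\<bar> powr (p - 2) * v'))
           / (phi p (v x) * phi p (v x))) + P * (z x / phi p (v x)))"
  have "((\<lambda>x. u x * w x - \<bar>u x\<bar> powr p * (z x / phi p (v x))) has_real_derivative D) (at x)"
    unfolding D_def using u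
    by (intro DERIV_diff DERIV_mult' DERIV_divide w z dP dphi n0) (simp add: u'_def q_def)
  moreover have "(R - Q) * \<bar>u x\<bar> powr p \<le> D"
  proof -
    have r: "\<rho> = phi p (v' / v x)"
      by (simp add: \<rho>_def z_eq phi_divide)
    have zz: "z x * (\<bar>v x\<bar> powr (p - 2) * v') / (phi p (v x) * phi p (v x)) = \<bar>\<rho>\<bar> powr q"
    proof -
      have "z x * (\<bar>v x\<bar> powr (p - 2) * v') / (phi p (v x) * phi p (v x))
          = (v' / v x) * phi p (v' / v x)"
        using v0 by (simp add: z_eq phi_divide) (simp add: phi_def field_simps)
      also have "\<dots> = \<bar>\<rho>\<bar> powr q"
        using p by (simp add: mult_phi r abs_phi powr_powr q_def)
      finally show ?thesis .
    qed
    have D_eq: "D = - Q * \<bar>u x\<bar> powr p + \<bar>u'\<bar> powr p + R * \<bar>u x\<bar> powr p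
        + (p - 1) * \<bar>u x\<bar> powr p * \<bar>\<rho>\<bar> powr q - p * phi p (u x) * u' * \<rho>"
    proof -
      have 1: "u x * (- (Q * phi p (u x))) = - Q * \<bar>u x\<bar> powr p"
        by (simp add: mult_phi[symmetric] algebra_simps)
      have 2: "u' * w x = \<bar>u'\<bar> powr p"
        by (simp add: w_eq mult_phi)
      have 3: "(- (R * phi p (v x)) * phi p (v x) - z x * ((p - 1) * \<bar>v x\<bar> powr (p - 2) * v'))
           / (phi p (v x) * phi p (v x))
          = - R - (p - 1) * (z x * (\<bar>v x\<bar> powr (p - 2) * v') / (phi p (v x) * phi p (v x)))"
        using n0 by (simp add: field_simps)
      show ?thesis
        unfolding D_def 1 2 3 zz P_def \<rho>_def[symmetric] by (simp add: algebra_simps)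
    qed
    have "\<bar>u'\<bar> * \<bar>phi p (u x) * \<rho>\<bar> \<le> \<bar>u'\<bar> powr p / p + \<bar>phi p (u x) * \<rho>\<bar> powr q / q"
      unfolding q_def by (rule young_conj[OF p]) auto
    then have "p * (\<bar>u'\<bar> * \<bar>phi p (u x) * \<rho>\<bar>) \<le> p * (\<bar>u'\<bar> powr p / p + \<bar>phi p (u x) * \<rho>\<bar> powr q / q)"
      using p by (intro mult_left_mono) auto
    also have "\<dots> = \<bar>u'\<bar> powr p + (p / q) * \<bar>phi p (u x) * \<rho>\<bar> powr q"
      using p q by (simp add: field_simps)
    also have "\<bar>phi p (u x) * \<rho>\<bar> powr q = \<bar>u x\<bar> powr p * \<bar>\<rho>\<bar> powr q"
      using p by (simp add: abs_mult powr_mult abs_phi powr_powr q_def)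
    finally have "p * (\<bar>u'\<bar> * \<bar>phi p (u x) * \<rho>\<bar>)
        \<le> \<bar>u'\<bar> powr p + (p - 1) * (\<bar>u x\<bar> powr p * \<bar>\<rho>\<bar> powr q)"
      using q by simp
    moreover have "p * phi p (u x) * u' * \<rho> \<le> p * (\<bar>u'\<bar> * \<bar>phi p (u x) * \<rho>\<bar>)"
    proof -
      have "u' * (phi p (u x) * \<rho>) \<le> \<bar>u'\<bar> * \<bar>phi p (u x) * \<rho>\<bar>"
        by (metis abs_ge_self abs_mult)
      then show ?thesis
        using p by (simp add: mult.assoc mult.left_commute)
    qed
    ultimately show ?thesis
      unfolding D_eq by (simp add: algebra_simps)
  qed
  ultimately show ?thesis
    by (rule that)
qed

text \<open>Written as $u\,(w - \varphi_p(u/v)\,z)$, Picone's function is controlled at a zero of $u$ by the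
  quotient $u/v$. This has a finite limit even if $v$ vanishes at the same point, because that zero of $v$ is
  simple.\<close>

lemma picone_boundary:
  fixes p :: real
  assumes p: "1 < p" and T: "T \<subseteq> {0..1}" and c: "c \<in> {0..1}"
    and u: "\<And>x. x \<in> {0..1} \<Longrightarrow> (u has_real_derivative phi (p / (p - 1)) (w x)) (at x within {0..1})"
    and v: "\<And>x. x \<in> {0..1} \<Longrightarrow> (v has_real_derivative phi (p / (p - 1)) (z x)) (at x within {0..1})"
    and w: "continuous_on {0..1} w" and z: "continuous_on {0..1} z"
    and u0: "u c = 0" and v0: "v c \<noteq> 0 \<or> z c \<noteq> 0"
  shows "((\<lambda>x. u x * (w x - phi p (u x / v x) * z x)) \<longlongrightarrow> 0) (at c within T)"
proof -
  have ucont: "continuous_on {0..1} u" and vcont: "continuous_on {0..1} v"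
    by (rule DERIV_continuous_on, erule u v)+
  have lim: "(g \<longlongrightarrow> g c) (at c within T)" if "continuous_on {0..1} g" for g :: "real \<Rightarrow> real"
    using that c T by (meson continuous_on_def tendsto_within_subset)
  obtain l where l: "((\<lambda>x. u x / v x) \<longlongrightarrow> l) (at c within T)"
  proof (cases "v c = 0")
    case False
    show ?thesis
      by (rule that) (rule tendsto_divide[OF lim[OF ucont] lim[OF vcont] False])
  next
    case True
    then have zc: "phi (p / (p - 1)) (z c) \<noteq> 0"
      using v0 by simp
    have "((\<lambda>x. (u x - u c) / (x - c)) \<longlongrightarrow> phi (p / (p - 1)) (w c)) (at c within T)"
      "((\<lambda>x. (v x - v c) / (x - c)) \<longlongrightarrow> phi (p / (p - 1)) (z c)) (at c within T)"
      using u[OF c] v[OF c] T by (auto simp: has_field_derivative_iff intro: tendsto_within_subset)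
    from tendsto_divide[OF this zc]
    have "((\<lambda>x. ((u x - u c) / (x - c)) / ((v x - v c) / (x - c))) \<longlongrightarrow>
        phi (p / (p - 1)) (w c) / phi (p / (p - 1)) (z c)) (at c within T)" .
    moreover have "\<forall>\<^sub>F x in at c within T. ((u x - u c) / (x - c)) / ((v x - v c) / (x - c)) = u x / v x"
      unfolding eventually_at_filter using True u0 by (intro always_eventually) auto
    ultimately show ?thesis
      by (intro that) (rule Lim_transform_eventually)
  qed
  have "((\<lambda>x. u x * (w x - phi p (u x / v x) * z x)) \<longlongrightarrow> u c * (w c - phi p l * z c)) (at c within T)"
    using p by (intro tendsto_intros lim ucont w z l)
  then show ?thesis
    by (simp add: u0)
qed

text \<open>If $v$ had no zero inside a lobe of $u$, Picone's function would vanish at both ends of the lobe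
  although its derivative is positive inside.\<close>

lemma picone_comparison:
  fixes p :: real
  assumes p: "1 < p" and cd: "0 \<le> c" "c < d" "d \<le> 1"
    and su: "plane_sol p F u w" and sv: "plane_sol p G v z"
    and F: "\<And>x. x \<in> {c<..<d} \<Longrightarrow> F x (u x) = Q x * phi p (u x)"
    and G: "\<And>x. x \<in> {c<..<d} \<Longrightarrow> G x (v x) = R x * phi p (v x)"
    and QR: "\<And>x. x \<in> {c<..<d} \<Longrightarrow> Q x < R x"
    and u0: "u c = 0" "u d = 0" and u: "\<And>x. x \<in> {c<..<d} \<Longrightarrow> u x \<noteq> 0"
    and v: "\<And>x. x \<in> {c<..<d} \<Longrightarrow> v x \<noteq> 0"
    and simple: "v c \<noteq> 0 \<or> z c \<noteq> 0" "v d \<noteq> 0 \<or> z d \<noteq> 0"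
  shows False
proof -
  note U = plane_solD[OF su] and V = plane_solD[OF sv]
  define h where "h x = u x * (w x - phi p (u x / v x) * z x)" for x
  \<comment> \<open>extended by its limit 0 to the end points\<close>
  define H where "H x = (if x \<in> {c<..<d} then h x else 0)" for x
  have sub: "{c<..<d} \<subseteq> {0..1}" "{c<..<d} \<subseteq> {0<..<1}"
    using cd by auto
  have h_eq: "h x = u x * w x - \<bar>u x\<bar> powr p * (z x / phi p (v x))" for x
    by (simp add: h_def phi_divide mult_phi[symmetric] algebra_simps)
  have deriv: "\<exists>D>0. (H has_real_derivative D) (at x)" if x: "x \<in> {c<..<d}" for x
  proof -
    have x1: "x \<in> {0<..<1}"
      using x sub by auto
    obtain D where D: "(h has_real_derivative D) (at x)" "(R x - Q x) * \<bar>u x\<bar> powr p \<le> D"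
      using picone_inequality[OF p v[OF x] U(5)[OF x1] V(5)[OF x1]
        U(3)[OF x1, unfolded F[OF x]] V(3)[OF x1, unfolded G[OF x]]]
      unfolding h_eq[abs_def] by metis
    have "0 < (R x - Q x) * \<bar>u x\<bar> powr p"
      using QR[OF x] u[OF x] by simp
    moreover have "(H has_real_derivative D) (at x)"
      by (rule DERIV_cong_ev[THEN iffD1, OF refl _ refl D(1)])
        (use x in \<open>auto simp: H_def eventually_nhds intro!: exI[of _ "{c<..<d}"]\<close>)
    ultimately show ?thesis
      using D(2) by (intro exI[of _ D]) auto
  qed
  have "continuous_on {c..d} H"
  proof (rule continuous_on_IccI)
    have c: "(h \<longlongrightarrow> 0) (at c within {c<..<d})" and d: "(h \<longlongrightarrow> 0) (at d within {c<..<d})"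
      unfolding h_def using cd u0 simple sub
      by (intro picone_boundary[OF p] U V; simp)+
    show "(H \<longlongrightarrow> H c) (at_right c)"
    proof -
      have e: "at_right c = at c within {c<..<d}"
        by (rule at_within_nhd[of c "{..<d}"]) (use cd in auto)
      have "((\<lambda>x. H x) \<longlongrightarrow> 0) (at c within {c<..<d})"
        by (rule Lim_transform_eventually[OF c]) (auto simp: eventually_at_filter H_def)
      then show ?thesis
        using cd by (simp add: e H_def[of c] H_def[of d])
    qed
    show "(H \<longlongrightarrow> H d) (at_left d)"
    proof -
      have e: "at_left d = at d within {c<..<d}"
        by (rule at_within_nhd[of d "{c<..}"]) (use cd in auto)
      have "((\<lambda>x. H x) \<longlongrightarrow> 0) (at d within {c<..<d})"
        by (rule Lim_transform_eventually[OF d]) (auto simp: eventually_at_filter H_def)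
      then show ?thesis
        using cd by (simp add: e H_def[of c] H_def[of d])
    qed
    show "(H \<longlongrightarrow> H x) (at x)" if "c < x" "x < d" for x
      using deriv[of x] that DERIV_isCont isContD by (meson greaterThanLessThan_iff)
  qed (use cd in simp)
  moreover have "H c = H d"
    by (simp add: H_def)
  ultimately obtain x where x: "c < x" "x < d" and "(H has_real_derivative 0) (at x)"
    using Rolle[of c d H] cd deriv by (metis real_differentiable_def greaterThanLessThan_iff)
  moreover obtain D where "0 < D" "(H has_real_derivative D) (at x)"
    using deriv[of x] x by auto
  ultimately show False
    using DERIV_unique by fastforce
qed

section \<open>Zeros and sign alternations\<close>

text \<open>This and \<open>alternates\<close> both say that a function with $u(0) = 0$ that is positive near $0$ has at
  least $n$ further zeros up to $b$. Limits of solutions preserve \<open>zero_chain\<close>, while \<open>alternates\<close> is stable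
  under small perturbations. If the zeros are simple, the two conditions differ only in a zero at $b$ itself, which
  counts for the former alone; the shooting argument lives on this difference. The zeros of a chain need not be
  consecutive.\<close>

definition zero_chain :: "nat \<Rightarrow> real \<Rightarrow> (real \<Rightarrow> real) \<Rightarrow> bool" where
  "zero_chain n b u \<longleftrightarrow>
     (\<exists>z. z 0 = 0 \<and> (\<forall>i<n. z i < z (Suc i)) \<and> (\<forall>i\<le>n. u (z i) = 0) \<and> z n \<le> b)"

definition alternates :: "nat \<Rightarrow> real \<Rightarrow> (real \<Rightarrow> real) \<Rightarrow> bool" where
  "alternates n b u \<longleftrightarrow>
     (\<exists>s. (\<forall>i<n. s i < s (Suc i)) \<and> (\<forall>i\<le>n. 0 \<le> s i \<and> s i < b \<and> 0 < (-1) ^ i * u (s i)))"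

lemma step_mono:
  fixes z :: "nat \<Rightarrow> real"
  assumes "\<forall>i<n. z i < z (Suc i)"
  shows "i \<le> j \<Longrightarrow> j \<le> n \<Longrightarrow> z i \<le> z j" and "i < j \<Longrightarrow> j \<le> n \<Longrightarrow> z i < z j"
proof -
  show *: "z i < z j" if "i < j" "j \<le> n" for i j
    using that
  proof (induction j)
    case (Suc j)
    have "z j < z (Suc j)" using Suc.prems assms by simp
    moreover have "i < j \<Longrightarrow> z i < z j" using Suc by simp
    moreover have "i = j \<or> i < j" using Suc.prems by auto
    ultimately show ?case by force
  qed simp
  show "z i \<le> z j" if "i \<le> j" "j \<le> n" 
    using *[of i j] that by (cases "i = j") auto
qed

lemma alternates_imp_zeros_between:
  assumes u: "continuous_on {0..1} u" and u0: "u 0 = 0" and b: "b \<le> 1" and alt: "alternates n b u"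
  shows "\<exists>z s. z 0 = 0 \<and> (\<forall>i\<le>n. u (z i) = 0 \<and> z i < s i \<and> 0 < (-1) ^ i * u (s i)) \<and>
    (\<forall>i<n. s i < z (Suc i)) \<and> s n < b"
proof -
  obtain s where s: "\<forall>i<n. s i < s (Suc i)"
    "\<And>i. i \<le> n \<Longrightarrow> 0 \<le> s i \<and> s i < b \<and> 0 < (-1) ^ i * u (s i)"
    using alt by (auto simp: alternates_def)
  have "\<exists>x. s i < x \<and> x < s (Suc i) \<and> u x = 0" if i: "i < n" for i
  proof -
    define g where "g x = (-1) ^ i * u x" for x
    have cg: "continuous_on {s i..s (Suc i)} g"
      unfolding g_def using s(2)[of i] s(2)[of "Suc i"] i b
      by (intro continuous_intros continuous_on_subset[OF u]) auto
    have pos: "0 < g (s i)" "g (s (Suc i)) < 0"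
      using s(2)[of i] s(2)[of "Suc i"] i by (auto simp: g_def)
    obtain x where x: "s i \<le> x" "x \<le> s (Suc i)" "g x = 0"
      using IVT2'[of g "s (Suc i)" 0 "s i"] pos cg s(1) i by (auto intro: less_imp_le)
    then have "x \<noteq> s i" "x \<noteq> s (Suc i)"
      using pos by auto
    moreover have "u x = 0"
      using x(3) by (simp add: g_def)
    ultimately show ?thesis
      using x by (intro exI[of _ x]) auto
  qed
  then obtain y where y: "\<And>i. i < n \<Longrightarrow> s i < y i \<and> y i < s (Suc i) \<and> u (y i) = 0"
    by metis
  define z where "z i = (case i of 0 \<Rightarrow> 0 | Suc j \<Rightarrow> y j)" for i
  have "0 < s 0"
    using s(2)[of 0] u0 by (cases "s 0 = 0") auto
  have "u (z i) = 0 \<and> z i < s i" if "i \<le> n" for i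
    using that y[of "i - 1"] u0 \<open>0 < s 0\<close> by (auto simp: z_def split: nat.split)
  moreover have "s i < z (Suc i)" if "i < n" for i
    using y[OF that] by (simp add: z_def)
  ultimately show ?thesis
    using s by (intro exI[of _ z] exI[of _ s]) (simp add: z_def)
qed

lemma alternates_imp_zero_chain:
  assumes "continuous_on {0..1} u" and "u 0 = 0" and "alternates n 1 u"
  shows "zero_chain n 1 u"
proof -
  obtain z s where z: "z 0 = (0::real)" "\<forall>i\<le>n. u (z i) = 0 \<and> z i < s i" "\<forall>i<n. s i < z (Suc i)" "s n < 1"
    using alternates_imp_zeros_between[OF assms(1,2) order_refl assms(3)] by blast
  then have "\<forall>i<n. z i < z (Suc i)"
    by (meson less_imp_le order_less_trans)
  moreover have "z n \<le> 1"
    using z by (meson less_imp_le order_less_trans order_refl)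
  ultimately show ?thesis
    unfolding zero_chain_def using z by blast
qed

text \<open>What is used of a simple interior zero: the function changes sign there at arbitrarily small scale.\<close>

definition crosses :: "(real \<Rightarrow> real) \<Rightarrow> bool" where
  "crosses u \<longleftrightarrow> (\<forall>x\<in>{0<..<1}. u x = 0 \<longrightarrow>
     (\<forall>e>0. \<exists>y z. x - e < y \<and> y < x \<and> x < z \<and> z < x + e \<and> u y * u z < 0))"

lemma crosses_of_deriv:
  assumes "\<And>x. x \<in> {0<..<1} \<Longrightarrow> u x = 0 \<Longrightarrow> \<exists>D. D \<noteq> 0 \<and> (u has_real_derivative D) (at x)"
  shows "crosses u"
  unfolding crosses_def
proof (intro ballI impI allI)
  fix x e :: real
  assume x: "x \<in> {0<..<1}" "u x = 0" and e: "0 < e"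
  obtain D where D: "D \<noteq> 0" "(u has_real_derivative D) (at x)"
    using assms[OF x] by blast
  have "\<exists>y z. x - e < y \<and> y < x \<and> x < z \<and> z < x + e \<and> v y < 0 \<and> 0 < v z"
    if v: "(v has_real_derivative D) (at x)" "0 < D" "v x = 0" for v :: "real \<Rightarrow> real" and D
  proof -
    obtain d where d: "0 < d" "\<And>h. 0 < h \<Longrightarrow> h < d \<Longrightarrow> v x < v (x + h)"
      using DERIV_pos_inc_right[OF v(1,2)] by auto
    obtain d' where d': "0 < d'" "\<And>h. 0 < h \<Longrightarrow> h < d' \<Longrightarrow> v (x - h) < v x"
      using DERIV_pos_inc_left[OF v(1,2)] by auto
    define h where "h = min (min d d') e / 2"
    have "0 < h" "h < d" "h < d'" "h < e"
      using d(1) d'(1) e by (auto simp: h_def min_def)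
    then show ?thesis
      using d(2)[of h] d'(2)[of h] v(3) by (intro exI[of _ "x - h"] exI[of _ "x + h"]) auto
  qed
  note * = this
  show "\<exists>y z. x - e < y \<and> y < x \<and> x < z \<and> z < x + e \<and> u y * u z < 0"
  proof (cases "0 < D")
    case True
    from *[OF D(2) True x(2)] show ?thesis
      by (metis mult_neg_pos)
  next
    case False
    have "((\<lambda>x. - u x) has_real_derivative - D) (at x)"
      using D(2) by (rule DERIV_minus)
    from *[OF this] False D(1) x(2) show ?thesis
      by (auto intro!: mult_pos_neg)
  qed
qed

text \<open>Induction on the chain: an alternating sequence that ends before the next zero is prolonged by
  a point next to that zero. On the two sides of the zero the signs differ, so one side has the sign that is needed,
  and the parity of the zeros skipped by the chain never enters.\<close>

lemma zero_chain_imp_alternates: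
  assumes cr: "crosses u" and pos: "\<forall>\<^sub>F x in at_right 0. 0 < u x"
    and z: "z 0 = (0::real)" "\<forall>i<n. z i < z (Suc i)" "\<forall>i\<le>n. u (z i) = 0" "z n < b" "b \<le> 1"
  shows "alternates n b u"
  using z(2-5)
proof (induction n arbitrary: b)
  case 0
  obtain d where d: "0 < d" "\<And>x. 0 < x \<Longrightarrow> x < d \<Longrightarrow> 0 < u x"
    using pos by (auto simp: eventually_at_right_field)
  define x where "x = min d b / 2"
  have "0 < x" "x < d" "x < b"
    using d(1) 0 z(1) by (auto simp: x_def min_def)
  then show ?case
    using d(2)[of x] unfolding alternates_def by (intro exI[of _ "\<lambda>_. x"]) auto
next
  case (Suc n)
  have "alternates n (z (Suc n)) u"
    using Suc by simp
  then obtain s where s: "\<forall>i<n. s i < s (Suc i)"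
    "\<And>i. i \<le> n \<Longrightarrow> 0 \<le> s i \<and> s i < z (Suc n) \<and> 0 < (-1) ^ i * u (s i)"
    by (auto simp: alternates_def)
  define x where "x = z (Suc n)"
  define e where "e = min (x - s n) (b - x)"
  have sn: "0 \<le> s n" "s n < x"
    using s(2)[of n] by (simp_all add: x_def)
  have e: "0 < e"
    using sn Suc.prems by (simp add: e_def x_def)
  have x: "x \<in> {0<..<1}" "u x = 0"
    using sn Suc.prems by (auto simp: x_def)
  from cr x e obtain y w where yw: "x - e < y" "y < x" "x < w" "w < x + e" "u y * u w < 0"
    unfolding crosses_def by blast
  have "0 < (-1) ^ Suc n * u y \<or> 0 < (-1) ^ Suc n * u w"
    using yw(5) by (cases "even n") (auto simp: mult_less_0_iff)
  then obtain t where t: "0 < (-1) ^ Suc n * u t" "s n < t" "t < b"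
    using yw unfolding e_def by (smt (verit))
  define s' where "s' = s(Suc n := t)"
  show ?case
    unfolding alternates_def
  proof (intro exI[of _ s'] conjI allI impI)
    fix i
    show "i < Suc n \<Longrightarrow> s' i < s' (Suc i)"
      using s(1) t by (auto simp: s'_def less_Suc_eq)
    assume i: "i \<le> Suc n"
    show "0 \<le> s' i" "s' i < b" "0 < (-1) ^ i * u (s' i)"
      using s(2)[of i] t i sn Suc.prems(3) by (auto simp: s'_def le_Suc_eq x_def)
  qed
qed

lemma enumerate_zeros:
  assumes u0: "u 0 = 0" and Z: "finite Z" "card Z = n" "Z \<subseteq> interior_zeros u"
  shows "\<exists>z. z 0 = (0::real) \<and> (\<forall>i<n. z i < z (Suc i)) \<and> (\<forall>i\<le>n. u (z i) = 0) \<and> z n < 1"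
proof -
  define l where "l = sorted_list_of_set Z"
  have l: "sorted_wrt (<) l" "set l = Z" "length l = n"
    using Z by (simp_all add: l_def)
  define z where "z i = (case i of 0 \<Rightarrow> 0 | Suc j \<Rightarrow> l ! j)" for i
  have m: "l ! j \<in> interior_zeros u" if "j < n" for j
    using l Z(3) that nth_mem by blast
  have "z i < z (Suc i)" if "i < n" for i
  proof (cases i)
    case 0
    then show ?thesis using m[of 0] that by (simp add: z_def interior_zeros_def)
  next
    case (Suc j)
    then show ?thesis
      using sorted_wrt_nth_less[OF l(1), of j "Suc j"] that l by (simp add: z_def)
  qed
  moreover have "u (z i) = 0" if "i \<le> n" for i
    using m[of "i - 1"] that u0 by (cases i) (auto simp: z_def interior_zeros_def)
  moreover have "z n < 1"
    using m[of "n - 1"] by (cases n) (auto simp: z_def interior_zeros_def)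
  ultimately show ?thesis
    by (intro exI[of _ z]) (simp add: z_def)
qed

text \<open>A chain that ends before 1 would produce the forbidden sign changes, so its last zero is 1; and any
  $k$ interior zeros would form such a chain.\<close>

lemma exact_zeros:
  assumes u0: "u 0 = 0" and cr: "crosses u" and pos: "\<forall>\<^sub>F x in at_right 0. 0 < u x"
    and k: "1 \<le> k" and zc: "zero_chain k 1 u" and na: "\<not> alternates k 1 u"
  shows "u 1 = 0" "finite (interior_zeros u)" "card (interior_zeros u) = k - 1"
proof -
  obtain z where z: "z 0 = 0" "\<forall>i<k. z i < z (Suc i)" "\<forall>i\<le>k. u (z i) = 0" "z k \<le> 1"
    using zc by (auto simp: zero_chain_def)
  have zk: "z k = 1"
  proof (rule ccontr)
    assume "z k \<noteq> 1"
    then have "z k < 1" using z(4) by simp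
    from zero_chain_imp_alternates[OF cr pos z(1,2,3) this order_refl] na show False by simp
  qed
  then show "u 1 = 0" using z by auto
  have few: False if "finite Z" "card Z = k" "Z \<subseteq> interior_zeros u" for Z
    using enumerate_zeros[OF u0 that] zero_chain_imp_alternates[OF cr pos] na by blast
  show fin: "finite (interior_zeros u)"
    using few infinite_arbitrarily_large[of "interior_zeros u" k] by blast
  have "card (interior_zeros u) < k"
    by (rule ccontr) (use few obtain_subset_with_card_n[of k "interior_zeros u"] in \<open>auto simp: not_less\<close>)
  moreover have "k - 1 \<le> card (interior_zeros u)"
  proof -
    have "inj_on z {1..<k}"
      by (rule linorder_inj_onI') (use step_mono(2)[OF z(2)] in \<open>force\<close>)
    moreover have "z ` {1..<k} \<subseteq> interior_zeros u"
      using z step_mono(2)[OF z(2), of 0] step_mono(2)[OF z(2), of _ k] zk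
      by (auto simp: interior_zeros_def)
    ultimately show ?thesis
      using card_mono[OF fin, of "z ` {1..<k}"] by (simp add: card_image)
  qed
  ultimately show "card (interior_zeros u) = k - 1" by simp
qed

lemma alternates_imp_many_zeros:
  assumes u: "continuous_on {0..1} u" and u0: "u 0 = 0" and k: "1 \<le> k" and alt: "alternates k 1 u"
    and fin: "finite (interior_zeros u)"
  shows "card (interior_zeros u) \<noteq> k - 1"
proof -
  obtain z s where z: "z 0 = (0::real)" "\<forall>i\<le>k. u (z i) = 0 \<and> z i < s i" "\<forall>i<k. s i < z (Suc i)" "s k < 1"
    using alternates_imp_zeros_between[OF u u0 order_refl alt] by blast
  have m: "\<forall>i<k. z i < z (Suc i)"
    using z by (meson less_imp_le order_less_trans)
  have "inj_on z {1..k}"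
    by (rule linorder_inj_onI') (use step_mono(2)[OF m] in \<open>force\<close>)
  moreover have "z ` {1..k} \<subseteq> interior_zeros u"
    using z step_mono(2)[OF m, of 0] step_mono(1)[OF m, of _ k]
    by (force simp: interior_zeros_def)
  ultimately have "k \<le> card (interior_zeros u)"
    using card_mono[OF fin, of "z ` {1..k}"] by (simp add: card_image)
  then show ?thesis using k by simp
qed

text \<open>Sign changes of the limit are finitely many strict inequalities at fixed points, hence they are
  inherited from the limit by late members of the sequence.\<close>

lemma not_alternates_limit:
  assumes "\<And>n. \<not> alternates k b (us n)" and lim: "\<And>x. 0 \<le> x \<Longrightarrow> x < b \<Longrightarrow> (\<lambda>n. us n x) \<longlonglongrightarrow> u x"
  shows "\<not> alternates k b u"
proof
  assume "alternates k b u"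
  then obtain s where s: "\<forall>i<k. s i < s (Suc i)"
    "\<And>i. i \<le> k \<Longrightarrow> 0 \<le> s i \<and> s i < b \<and> 0 < (-1) ^ i * u (s i)"
    by (auto simp: alternates_def)
  have "\<forall>\<^sub>F n in sequentially. 0 < (-1) ^ i * us n (s i)" if "i \<le> k" for i
  proof -
    have "(\<lambda>n. (-1) ^ i * us n (s i)) \<longlonglongrightarrow> (-1) ^ i * u (s i)"
      using lim[of "s i"] s(2)[OF that] by (intro tendsto_intros) auto
    from order_tendstoD(1)[OF this, of 0] show ?thesis
      using s(2)[OF that] by blast
  qed
  then have "\<forall>\<^sub>F n in sequentially. \<forall>i\<in>{..k}. 0 < (-1) ^ i * us n (s i)"
    by (intro eventually_ball_finite) auto
  then obtain n where "\<forall>i\<in>{..k}. 0 < (-1) ^ i * us n (s i)"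
    by (auto simp: eventually_sequentially)
  then have "alternates k b (us n)"
    using s unfolding alternates_def by (intro exI[of _ s]) auto
  with assms(1) show False by blast
qed

lemma uniform_limit_diagonal:
  fixes f :: "nat \<Rightarrow> real \<Rightarrow> 'b::metric_space"
  assumes "uniform_limit X f g sequentially" "continuous_on X g" "x \<in> X" "\<And>n. xs n \<in> X" "xs \<longlonglongrightarrow> x"
  shows "(\<lambda>n. f n (xs n)) \<longlonglongrightarrow> g x"
proof (rule tendstoI)
  fix e :: real assume "0 < e"
  have "(\<lambda>n. g (xs n)) \<longlonglongrightarrow> g x"
    using assms by (intro continuous_on_tendsto_compose[OF assms(2)]) auto
  then have "\<forall>\<^sub>F n in sequentially. dist (g (xs n)) (g x) < e / 2"
    using \<open>0 < e\<close> by (intro tendstoD) auto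
  moreover have "\<forall>\<^sub>F n in sequentially. \<forall>y\<in>X. dist (f n y) (g y) < e / 2"
    using assms(1) \<open>0 < e\<close> by (intro uniform_limitD) auto
  ultimately show "\<forall>\<^sub>F n in sequentially. dist (f n (xs n)) (g x) < e"
  proof eventually_elim
    case (elim n)
    then have "dist (f n (xs n)) (g (xs n)) < e / 2" using assms(4) by blast
    with elim(1) show ?case
      using dist_triangle[of "f n (xs n)" "g x" "g (xs n)"] by simp
  qed
qed

text \<open>Sequential compactness of a countable product of intervals, used to pass to the limit in all zeros
  of a chain at once.\<close>

lemma bounded_sequences_subseq:
  fixes zs :: "nat \<Rightarrow> nat \<Rightarrow> real"
  assumes "\<And>n i. zs n i \<in> {0..1}"
  shows "\<exists>r z. strict_mono (r :: nat \<Rightarrow> nat) \<and> (\<forall>i. (\<lambda>n. zs (r n) i) \<longlonglongrightarrow> z i)"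
proof -
  have "compact (PiE UNIV (\<lambda>_::nat. {0..1::real}))"
    using compactin_PiE[of "\<lambda>_::nat. euclidean" UNIV "\<lambda>_. {0..1::real}"]
    by (simp add: euclidean_product_topology)
  then have "seq_compact (PiE UNIV (\<lambda>_::nat. {0..1::real}))"
    by (simp add: compact_eq_seq_compact_metric)
  then obtain z r where "strict_mono (r :: nat \<Rightarrow> nat)" "(zs \<circ> r) \<longlonglongrightarrow> z"
    using assms unfolding seq_compact_def by (metis PiE_UNIV_domain PiE_iff iso_tuple_UNIV_I extensional_UNIV)
  moreover have "(\<lambda>n. zs (r n) i) \<longlonglongrightarrow> z i" for i
    using continuous_on_tendsto_compose[OF continuous_on_product_coordinates[of i] \<open>(zs \<circ> r) \<longlonglongrightarrow> z\<close>]
    by (simp add: o_def)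
  ultimately show ?thesis by blast
qed

section \<open>Connectedness of the solution funnel\<close>

text \<open>On $[0,1]$ this is the length of the part of the cell $[j/n, (j+1)/n]$ that lies to the left of $t$. It
  makes an Euler polygon a finite sum of fixed functions of $t$ with the slopes as coefficients.\<close>

definition cell :: "nat \<Rightarrow> nat \<Rightarrow> real \<Rightarrow> real" where
  "cell n j t = min t (real (Suc j) / real n) - min t (real j / real n)"

lemma cell_mono:
  assumes "s \<le> t"
  shows "cell n j s \<le> cell n j t"
proof -
  have "real j / real n \<le> real (Suc j) / real n"
    by (simp add: divide_right_mono)
  then show ?thesis
    using assms unfolding cell_def min_def by (simp split: if_splits)
qed

lemma sum_cell:
  assumes "0 \<le> t" "t \<le> 1" "0 < n"
  shows "(\<Sum>j<n. cell n j t) = t"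
proof -
  have "(\<Sum>j<m. cell n j t) = min t (real m / real n) - min t (real 0 / real n)" for m
    unfolding cell_def by (rule sum_lessThan_telescope)
  then show ?thesis
    using assms by simp
qed

text \<open>The increments of the cell functions are nonnegative and add up to $t - s$, so the sum is $t - s$
  times an average of those $g_j$ whose cell meets $[s,t]$.\<close>

lemma sum_cell_diff_le:
  fixes g :: "nat \<Rightarrow> 'a::real_normed_vector"
  assumes st: "0 \<le> s" "s \<le> t" "t \<le> 1" and n: "0 < n"
    and g: "\<And>j. j < n \<Longrightarrow> real j / n \<le> t \<Longrightarrow> s \<le> real (Suc j) / n \<Longrightarrow> norm (g j) \<le> M"
  shows "norm (\<Sum>j<n. (cell n j t - cell n j s) *\<^sub>R g j) \<le> (t - s) * M"
proof -
  have "norm ((cell n j t - cell n j s) *\<^sub>R g j) \<le> (cell n j t - cell n j s) * M" if "j < n" for j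
  proof (cases "real j / n \<le> t \<and> s \<le> real (Suc j) / n")
    case True
    then show ?thesis
      using g[OF that] cell_mono[OF st(2), of n j] by (simp add: mult_left_mono)
  next
    case False
    have "real j / n \<le> real (Suc j) / n"
      by (simp add: divide_right_mono)
    then have "cell n j t = cell n j s"
      using False st(2) unfolding cell_def by (auto simp: min_def)
    then show ?thesis by simp
  qed
  then have "norm (\<Sum>j<n. (cell n j t - cell n j s) *\<^sub>R g j) \<le> (\<Sum>j<n. (cell n j t - cell n j s) * M)"
    by (intro sum_norm_le) auto
  also have "\<dots> = (t - s) * M"
    using st n by (simp add: sum_distrib_right[symmetric] sum_subtractf sum_cell)
  finally show ?thesis .
qed

fun euler_node :: "(real \<Rightarrow> real \<Rightarrow> 'a \<Rightarrow> 'a) \<Rightarrow> 'a::real_normed_vector \<Rightarrow> nat \<Rightarrow> real \<Rightarrow> nat \<Rightarrow> 'a" where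
  "euler_node G y0 n \<tau> 0 = y0"
| "euler_node G y0 n \<tau> (Suc j) =
     euler_node G y0 n \<tau> j + (1 / real n) *\<^sub>R G \<tau> (real j / real n) (euler_node G y0 n \<tau> j)"

definition euler_slope :: "(real \<Rightarrow> real \<Rightarrow> 'a \<Rightarrow> 'a) \<Rightarrow> 'a::real_normed_vector \<Rightarrow> nat \<Rightarrow> real \<Rightarrow> nat \<Rightarrow> 'a" where
  "euler_slope G y0 n \<tau> j = G \<tau> (real j / real n) (euler_node G y0 n \<tau> j)"

definition euler :: "(real \<Rightarrow> real \<Rightarrow> 'a \<Rightarrow> 'a) \<Rightarrow> 'a::real_normed_vector \<Rightarrow> nat \<Rightarrow> real \<Rightarrow> real \<Rightarrow> 'a" where
  "euler G y0 n \<tau> t = y0 + (\<Sum>j<n. cell n j t *\<^sub>R euler_slope G y0 n \<tau> j)"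

lemma euler_at_node:
  assumes "i \<le> n" "0 < n"
  shows "euler G y0 n \<tau> (real i / real n) = euler_node G y0 n \<tau> i"
proof -
  have c: "cell n j (real i / real n) = (if j < i then 1 / real n else 0)" for j
  proof (cases "j < i")
    case True
    then have "real j / n \<le> real i / n" "real (Suc j) / n \<le> real i / n"
      by (intro divide_right_mono; simp)+
    then show ?thesis
      using True by (simp add: cell_def min_def add_divide_distrib)
  next
    case False
    then have "real i / n \<le> real j / n" "real i / n \<le> real (Suc j) / n"
      by (intro divide_right_mono; simp)+
    then show ?thesis
      using False by (simp add: cell_def min_def)
  qed
  have "(\<Sum>j<n. cell n j (real i / real n) *\<^sub>R euler_slope G y0 n \<tau> j)
      = (\<Sum>j<i. (1 / real n) *\<^sub>R euler_slope G y0 n \<tau> j)"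
    unfolding c using assms(1) by (intro sum.mono_neutral_cong_right) auto
  moreover have "y0 + (\<Sum>j<i. (1 / real n) *\<^sub>R euler_slope G y0 n \<tau> j) = euler_node G y0 n \<tau> i"
    by (induction i) (simp_all add: euler_slope_def add.assoc[symmetric])
  ultimately show ?thesis
    by (simp add: euler_def)
qed

locale bounded_family =
  fixes G :: "real \<Rightarrow> real \<Rightarrow> 'a::euclidean_space \<Rightarrow> 'a" and M :: real and y0 :: 'a
  assumes G_cont: "continuous_on ({0..1} \<times> {0..1} \<times> UNIV) (\<lambda>(\<tau>, t, y). G \<tau> t y)"
    and G_bound: "\<And>\<tau> t y. \<tau> \<in> {0..1} \<Longrightarrow> t \<in> {0..1} \<Longrightarrow> norm (G \<tau> t y) \<le> M"
begin

abbreviation Y :: "nat \<Rightarrow> real \<Rightarrow> real \<Rightarrow> 'a" where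
  "Y \<equiv> euler G y0"

definition solves :: "real \<Rightarrow> (real \<Rightarrow> 'a) \<Rightarrow> bool" where
  "solves \<tau> y \<longleftrightarrow> y 0 = y0 \<and> (\<forall>t\<in>{0..1}. (y has_vector_derivative G \<tau> t (y t)) (at t within {0..1}))"

lemma M_nonneg: "0 \<le> M"
  by (rule order_trans[OF norm_ge_zero G_bound[of 0 0 y0]]) auto

lemma node_in: "j < n \<Longrightarrow> real j / real n \<in> {0..1}"
  by (simp add: field_simps)

lemma slope_bound: "\<tau> \<in> {0..1} \<Longrightarrow> j < n \<Longrightarrow> norm (euler_slope G y0 n \<tau> j) \<le> M"
  unfolding euler_slope_def by (intro G_bound node_in)

lemma euler_diff:
  "Y n \<tau> t - Y n \<tau> s = (\<Sum>j<n. (cell n j t - cell n j s) *\<^sub>R euler_slope G y0 n \<tau> j)"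
  by (simp add: euler_def sum_subtractf[symmetric] scaleR_diff_left)

lemma euler_lipschitz:
  assumes "\<tau> \<in> {0..1}" "s \<in> {0..1}" "t \<in> {0..1}" "0 < n"
  shows "norm (Y n \<tau> t - Y n \<tau> s) \<le> M * \<bar>t - s\<bar>"
proof -
  have *: "norm (Y n \<tau> t - Y n \<tau> s) \<le> M * (t - s)" if "s \<le> t" "s \<in> {0..1}" "t \<in> {0..1}" for s t
    unfolding euler_diff
    using sum_cell_diff_le[of s t n "euler_slope G y0 n \<tau>" M] that assms slope_bound
    by (simp add: mult.commute)
  show ?thesis
    using *[of s t] *[of t s] assms by (cases "s \<le> t") (auto simp: norm_minus_commute)
qed

lemma euler_0: "0 < n \<Longrightarrow> Y n \<tau> 0 = y0"
  using euler_at_node[of 0 n G y0 \<tau>] by simp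

lemma slope_continuous: "j \<le> n \<Longrightarrow> continuous_on {0..1} (\<lambda>\<tau>. euler_node G y0 n \<tau> j)"
  "j < n \<Longrightarrow> continuous_on {0..1} (\<lambda>\<tau>. euler_slope G y0 n \<tau> j)"
proof -
  have s: "continuous_on {0..1} (\<lambda>\<tau>. G \<tau> (real j / real n) (e \<tau>))"
    if "continuous_on {0..1} e" "j < n" for e j
  proof -
    have "continuous_on {0..1} (\<lambda>\<tau>. (\<lambda>(\<tau>, t, y). G \<tau> t y) (\<tau>, real j / real n, e \<tau>))"
      using node_in[OF that(2)] by (intro continuous_on_compose2[OF G_cont] continuous_intros that) auto
    then show ?thesis by simp
  qed
  show n: "continuous_on {0..1} (\<lambda>\<tau>. euler_node G y0 n \<tau> j)" if "j \<le> n" for j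
    using that by (induction j) (auto intro!: continuous_intros s)
  show "j < n \<Longrightarrow> continuous_on {0..1} (\<lambda>\<tau>. euler_slope G y0 n \<tau> j)"
    unfolding euler_slope_def by (intro s n) auto
qed

text \<open>Near a point $x$ the slopes of late polygons are values of $G$ at points close to
  $(\tau, x, g(x))$. Difference quotients of a polygon are averages of its slopes, so those of the limit tend to
  $G_\tau(x, g(x))$.\<close>

lemma euler_limit_solves:
  assumes \<tau>s: "\<And>n. \<tau>s n \<in> {0..1}" and \<tau>: "\<tau>s \<longlonglongrightarrow> \<tau>" and r: "filterlim r at_top sequentially"
    and lim: "uniform_limit {0..1} (\<lambda>n. Y (r n) (\<tau>s n)) g sequentially"
    and g: "continuous_on {0..1} g"
  shows "\<tau> \<in> {0..1}" "solves \<tau> g"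
proof -
  have "\<forall>n\<ge>0. \<tau>s n \<in> {0..1}" using \<tau>s by blast
  then show \<tau>01: "\<tau> \<in> {0..1}"
    by (intro closed_sequentially[OF closed_atLeastAtMost _ \<tau>]) auto
  have rpos: "\<forall>\<^sub>F n in sequentially. N < r n" for N
    using r[unfolded filterlim_at_top, rule_format, of "Suc N"]
    by (simp add: Suc_le_eq)
  have ptlim: "(\<lambda>n. Y (r n) (\<tau>s n) t) \<longlonglongrightarrow> g t" if "t \<in> {0..1}" for t
    using lim that by (rule tendsto_uniform_limitI)
  have "(\<lambda>n. Y (r n) (\<tau>s n) 0) \<longlonglongrightarrow> y0"
    by (rule tendsto_eventually) (use rpos[of 0] in \<open>auto elim!: eventually_mono simp: euler_0\<close>)
  with ptlim[of 0] have g0: "g 0 = y0"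
    using LIMSEQ_unique by auto
  have "(g has_vector_derivative G \<tau> x (g x)) (at x within {0..1})" if x: "x \<in> {0..1}" for x
    unfolding has_vector_derivative_def has_derivative_within_alt
  proof (intro conjI allI impI bounded_linear_scaleR_left)
    fix e :: real assume e: "0 < e"
    \<comment> \<open>near x all slopes of late polygons are close to the slope of the limit\<close>
    have "(\<tau>, x, g x) \<in> {0..1} \<times> {0..1} \<times> UNIV" using x \<tau>01 by simp
    then obtain d where d: "0 < d" and dG: "\<And>\<tau>' t y. \<tau>' \<in> {0..1} \<Longrightarrow> t \<in> {0..1} \<Longrightarrow>
        dist (\<tau>', t, y) (\<tau>, x, g x) < d \<Longrightarrow> dist (G \<tau>' t y) (G \<tau> x (g x)) < e"
    proof -
      from G_cont[unfolded continuous_on_iff, rule_format, OF \<open>(\<tau>, x, g x) \<in> _\<close> e]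
      obtain d where "0 < d" "\<forall>z\<in>{0..1} \<times> {0..1} \<times> UNIV. dist z (\<tau>, x, g x) < d \<longrightarrow>
          dist (case z of (\<tau>, t, y) \<Rightarrow> G \<tau> t y) (G \<tau> x (g x)) < e"
        by auto
      then show thesis
        by (intro that[of d]) (auto dest!: bspec)
    qed
    have small: "dist (\<tau>', t, y) (\<tau>, x, g x) < d"
      if "dist \<tau>' \<tau> < d / 3" "dist t x < d / 3" "dist y (g x) < d / 3" for \<tau>' t y
    proof -
      have "dist (\<tau>', t, y) (\<tau>, x, g x) \<le> dist \<tau>' \<tau> + dist (t, y) (x, g x)"
        unfolding dist_Pair_Pair by (rule order_trans[OF sqrt_sum_squares_le_sum]) auto
      also have "dist (t, y) (x, g x) \<le> dist t x + dist y (g x)"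
        unfolding dist_Pair_Pair by (rule sqrt_sum_squares_le_sum) auto
      finally show ?thesis using that by linarith
    qed
    \<comment> \<open>within distance \<open>2 * \<eta>\<close> of \<open>x\<close> the polygons vary by at most \<open>d / 6\<close>, as they are \<open>M\<close>-Lipschitz\<close>
    define b where "b = d / 3 / (2 * (M + 1))"
    define \<eta> where "\<eta> = min (d / 3) b / 2"
    have b: "0 < b" "M * (2 * b) \<le> d / 3"
    proof -
      show "0 < b"
        using d M_nonneg by (simp add: b_def)
      have "M * (2 * b) \<le> (M + 1) * (2 * b)"
        using \<open>0 < b\<close> by simp
      also have "\<dots> = d / 3"
        using iffD1[OF nonzero_eq_divide_eq[of "2 * (M + 1)" b "d / 3"] b_def] M_nonneg
        by (simp add: mult_ac)
      finally show "M * (2 * b) \<le> d / 3" by simp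
    qed
    have \<eta>: "0 < \<eta>" "2 * \<eta> \<le> d / 3" "2 * \<eta> \<le> b"
      using d b(1) unfolding \<eta>_def by (simp_all add: min_def)
    have small_M: "M * (2 * \<eta>) \<le> d / 6"
    proof -
      have "M * (2 * \<eta>) \<le> M * b"
        using \<eta>(3) M_nonneg by (rule mult_left_mono)
      then show ?thesis using b(2) by simp
    qed
    have ev: "\<forall>\<^sub>F n in sequentially. dist (\<tau>s n) \<tau> < d / 3 \<and> dist (Y (r n) (\<tau>s n) x) (g x) < d / 6
        \<and> max 0 (1 / \<eta>) < real (r n)"
    proof (intro eventually_conj)
      show "\<forall>\<^sub>F n in sequentially. dist (\<tau>s n) \<tau> < d / 3"
        by (rule tendstoD[OF \<tau>]) (use d in simp)
      show "\<forall>\<^sub>F n in sequentially. dist (Y (r n) (\<tau>s n) x) (g x) < d / 6"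
        by (rule tendstoD[OF ptlim[OF x]]) (use d in simp)
      obtain N where N: "max 0 (1 / \<eta>) < real N"
        using reals_Archimedean2 by blast
      show "\<forall>\<^sub>F n in sequentially. max 0 (1 / \<eta>) < real (r n)"
        using rpos[of N] by eventually_elim (use N in linarith)
    qed
    have step: "norm (g t - g s - (t - s) *\<^sub>R G \<tau> x (g x)) \<le> (t - s) * e"
      if st: "0 \<le> s" "s \<le> t" "t \<le> 1" "\<bar>s - x\<bar> < \<eta>" "\<bar>t - x\<bar> < \<eta>" for s t
    proof (rule tendsto_upperbound)
      show "(\<lambda>n. norm (Y (r n) (\<tau>s n) t - Y (r n) (\<tau>s n) s - (t - s) *\<^sub>R G \<tau> x (g x)))
          \<longlonglongrightarrow> norm (g t - g s - (t - s) *\<^sub>R G \<tau> x (g x))"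
        using st by (intro tendsto_intros ptlim) auto
      show "\<forall>\<^sub>F n in sequentially.
          norm (Y (r n) (\<tau>s n) t - Y (r n) (\<tau>s n) s - (t - s) *\<^sub>R G \<tau> x (g x)) \<le> (t - s) * e"
        using ev
      proof eventually_elim
        case (elim n)
        define m where "m = r n"
        have m: "0 < m" "1 / m < \<eta>"
        proof -
          have "0 < real m" "1 / \<eta> < real m"
            using elim by (simp_all add: m_def)
          then show "0 < m" "1 / m < \<eta>"
            using \<eta>(1) by (simp_all add: divide_less_eq mult.commute)
        qed
        have cells: "(\<Sum>j<m. cell m j t - cell m j s) = t - s"
          using st m by (simp add: sum_subtractf sum_cell)
        have eq: "Y m (\<tau>s n) t - Y m (\<tau>s n) s - (t - s) *\<^sub>R G \<tau> x (g x)
            = (\<Sum>j<m. (cell m j t - cell m j s) *\<^sub>R (euler_slope G y0 m (\<tau>s n) j - G \<tau> x (g x)))"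
        proof -
          have "(\<Sum>j<m. (cell m j t - cell m j s) *\<^sub>R (euler_slope G y0 m (\<tau>s n) j - G \<tau> x (g x)))
              = (\<Sum>j<m. (cell m j t - cell m j s) *\<^sub>R euler_slope G y0 m (\<tau>s n) j)
                - (\<Sum>j<m. (cell m j t - cell m j s) *\<^sub>R G \<tau> x (g x))"
            by (simp only: scaleR_diff_right sum_subtractf)
          then show ?thesis
            by (simp only: euler_diff cells[symmetric] scaleR_sum_left)
        qed
        have "norm (euler_slope G y0 m (\<tau>s n) j - G \<tau> x (g x)) \<le> e"
          if j: "j < m" "real j / m \<le> t" "s \<le> real (Suc j) / m" for j
        proof -
          define c where "c = real j / m"
          have c01: "c \<in> {0..1}"
            unfolding c_def using j(1) by (rule node_in)
          have "real (Suc j) / m = c + 1 / m"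
            by (simp add: c_def add_divide_distrib)
          then have cx: "\<bar>c - x\<bar> < 2 * \<eta>"
            using st j m by (simp add: c_def[symmetric])
          have "dist (Y m (\<tau>s n) c) (Y m (\<tau>s n) x) \<le> M * \<bar>c - x\<bar>"
            unfolding dist_norm using \<tau>s c01 x m by (intro euler_lipschitz)
          also have "\<dots> \<le> M * (2 * \<eta>)"
            using cx M_nonneg by (intro mult_left_mono) auto
          finally have "dist (Y m (\<tau>s n) c) (g x) < d / 3"
            using elim small_M dist_triangle[of "Y m (\<tau>s n) c" "g x" "Y m (\<tau>s n) x"]
            by (simp add: m_def)
          moreover have "dist c x < d / 3"
            using cx \<eta> by (simp add: dist_real_def)
          ultimately have "dist (G (\<tau>s n) c (Y m (\<tau>s n) c)) (G \<tau> x (g x)) < e"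
            using elim by (intro dG small \<tau>s c01) auto
          moreover have "euler_slope G y0 m (\<tau>s n) j = G (\<tau>s n) c (Y m (\<tau>s n) c)"
            unfolding c_def euler_slope_def using euler_at_node[of j m G y0 "\<tau>s n"] j by simp
          ultimately show ?thesis by (simp add: dist_norm)
        qed
        then show ?case
          unfolding m_def[symmetric] eq
          using st m(1) by (intro sum_cell_diff_le) auto
      qed
    qed simp
    show "\<exists>\<delta>>0. \<forall>t\<in>{0..1}. norm (t - x) < \<delta> \<longrightarrow>
        norm (g t - g x - (t - x) *\<^sub>R G \<tau> x (g x)) \<le> e * norm (t - x)"
    proof (intro exI[of _ \<eta>] conjI ballI impI \<eta>(1))
      fix t :: real assume t: "t \<in> {0..1}" "norm (t - x) < \<eta>"
      show "norm (g t - g x - (t - x) *\<^sub>R G \<tau> x (g x)) \<le> e * norm (t - x)"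
      proof (cases "x \<le> t")
        case True
        then show ?thesis using step[of x t] t x \<eta>(1) by (simp add: mult.commute)
      next
        case False
        have eq: "g t - g x - (t - x) *\<^sub>R G \<tau> x (g x) = - (g x - g t - (x - t) *\<^sub>R G \<tau> x (g x))"
          by (simp add: algebra_simps)
        have "norm (g x - g t - (x - t) *\<^sub>R G \<tau> x (g x)) \<le> (x - t) * e"
          using step[of t x] t x \<eta>(1) False by simp
        then show ?thesis
          unfolding eq norm_minus_cancel using False by (simp add: mult.commute)
      qed
    qed
  qed
  with g0 show "solves \<tau> g"
    by (simp add: solves_def)
qed

text \<open>The polygons share the Lipschitz constant $M$, so the theorem of Arzela and Ascoli applies.\<close>

lemma euler_subseq:
  assumes \<tau>s: "\<And>n. \<tau>s n \<in> {0..1}" and ns: "\<And>n. n < ns n"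
  obtains r \<tau> g where "strict_mono (r :: nat \<Rightarrow> nat)" "\<tau> \<in> {0..1}" "(\<lambda>n. \<tau>s (r n)) \<longlonglongrightarrow> \<tau>"
    "solves \<tau> g" "continuous_on {0..1} g"
    "uniform_limit {0..1} (\<lambda>n. Y (ns (r n)) (\<tau>s (r n))) g sequentially"
proof -
  obtain \<tau> r1 where r1: "\<tau> \<in> {0..1}" "strict_mono (r1 :: nat \<Rightarrow> nat)" "(\<tau>s \<circ> r1) \<longlonglongrightarrow> \<tau>"
    using compact_Icc[of 0 "1::real"] \<tau>s unfolding compact_eq_seq_compact_metric seq_compact_def by blast
  define F where "F n = Y (ns (r1 n)) (\<tau>s (r1 n))" for n
  have nz: "0 < ns m" for m
    using ns[of m] by simp
  have lip: "norm (F n x - F n y) \<le> M * \<bar>x - y\<bar>" if "x \<in> {0..1}" "y \<in> {0..1}" for n x y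
    unfolding F_def using euler_lipschitz[OF \<tau>s that(2,1) nz] .
  have "norm (F n x) \<le> norm y0 + M" if "x \<in> {0..1}" for n x
  proof -
    have "norm (F n x - F n 0) \<le> M * \<bar>x\<bar>"
      using lip[OF that, of 0] by simp
    also have "\<dots> \<le> M * 1"
      using that M_nonneg by (intro mult_left_mono) auto
    finally show ?thesis
      using norm_triangle_sub[of "F n x" "F n 0"] nz by (simp add: F_def euler_0)
  qed
  moreover have "\<exists>d. 0 < d \<and> (\<forall>n y. y \<in> {0..1} \<and> norm (x - y) < d \<longrightarrow> norm (F n x - F n y) < e)"
    if "x \<in> {0..1}" "0 < e" for x e
  proof (intro exI[of _ "e / (M + 1)"] conjI allI impI)
    show "0 < e / (M + 1)"
      using that M_nonneg by simp
    fix n y assume y: "y \<in> {0..1} \<and> norm (x - y) < e / (M + 1)"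
    have "M * \<bar>x - y\<bar> \<le> (M + 1) * \<bar>x - y\<bar>"
      by (simp add: mult_right_mono)
    also have "\<dots> < e"
      using y M_nonneg by (simp add: pos_less_divide_eq mult.commute)
    finally show "norm (F n x - F n y) < e"
      using lip[OF that(1), of y n] y by simp
  qed
  ultimately obtain g r2 where g: "continuous_on {0..1} g" "strict_mono (r2 :: nat \<Rightarrow> nat)"
    "\<And>e. 0 < e \<Longrightarrow> \<exists>N. \<forall>n x. n \<ge> N \<and> x \<in> {0..1} \<longrightarrow> norm (F (r2 n) x - g x) < e"
    using Arzela_Ascoli[of "{0..1::real}" F "norm y0 + M"] by (metis compact_Icc)
  define r where "r = r1 \<circ> r2"
  have r: "strict_mono r"
    unfolding r_def using r1 g by (intro strict_mono_o)
  have lim: "uniform_limit {0..1} (\<lambda>n. Y (ns (r n)) (\<tau>s (r n))) g sequentially"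
    unfolding uniform_limit_sequentially_iff
  proof (intro allI impI)
    fix e :: real assume "0 < e"
    from g(3)[OF this] obtain N where
      "\<forall>n x. N \<le> n \<and> x \<in> {0..1} \<longrightarrow> norm (F (r2 n) x - g x) < e"
      by blast
    then show "\<exists>N. \<forall>n\<ge>N. \<forall>x\<in>{0..1}. dist (Y (ns (r n)) (\<tau>s (r n)) x) (g x) < e"
      by (intro exI[of _ N]) (simp add: F_def r_def dist_norm)
  qed
  have \<tau>r: "(\<lambda>n. \<tau>s (r n)) \<longlonglongrightarrow> \<tau>"
    using LIMSEQ_subseq_LIMSEQ[OF r1(3) g(2)] by (simp add: r_def o_def)
  have "filterlim (\<lambda>n. ns (r n)) at_top sequentially"
    by (rule filterlim_at_top_mono[OF filterlim_subseq[OF r]]) (auto intro!: always_eventually less_imp_le ns)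
  from euler_limit_solves[OF _ \<tau>r this lim g(1)] \<tau>s have "solves \<tau> g"
    by blast
  with r r1 \<tau>r g lim show thesis
    by (intro that)
qed

text \<open>Continuing by the boundary values places the solutions, which matter on $[0,1]$ only, in the metric space
  of bounded continuous functions on the line.\<close>

definition ext :: "(real \<Rightarrow> 'a) \<Rightarrow> real \<Rightarrow>\<^sub>C 'a" where
  "ext g = Bcontfun (\<lambda>t. g (max 0 (min 1 t)))"

lemma apply_ext:
  assumes "continuous_on {0..1} g"
  shows "apply_bcontfun (ext g) t = g (max 0 (min 1 t))"
proof -
  have "continuous_on UNIV (\<lambda>t. g (max 0 (min 1 t)))"
    by (intro continuous_on_compose2[OF assms] continuous_intros) auto
  moreover have "range (\<lambda>t. g (max 0 (min 1 t))) \<subseteq> g ` {0..1}"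
    by auto
  moreover have "bounded (g ` {0..1})"
    by (intro compact_imp_bounded compact_continuous_image assms compact_Icc)
  ultimately have "(\<lambda>t. g (max 0 (min 1 t))) \<in> bcontfun"
    by (auto simp: bcontfun_def intro: bounded_subset)
  then show ?thesis
    by (simp add: ext_def Bcontfun_inverse)
qed

lemma dist_ext_le:
  assumes "continuous_on {0..1} f" "continuous_on {0..1} g" "\<And>t. t \<in> {0..1} \<Longrightarrow> dist (f t) (g t) \<le> e"
  shows "dist (ext f) (ext g) \<le> e"
  using assms by (intro dist_bound) (simp add: apply_ext)

lemma dist_le_dist_ext:
  assumes "continuous_on {0..1} f" "continuous_on {0..1} g" "t \<in> {0..1}"
  shows "dist (f t) (g t) \<le> dist (ext f) (ext g)"
  using dist_bounded[of "ext f" t "ext g"] assms by (simp add: apply_ext)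

lemma tendsto_ext_iff:
  assumes "\<And>n. continuous_on {0..1} (gs n)" "continuous_on {0..1} g"
  shows "(\<lambda>n. ext (gs n)) \<longlonglongrightarrow> ext g \<longleftrightarrow> uniform_limit {0..1} gs g sequentially"
proof
  assume l: "(\<lambda>n. ext (gs n)) \<longlonglongrightarrow> ext g"
  show "uniform_limit {0..1} gs g sequentially"
  proof (rule uniform_limitI)
    fix e :: real assume "0 < e"
    from tendstoD[OF l this] show "\<forall>\<^sub>F n in sequentially. \<forall>x\<in>{0..1}. dist (gs n x) (g x) < e"
      by eventually_elim (use dist_le_dist_ext[OF assms] in \<open>blast intro: le_less_trans\<close>)
  qed
next
  assume l: "uniform_limit {0..1} gs g sequentially"
  show "(\<lambda>n. ext (gs n)) \<longlonglongrightarrow> ext g"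
  proof (rule tendstoI)
    fix e :: real assume e: "0 < e"
    from e have "0 < e / 2" by simp
    from uniform_limitD[OF l this] show "\<forall>\<^sub>F n in sequentially. dist (ext (gs n)) (ext g) < e"
    proof eventually_elim
      case (elim n)
      then have "dist (ext (gs n)) (ext g) \<le> e / 2"
        by (intro dist_ext_le assms) (auto intro: less_imp_le)
      with e show ?case by simp
    qed
  qed
qed

lemma solves_continuous: "solves \<tau> g \<Longrightarrow> continuous_on {0..1} g"
  by (auto simp: solves_def continuous_on_eq_continuous_within intro: has_vector_derivative_continuous)

lemma euler_continuous: "continuous_on {0..1} (Y n \<tau>)"
  unfolding euler_def cell_def by (intro continuous_intros)

lemma euler_continuous_param:
  assumes n: "0 < n"
  shows "continuous_on {0..1} (\<lambda>\<tau>. ext (Y n \<tau>))"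
  unfolding continuous_on_def
proof (intro ballI)
  fix \<tau> :: real assume \<tau>: "\<tau> \<in> {0..1}"
  have cell: "\<bar>cell n j t\<bar> \<le> 1" if "t \<in> {0..1}" "j < n" for j t
  proof -
    have *: "0 \<le> min t a \<and> min t a \<le> 1" if "0 \<le> a" for a
      using that \<open>t \<in> {0..1}\<close> by auto
    have "\<bar>x - y\<bar> \<le> 1" if "0 \<le> x \<and> x \<le> 1" "0 \<le> y \<and> y \<le> 1" for x y :: real
      using that by linarith
    from this[OF * *] show ?thesis
      unfolding cell_def by simp
  qed
  have bound: "dist (ext (Y n \<sigma>)) (ext (Y n \<tau>)) \<le> (\<Sum>j<n. norm (euler_slope G y0 n \<sigma> j - euler_slope G y0 n \<tau> j))" for \<sigma>
  proof (intro dist_ext_le euler_continuous)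
    fix t :: real assume t: "t \<in> {0..1}"
    have "Y n \<sigma> t - Y n \<tau> t = (\<Sum>j<n. cell n j t *\<^sub>R (euler_slope G y0 n \<sigma> j - euler_slope G y0 n \<tau> j))"
      by (simp add: euler_def sum_subtractf scaleR_diff_right)
    also have "norm \<dots> \<le> (\<Sum>j<n. norm (euler_slope G y0 n \<sigma> j - euler_slope G y0 n \<tau> j))"
      using cell[OF t] by (intro sum_norm_le) (simp add: mult_left_le_one_le)
    finally show "dist (Y n \<sigma> t) (Y n \<tau> t) \<le> (\<Sum>j<n. norm (euler_slope G y0 n \<sigma> j - euler_slope G y0 n \<tau> j))"
      by (simp add: dist_norm)
  qed
  have "((\<lambda>\<sigma>. \<Sum>j<n. norm (euler_slope G y0 n \<sigma> j - euler_slope G y0 n \<tau> j)) \<longlongrightarrow>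
      (\<Sum>j<n. norm (euler_slope G y0 n \<tau> j - euler_slope G y0 n \<tau> j))) (at \<tau> within {0..1})"
    using slope_continuous(2) \<tau> by (intro tendsto_intros) (auto simp: continuous_on_def)
  then have zero: "((\<lambda>\<sigma>. \<Sum>j<n. norm (euler_slope G y0 n \<sigma> j - euler_slope G y0 n \<tau> j)) \<longlongrightarrow> 0) (at \<tau> within {0..1})"
    by simp
  have "((\<lambda>\<sigma>. dist (ext (Y n \<sigma>)) (ext (Y n \<tau>))) \<longlongrightarrow> 0) (at \<tau> within {0..1})"
    by (rule Lim_null_comparison[OF _ zero]) (simp add: bound)
  then show "((\<lambda>\<sigma>. ext (Y n \<sigma>)) \<longlongrightarrow> ext (Y n \<tau>)) (at \<tau> within {0..1})"
    by (subst tendsto_dist_iff)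
qed

text \<open>Closedness relative to the set of solutions: the limit is known to be a solution as well.\<close>

definition limit_closed :: "((real \<Rightarrow> 'a) \<Rightarrow> bool) \<Rightarrow> bool" where
  "limit_closed R \<longleftrightarrow> (\<forall>gs g. (\<forall>n. \<exists>\<tau>\<in>{0..1}. solves \<tau> (gs n)) \<longrightarrow> (\<forall>n. R (gs n)) \<longrightarrow>
      (\<exists>\<tau>\<in>{0..1}. solves \<tau> g) \<longrightarrow> uniform_limit {0..1} gs g sequentially \<longrightarrow> R g)"

text \<open>Suppose that no solution satisfies both conditions, and let $h(y)$ be the distance of $y$ to
  the solutions with $P$ minus its distance to those with $Q$. By closedness $h$ is negative on the former and
  positive on the latter. Late Euler polygons have $h < 0$ for $\tau = 0$ and $h > 0$ for $\tau = 1$, and since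
  they depend continuously on $\tau$, each of them has $h = 0$ for some $\tau$. A limit of these polygons
  is a solution with $h = 0$, which is impossible. Uniqueness for the initial value problem would make this the
  intermediate value theorem; here a solution need not depend on $\tau$ in any continuous way.\<close>

lemma solution_funnel_connected:
  assumes P_lim: "limit_closed P" and Q_lim: "limit_closed Q"
    and P_or_Q: "\<And>\<tau> g. \<tau> \<in> {0..1} \<Longrightarrow> solves \<tau> g \<Longrightarrow> P g \<or> Q g"
    and P0: "\<And>g. solves 0 g \<Longrightarrow> P g" and Q1: "\<And>g. solves 1 g \<Longrightarrow> Q g"
  shows "\<exists>\<tau>\<in>{0..1}. \<exists>g. solves \<tau> g \<and> P g \<and> Q g"
proof (rule ccontr)
  assume "\<not> ?thesis"
  then have disj: "\<And>\<tau> g. \<tau> \<in> {0..1} \<Longrightarrow> solves \<tau> g \<Longrightarrow> \<not> (P g \<and> Q g)"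
    by blast
  define sols where "sols R = ext ` {g. (\<exists>\<tau>\<in>{0..1}. solves \<tau> g) \<and> R g}" for R
  define h where "h x = infdist x (sols P) - infdist x (sols Q)" for x
  have h_cont: "continuous_on X h" for X
    unfolding h_def by (intro continuous_intros)
  have in_sols: "ext g \<in> sols R" if "\<tau> \<in> {0..1}" "solves \<tau> g" "R g" for \<tau> g R
    unfolding sols_def using that by (intro imageI CollectI conjI bexI[of _ \<tau>])
  have apart: "0 < infdist (ext g) (sols R)"
    if R_lim: "limit_closed R" and g: "\<exists>\<tau>\<in>{0..1}. solves \<tau> g" "\<not> R g" and ne: "sols R \<noteq> {}" for R g
  proof (rule ccontr)
    assume "\<not> 0 < infdist (ext g) (sols R)"
    then have "ext g \<in> closure (sols R)"
      using ne infdist_nonneg[of "ext g" "sols R"] by (simp add: in_closure_iff_infdist_zero)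
    then obtain xs where xs: "\<And>n. xs n \<in> sols R" "xs \<longlonglongrightarrow> ext g"
      by (auto simp: closure_sequential)
    have "\<exists>f. (\<exists>\<tau>\<in>{0..1}. solves \<tau> f) \<and> R f \<and> xs n = ext f" for n
      using xs(1)[of n] by (auto simp: sols_def)
    then obtain gs where gs: "\<And>n. \<exists>\<tau>\<in>{0..1}. solves \<tau> (gs n)" "\<And>n. R (gs n)" "\<And>n. xs n = ext (gs n)"
      by metis
    have "xs = (\<lambda>n. ext (gs n))"
      by (rule ext) (rule gs(3))
    then have "(\<lambda>n. ext (gs n)) \<longlonglongrightarrow> ext g"
      using xs(2) by simp
    moreover have "continuous_on {0..1} (gs n)" for n
      using gs(1)[of n] solves_continuous by blast
    moreover have "continuous_on {0..1} g"
      using g(1) solves_continuous by blast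
    ultimately have "uniform_limit {0..1} gs g sequentially"
      by (simp only: tendsto_ext_iff)
    with R_lim gs(1,2) g show False
      unfolding limit_closed_def by blast
  qed
  have limit: "\<exists>\<tau> g r. \<tau> \<in> {0..1} \<and> solves \<tau> g \<and> strict_mono r \<and> (\<lambda>n. \<tau>s (r n)) \<longlonglongrightarrow> \<tau> \<and>
      (\<lambda>n. h (ext (Y (ns (r n)) (\<tau>s (r n))))) \<longlonglongrightarrow> h (ext g)"
    if \<tau>s: "\<And>n. \<tau>s n \<in> {0..1}" and ns: "\<And>n. n < ns n" for \<tau>s :: "nat \<Rightarrow> real" and ns
  proof -
    obtain r \<tau> g where rg: "strict_mono (r :: nat \<Rightarrow> nat)" "\<tau> \<in> {0..1}" "(\<lambda>n. \<tau>s (r n)) \<longlonglongrightarrow> \<tau>" "solves \<tau> g"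
      "continuous_on {0..1} g" "uniform_limit {0..1} (\<lambda>n. Y (ns (r n)) (\<tau>s (r n))) g sequentially"
      by (rule euler_subseq[OF \<tau>s ns], rule that)
    have "(\<lambda>n. ext (Y (ns (r n)) (\<tau>s (r n)))) \<longlonglongrightarrow> ext g"
      using rg(5,6) by (simp only: tendsto_ext_iff[OF euler_continuous])
    then have "(\<lambda>n. h (ext (Y (ns (r n)) (\<tau>s (r n))))) \<longlonglongrightarrow> h (ext g)"
      by (intro continuous_on_tendsto_compose[OF h_cont[of UNIV]]) auto
    with rg show ?thesis by blast
  qed
  have const: "\<exists>g. solves \<tau> g \<and> (\<exists>r. strict_mono r \<and> (\<lambda>n. h (ext (Y (ns (r n)) \<tau>))) \<longlonglongrightarrow> h (ext g))"
    if \<tau>: "\<tau> \<in> {0..1}" and ns: "\<And>n. n < ns n" for \<tau> ns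
  proof -
    obtain \<sigma> g r where "solves \<sigma> g" "strict_mono r" "(\<lambda>n. \<tau>) \<longlonglongrightarrow> \<sigma>"
      "(\<lambda>n. h (ext (Y (ns (r n)) \<tau>))) \<longlonglongrightarrow> h (ext g)"
      using limit[of "\<lambda>_. \<tau>" ns, OF \<tau> ns] by blast
    moreover from this have "\<sigma> = \<tau>"
      by (simp add: LIMSEQ_const_iff)
    ultimately show ?thesis by blast
  qed
  have ne: "sols P \<noteq> {}" "sols Q \<noteq> {}"
  proof -
    obtain g0 g1 where "solves 0 g0" "solves 1 g1"
      using const[of 0 Suc] const[of 1 Suc] by auto
    then have "ext g0 \<in> sols P" "ext g1 \<in> sols Q"
      using in_sols[of 0 g0 P] in_sols[of 1 g1 Q] P0[of g0] Q1[of g1] by simp_all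
    then show "sols P \<noteq> {}" "sols Q \<noteq> {}" by blast+
  qed
  have neg: "h (ext g) < 0" if g: "\<tau> \<in> {0..1}" "solves \<tau> g" "P g" for \<tau> g
  proof -
    have "infdist (ext g) (sols P) = 0"
      by (rule infdist_zero) (rule in_sols[of \<tau> g P, OF g])
    moreover have "\<exists>\<tau>\<in>{0..1}. solves \<tau> g" "\<not> Q g"
      using g disj[OF g(1,2)] by blast+
    from apart[OF Q_lim this ne(2)] have "0 < infdist (ext g) (sols Q)" .
    ultimately show ?thesis by (simp add: h_def)
  qed
  have pos: "0 < h (ext g)" if g: "\<tau> \<in> {0..1}" "solves \<tau> g" "Q g" for \<tau> g
  proof -
    have "infdist (ext g) (sols Q) = 0"
      by (rule infdist_zero) (rule in_sols[of \<tau> g Q, OF g])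
    moreover have "\<exists>\<tau>\<in>{0..1}. solves \<tau> g" "\<not> P g"
      using g disj[OF g(1,2)] by blast+
    from apart[OF P_lim this ne(1)] have "0 < infdist (ext g) (sols P)" .
    ultimately show ?thesis by (simp add: h_def)
  qed
  have "\<exists>N. \<forall>n>N. h (ext (Y n 0)) < 0"
  proof (rule ccontr)
    assume "\<nexists>N. \<forall>n>N. h (ext (Y n 0)) < 0"
    then obtain ns where ns: "\<And>n. n < ns n" "\<And>n. 0 \<le> h (ext (Y (ns n) 0))"
      by (metis not_less)
    obtain g r where g: "solves 0 g" "(\<lambda>n. h (ext (Y (ns (r n)) 0))) \<longlonglongrightarrow> h (ext g)"
      using const[OF _ ns(1), of 0] by auto
    have "0 \<le> h (ext g)"
      using ns(2) by (intro LIMSEQ_le_const[OF g(2)]) auto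
    with neg[OF _ g(1) P0[OF g(1)]] show False by simp
  qed
  then obtain N where N: "\<And>n. N < n \<Longrightarrow> h (ext (Y n 0)) < 0" by blast
  have "\<exists>N. \<forall>n>N. 0 < h (ext (Y n 1))"
  proof (rule ccontr)
    assume "\<nexists>N. \<forall>n>N. 0 < h (ext (Y n 1))"
    then obtain ns where ns: "\<And>n. n < ns n" "\<And>n. h (ext (Y (ns n) 1)) \<le> 0"
      by (metis not_less)
    obtain g r where g: "solves 1 g" "(\<lambda>n. h (ext (Y (ns (r n)) 1))) \<longlonglongrightarrow> h (ext g)"
      using const[OF _ ns(1), of 1] by auto
    have "h (ext g) \<le> 0"
      using ns(2) by (intro LIMSEQ_le_const2[OF g(2)]) auto
    with pos[OF _ g(1) Q1[OF g(1)]] show False by simp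
  qed
  then obtain N' where N': "\<And>n. N' < n \<Longrightarrow> 0 < h (ext (Y n 1))" by blast
  have "\<exists>\<tau>\<in>{0..1}. h (ext (Y (n + N + N' + 1) \<tau>)) = 0" for n
  proof -
    have "continuous_on {0..1} (\<lambda>\<tau>. h (ext (Y (n + N + N' + 1) \<tau>)))"
      by (intro continuous_on_compose2[OF h_cont[of UNIV] euler_continuous_param]) auto
    moreover have "h (ext (Y (n + N + N' + 1) 0)) \<le> 0" "0 \<le> h (ext (Y (n + N + N' + 1) 1))"
      by (intro less_imp_le N N'; simp)+
    ultimately obtain \<tau> where "0 \<le> \<tau>" "\<tau> \<le> 1" "h (ext (Y (n + N + N' + 1) \<tau>)) = 0"
      using IVT'[of "\<lambda>\<tau>. h (ext (Y (n + N + N' + 1) \<tau>))" 0 0 1] by auto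
    then show ?thesis by (intro bexI[of _ \<tau>]) auto
  qed
  then obtain \<tau>s where \<tau>s: "\<And>n. \<tau>s n \<in> {0..1}" "\<And>n. h (ext (Y (n + N + N' + 1) (\<tau>s n))) = 0"
    by metis
  have shift: "n < n + N + N' + 1" for n
    by simp
  from limit[of \<tau>s "\<lambda>n. n + N + N' + 1", OF \<tau>s(1) shift] obtain \<tau> g r where g: "\<tau> \<in> {0..1}" "solves \<tau> g"
    "(\<lambda>n. h (ext (Y (r n + N + N' + 1) (\<tau>s (r n))))) \<longlonglongrightarrow> h (ext g)"
    by blast
  from g(3) have "h (ext g) = 0"
    by (simp only: \<tau>s(2) LIMSEQ_const_iff)
  with P_or_Q[OF g(1,2)] neg[OF g(1,2)] pos[OF g(1,2)] show False
    by auto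
qed

end

section \<open>Energy estimate and shooting\<close>

text \<open>Two zeros of a chain cannot merge in the limit. By Rolle's theorem there is a zero of $w_n$ between
  them, and at the common limit both $u$ and $w$ would vanish.\<close>

lemma zero_chain_limit:
  assumes zc: "\<And>n. zero_chain k 1 (us n)"
    and ucont: "\<And>n. continuous_on {0..1} (us n)"
    and deriv: "\<And>n x. x \<in> {0<..<1} \<Longrightarrow> (us n has_real_derivative phi q (ws n x)) (at x)"
    and ulim: "uniform_limit {0..1} us u sequentially" and wlim: "uniform_limit {0..1} ws w sequentially"
    and u: "continuous_on {0..1} u" and w: "continuous_on {0..1} w"
    and simple: "\<And>x. x \<in> {0..1} \<Longrightarrow> u x \<noteq> 0 \<or> w x \<noteq> 0"
  shows "zero_chain k 1 u"
proof -
  from zc have "\<forall>n. \<exists>z. z 0 = 0 \<and> (\<forall>i<k. z i < z (Suc i)) \<and> (\<forall>i\<le>k. us n (z i) = 0) \<and> z k \<le> 1"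
    by (simp add: zero_chain_def)
  then obtain zs where zs: "\<And>n. zs n 0 = 0" "\<And>n. \<forall>i<k. zs n i < zs n (Suc i)"
    "\<And>n i. i \<le> k \<Longrightarrow> us n (zs n i) = 0" "\<And>n. zs n k \<le> 1"
    by metis
  have in01: "zs n i \<in> {0..1}" if "i \<le> k" for n i
    using step_mono(1)[OF zs(2), of 0 i n] step_mono(1)[OF zs(2), of i k n] zs(1)[of n] zs(4)[of n] that
    by auto
  \<comment> \<open>only the first \<open>k + 1\<close> entries of a chain are under control, the others are set to 0\<close>
  define zs' where "zs' n i = (if i \<le> k then zs n i else 0)" for n i
  have "\<And>n i. zs' n i \<in> {0..1}"
    using in01 by (simp add: zs'_def)
  from bounded_sequences_subseq[of zs', OF this] obtain r z where r: "strict_mono (r :: nat \<Rightarrow> nat)"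
    and z': "\<And>i. (\<lambda>n. zs' (r n) i) \<longlonglongrightarrow> z i"
    by blast
  have z: "(\<lambda>n. zs (r n) i) \<longlonglongrightarrow> z i" if "i \<le> k" for i
    using z'[of i] that by (simp add: zs'_def)
  have ulim': "uniform_limit {0..1} (\<lambda>n. us (r n)) u sequentially"
    and wlim': "uniform_limit {0..1} (\<lambda>n. ws (r n)) w sequentially"
    using filterlim_compose[OF ulim filterlim_subseq[OF r]] filterlim_compose[OF wlim filterlim_subseq[OF r]] .
  have z01: "z i \<in> {0..1}" if "i \<le> k" for i
    using in01[OF that] by (intro closed_sequentially[OF closed_atLeastAtMost _ z[OF that]]) auto
  have u0: "u (z i) = 0" if "i \<le> k" for i
  proof -
    have "(\<lambda>n. us (r n) (zs (r n) i)) \<longlonglongrightarrow> u (z i)"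
      by (rule uniform_limit_diagonal[OF ulim' u z01[OF that] in01[OF that] z[OF that]])
    then show ?thesis
      by (simp add: zs(3)[OF that] LIMSEQ_const_iff)
  qed
  have "z i < z (Suc i)" if i: "i < k" for i
  proof (rule ccontr)
    assume "\<not> z i < z (Suc i)"
    moreover have "z i \<le> z (Suc i)"
      using zs(2) i by (intro LIMSEQ_le[OF z z]) (auto intro!: exI[of _ 0] less_imp_le)
    ultimately have eq: "z (Suc i) = z i" by simp
    have "\<exists>\<xi>. zs (r n) i < \<xi> \<and> \<xi> < zs (r n) (Suc i) \<and> ws (r n) \<xi> = 0" for n
    proof -
      let ?a = "zs (r n) i" and ?b = "zs (r n) (Suc i)"
      have ab: "?a < ?b" "?a \<in> {0..1}" "?b \<in> {0..1}"
        using zs(2) i in01 by auto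
      have d: "(us (r n) has_real_derivative phi q (ws (r n) x)) (at x)" if "?a < x" "x < ?b" for x
        using that ab by (intro deriv) auto
      have "continuous_on {?a..?b} (us (r n))"
        using ab by (intro continuous_on_subset[OF ucont]) auto
      moreover have "us (r n) ?a = us (r n) ?b"
        using zs(3) i by simp
      ultimately obtain \<xi> where \<xi>: "?a < \<xi>" "\<xi> < ?b" "(us (r n) has_real_derivative 0) (at \<xi>)"
        using Rolle[OF ab(1)] d by (metis real_differentiable_def)
      then have "phi q (ws (r n) \<xi>) = 0"
        using d DERIV_unique by blast
      with \<xi> show ?thesis by auto
    qed
    then obtain \<xi> where \<xi>: "\<And>n. zs (r n) i < \<xi> n" "\<And>n. \<xi> n < zs (r n) (Suc i)" "\<And>n. ws (r n) (\<xi> n) = 0"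
      by metis
    have "\<xi> \<longlonglongrightarrow> z i"
      by (rule tendsto_sandwich[of "\<lambda>n. zs (r n) i" _ _ "\<lambda>n. zs (r n) (Suc i)"])
        (use z[of i] z[of "Suc i"] i eq \<xi> in \<open>auto intro!: always_eventually less_imp_le\<close>)
    moreover have "\<xi> n \<in> {0..1}" for n
      using \<xi>(1,2)[of n] in01[of i "r n"] in01[of "Suc i" "r n"] i by auto
    ultimately have "(\<lambda>n. ws (r n) (\<xi> n)) \<longlonglongrightarrow> w (z i)"
      using z01 i by (intro uniform_limit_diagonal[OF wlim' w]) auto
    then have "w (z i) = 0"
      by (simp add: \<xi>(3) LIMSEQ_const_iff)
    with simple[OF z01[of i]] u0[of i] i show False by simp
  qed
  moreover have "z 0 = 0"
    using z[of 0] by (simp add: zs(1) LIMSEQ_const_iff)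
  ultimately show ?thesis
    unfolding zero_chain_def using u0 z01[of k] by (intro exI[of _ z]) auto
qed

text \<open>The Hamiltonian of the system with $F(x,s) = \varphi_p(s)$.\<close>

definition energy :: "real \<Rightarrow> real \<Rightarrow> real \<Rightarrow> real" where
  "energy p u w = \<bar>u\<bar> powr p / p + \<bar>w\<bar> powr (p / (p - 1)) / (p / (p - 1))"

lemma energy_nonneg: "1 < p \<Longrightarrow> 0 \<le> energy p u w"
  by (simp add: energy_def)

lemma energy_eq_0_iff: "1 < p \<Longrightarrow> energy p u w = 0 \<longleftrightarrow> u = 0 \<and> w = 0"
proof -
  assume p: "1 < p"
  have "0 \<le> \<bar>u\<bar> powr p / p" "0 \<le> \<bar>w\<bar> powr (p / (p - 1)) / (p / (p - 1))"
    using p by simp_all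
  then have "energy p u w = 0 \<longleftrightarrow> \<bar>u\<bar> powr p / p = 0 \<and> \<bar>w\<bar> powr (p / (p - 1)) / (p / (p - 1)) = 0"
    unfolding energy_def by (rule add_nonneg_eq_0_iff)
  also have "\<dots> \<longleftrightarrow> u = 0 \<and> w = 0"
    using p by auto
  finally show ?thesis .
qed

text \<open>The derivative of the energy is at most a multiple of $|u|^{p-1}|w|^{q-1}$, and Young's inequality
  bounds this product by the energy. Hence the energy changes at most by a bounded factor: solutions stay bounded, and
  $u$ and $w$ cannot vanish together unless they vanish at $0$. The lemma leaves the right hand sides open so that it
  also covers truncated systems.\<close>

lemma energy_gronwall:
  fixes p C :: real
  assumes p: "1 < p" and C: "0 \<le> C"
    and uc: "continuous_on {0..1} u" and wc: "continuous_on {0..1} w"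
    and u: "\<And>x. x \<in> {0<..<1} \<Longrightarrow> (u has_real_derivative U x) (at x)"
    and w: "\<And>x. x \<in> {0<..<1} \<Longrightarrow> (w has_real_derivative W x) (at x)"
    and U: "\<And>x. x \<in> {0<..<1} \<Longrightarrow> \<bar>U x\<bar> \<le> \<bar>w x\<bar> powr (p / (p - 1) - 1)"
    and W: "\<And>x. x \<in> {0<..<1} \<Longrightarrow> \<bar>W x\<bar> \<le> C * \<bar>u x\<bar> powr (p - 1)"
    and x: "x \<in> {0..1}"
  defines "L \<equiv> (1 + C) * (p + p / (p - 1))"
  shows "energy p (u x) (w x) \<le> energy p (u 0) (w 0) * exp L"
    and "energy p (u 0) (w 0) \<le> energy p (u x) (w x) * exp L"
proof -
  define q where "q = p / (p - 1)"
  have q: "1 < q" and pq: "p / q = p - 1" "q / p = q - 1" "(p - 1) * q = p" "(q - 1) * p = q"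
    using p by (simp_all add: q_def field_simps)
  have q_conj: "q / (q - 1) = p"
    using p by (simp add: q_def field_simps)
  define e where "e t = energy p (u t) (w t)" for t
  define e' where "e' t = phi p (u t) * U t + phi q (w t) * W t" for t
  have e0: "0 \<le> e t" for t
    using p by (simp add: e_def energy_nonneg)
  have L0: "0 \<le> L"
    unfolding L_def using C p by simp
  have ec: "continuous_on {0..1} e"
    unfolding e_def energy_def q_def[symmetric] mult_phi[symmetric] using p q
    by (intro continuous_intros uc wc) auto
  have e_deriv: "(e has_real_derivative e' t) (at t)" if t: "t \<in> {0<..<1}" for t
  proof -
    have "((\<lambda>t. \<bar>u t\<bar> powr p / p + \<bar>w t\<bar> powr q / q) has_real_derivative
        p * phi p (u t) * U t / p + q * phi q (w t) * W t / q) (at t)"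
      by (intro DERIV_add DERIV_cdivide DERIV_chain2[OF abs_powr_deriv u[OF t]]
          DERIV_chain2[OF abs_powr_deriv w[OF t]] p q)
    then show ?thesis
      using p q by (simp add: e_def[abs_def] energy_def q_def[symmetric] e'_def)
  qed
  have e'_le: "\<bar>e' t\<bar> \<le> L * e t" if t: "t \<in> {0<..<1}" for t
  proof -
    let ?a = "\<bar>u t\<bar> powr (p - 1)" and ?b = "\<bar>w t\<bar> powr (q - 1)"
    have "?a * ?b \<le> ?a powr q / q + ?b powr p / p"
      using young_conj[OF q, of ?a ?b] by (simp add: q_conj)
    also have "\<dots> = \<bar>u t\<bar> powr p / q + \<bar>w t\<bar> powr q / p"
      by (simp add: powr_powr pq)
    also have "\<dots> = (p - 1) * (\<bar>u t\<bar> powr p / p) + (q - 1) * (\<bar>w t\<bar> powr q / q)"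
      unfolding pq(1,2)[symmetric] using p q by simp
    also have "\<dots> \<le> (p + q) * (\<bar>u t\<bar> powr p / p) + (p + q) * (\<bar>w t\<bar> powr q / q)"
      using p q by (intro add_mono mult_right_mono) auto
    also have "\<dots> = (p + q) * e t"
      by (simp add: e_def energy_def q_def[symmetric] distrib_left)
    finally have ab: "?a * ?b \<le> (p + q) * e t" .
    have "\<bar>e' t\<bar> \<le> \<bar>phi p (u t) * U t\<bar> + \<bar>phi q (w t) * W t\<bar>"
      unfolding e'_def by (rule abs_triangle_ineq)
    also have "\<bar>phi p (u t) * U t\<bar> \<le> ?a * ?b"
      unfolding abs_mult abs_phi using U[OF t] by (intro mult_left_mono) (simp_all add: q_def)
    also have "\<bar>phi q (w t) * W t\<bar> \<le> ?b * (C * ?a)"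
      unfolding abs_mult abs_phi using W[OF t] by (intro mult_left_mono) simp_all
    finally have "\<bar>e' t\<bar> \<le> (1 + C) * (?a * ?b)"
      by (simp add: algebra_simps)
    also have "\<dots> \<le> (1 + C) * ((p + q) * e t)"
      using ab C by (intro mult_left_mono) auto
    finally show ?thesis
      by (simp add: L_def q_def mult.assoc)
  qed
  have x01: "0 \<le> x" "x \<le> 1"
    using x by auto
  have expx: "exp (L * x) \<le> exp L"
    using x01 L0 by (simp add: mult_left_le)
  have "e x * exp (- L * x) \<le> e 0 * exp (- L * 0)"
  proof (rule DERIV_nonpos_imp_decreasing_open[where f = "\<lambda>t. e t * exp (- L * t)" and a = 0 and b = x])
    show "0 \<le> x" by (rule x01)
    show "continuous_on {0..x} (\<lambda>t. e t * exp (- L * t))"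
      using x01 by (intro continuous_intros continuous_on_subset[OF ec]) auto
    fix t assume t: "0 < t" "t < x"
    then have t01: "t \<in> {0<..<1}" using x01 by simp
    have "((\<lambda>t. e t * exp (- L * t)) has_real_derivative (e' t - L * e t) * exp (- L * t)) (at t)"
      by (auto intro!: derivative_eq_intros e_deriv[OF t01] simp: algebra_simps)
    moreover have "(e' t - L * e t) * exp (- L * t) \<le> 0"
      using e'_le[OF t01] by (intro mult_nonpos_nonneg) auto
    ultimately show "\<exists>y. ((\<lambda>t. e t * exp (- L * t)) has_real_derivative y) (at t) \<and> y \<le> 0"
      by blast
  qed
  then have "e x \<le> e 0 * exp (L * x)"
    by (simp add: exp_minus field_simps)
  also have "\<dots> \<le> e 0 * exp L"
    using expx e0 by (intro mult_left_mono)
  finally show "energy p (u x) (w x) \<le> energy p (u 0) (w 0) * exp L"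
    by (simp add: e_def)
  have "e 0 * exp (L * 0) \<le> e x * exp (L * x)"
  proof (rule DERIV_nonneg_imp_increasing_open[where f = "\<lambda>t. e t * exp (L * t)" and a = 0 and b = x])
    show "0 \<le> x" by (rule x01)
    show "continuous_on {0..x} (\<lambda>t. e t * exp (L * t))"
      using x01 by (intro continuous_intros continuous_on_subset[OF ec]) auto
    fix t assume t: "0 < t" "t < x"
    then have t01: "t \<in> {0<..<1}" using x01 by simp
    have "((\<lambda>t. e t * exp (L * t)) has_real_derivative (e' t + L * e t) * exp (L * t)) (at t)"
      by (auto intro!: derivative_eq_intros e_deriv[OF t01] simp: algebra_simps)
    moreover have "0 \<le> (e' t + L * e t) * exp (L * t)"
      using e'_le[OF t01] by (intro mult_nonneg_nonneg) auto
    ultimately show "\<exists>y. ((\<lambda>t. e t * exp (L * t)) has_real_derivative y) (at t) \<and> 0 \<le> y"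
      by blast
  qed
  then have "e 0 \<le> e x * exp (L * x)"
    by simp
  also have "\<dots> \<le> e x * exp L"
    using expx e0 by (intro mult_left_mono)
  finally show "energy p (u 0) (w 0) \<le> energy p (u x) (w x) * exp L"
    by (simp add: e_def)
qed

lemma plane_sol_simple:
  assumes p: "1 < p" and sol: "plane_sol p F u w"
    and F: "\<And>x s. x \<in> {0..1} \<Longrightarrow> \<bar>F x s\<bar> \<le> C * \<bar>s\<bar> powr (p - 1)"
    and w0: "w 0 \<noteq> 0" and x: "x \<in> {0..1}"
  shows "u x \<noteq> 0 \<or> w x \<noteq> 0"
proof -
  note s = plane_solD[OF sol]
  have C: "0 \<le> C"
    using F[of 0 1] abs_ge_zero[of "F 0 1"] by simp
  have "energy p (u 0) (w 0) \<le> energy p (u x) (w x) * exp ((1 + C) * (p + p / (p - 1)))"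
    by (rule energy_gronwall(2)[OF p C s(4,2,5,3) _ _ x]) (use F in \<open>auto simp: abs_phi\<close>)
  moreover have "energy p (u 0) (w 0) \<noteq> 0"
    using w0 energy_eq_0_iff[OF p] by blast
  then have "0 < energy p (u 0) (w 0)"
    using energy_nonneg[OF p, of "u 0" "w 0"] by simp
  ultimately have "energy p (u x) (w x) \<noteq> 0"
    by auto
  then show ?thesis
    using energy_eq_0_iff[OF p] by blast
qed

lemma plane_sol_crosses:
  assumes p: "1 < p" and sol: "plane_sol p F u w"
    and simple: "\<And>x. x \<in> {0<..<1} \<Longrightarrow> u x \<noteq> 0 \<or> w x \<noteq> 0"
  shows "crosses u"
proof (rule crosses_of_deriv)
  fix x :: real assume x: "x \<in> {0<..<1}" "u x = 0"
  then have "phi (p / (p - 1)) (w x) \<noteq> 0"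
    using simple by simp
  then show "\<exists>D. D \<noteq> 0 \<and> (u has_real_derivative D) (at x)"
    using plane_solD(5)[OF sol x(1)] by blast
qed

lemma plane_sol_pos_near_0:
  assumes sol: "plane_sol p F u w" and u0: "u 0 = 0" and w0: "0 < w 0"
  shows "\<forall>\<^sub>F x in at_right 0. 0 < u x"
proof -
  have "0 < phi (p / (p - 1)) (w 0)"
    using w0 by simp
  from has_real_derivative_pos_inc_right[OF plane_solD(1)[OF sol, of 0] this]
  obtain d where "0 < d" "\<And>h. 0 < h \<Longrightarrow> h \<le> 1 \<Longrightarrow> h < d \<Longrightarrow> u 0 < u h"
    by auto
  then show ?thesis
    unfolding eventually_at_right_field u0 by (intro exI[of _ "min d 1"]) auto
qed

text \<open>Kneser's theorem for the closed conditions \<open>\<not> alternates k 1 u\<close> and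
  \<open>zero_chain k 1 u\<close>, of which every solution satisfies at least one. As that theorem
  is about bounded right hand sides, the system is truncated at a level that the energy estimate, valid
  for the truncated system too, keeps out of reach.\<close>

lemma shooting:
  fixes F :: "real \<Rightarrow> real \<Rightarrow> real \<Rightarrow> real"
  assumes p: "1 < p"
    and F_cont: "continuous_on ({0..1} \<times> {0..1} \<times> UNIV) (\<lambda>(\<tau>, x, s). F \<tau> x s)"
    and F_bound: "\<And>\<tau> x s. \<tau> \<in> {0..1} \<Longrightarrow> x \<in> {0..1} \<Longrightarrow> \<bar>F \<tau> x s\<bar> \<le> C * \<bar>s\<bar> powr (p - 1)"
    and few: "\<And>u w. plane_sol p (F 0) u w \<Longrightarrow> u 0 = 0 \<Longrightarrow> w 0 = 1 \<Longrightarrow> \<not> zero_chain k 1 u"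
    and many: "\<And>u w. plane_sol p (F 1) u w \<Longrightarrow> u 0 = 0 \<Longrightarrow> w 0 = 1 \<Longrightarrow> alternates k 1 u"
  shows "\<exists>\<tau>\<in>{0..1}. \<exists>u w. plane_sol p (F \<tau>) u w \<and> u 0 = 0 \<and> w 0 = 1 \<and>
    zero_chain k 1 u \<and> \<not> alternates k 1 u"
proof -
  define q where "q = p / (p - 1)"
  have q: "1 < q"
    using p by (simp add: q_def)
  have C: "0 \<le> C"
    using F_bound[of 0 0 1] abs_ge_zero[of "F 0 0 1"] by simp
  define L where "L = (1 + C) * (p + p / (p - 1))"
  \<comment> \<open>a level beyond the energy bound, see \<open>bound\<close> below\<close>
  define R where "R = (p + q) * exp L"
  have L0: "0 \<le> L"
    using C p by (simp add: L_def)
  have R1: "1 \<le> R"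
  proof -
    have "1 * 1 \<le> (p + q) * exp L"
      using p q L0 by (intro mult_mono) auto
    then show ?thesis by (simp add: R_def)
  qed
  define cut where "cut s = max (- R) (min R s)" for s
  have cut_le: "\<bar>cut s\<bar> \<le> R" "\<bar>cut s\<bar> \<le> \<bar>s\<bar>" for s
    using R1 by (auto simp: cut_def)
  have cut_id: "cut s = s" if "\<bar>s\<bar> \<le> R" for s
    using that by (auto simp: cut_def)
  have cut_cont: "continuous_on X (\<lambda>x. cut (g x))" if "continuous_on X g" for X :: "'b::topological_space set" and g
    unfolding cut_def by (intro continuous_intros that)
  define G where "G \<tau> t y = (phi q (cut (snd y)), - F \<tau> t (cut (fst y)))" for \<tau> t and y :: "real \<times> real"
  interpret bounded_family G "R powr (q - 1) + C * R powr (p - 1)" "(0, 1)"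
  proof
    show "continuous_on ({0..1} \<times> {0..1} \<times> UNIV) (\<lambda>(\<tau>, t, y). G \<tau> t y)"
    proof -
      have "continuous_on ({0..1} \<times> {0..1} \<times> UNIV)
          (\<lambda>z :: real \<times> real \<times> real \<times> real. (\<lambda>(\<tau>, x, s). F \<tau> x s) (fst z, fst (snd z), cut (fst (snd (snd z)))))"
        by (rule continuous_on_compose2[OF F_cont])
          (intro continuous_intros cut_cont, auto)
      then have "continuous_on ({0..1} \<times> {0..1} \<times> UNIV)
          (\<lambda>z :: real \<times> real \<times> real \<times> real. (phi q (cut (snd (snd (snd z)))), - F (fst z) (fst (snd z)) (cut (fst (snd (snd z))))))"
        by (intro continuous_intros cut_cont q) simp_all
      then show ?thesis
        by (simp add: G_def case_prod_beta)
    qed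
    show "norm (G \<tau> t y) \<le> R powr (q - 1) + C * R powr (p - 1)" if "\<tau> \<in> {0..1}" "t \<in> {0..1}" for \<tau> t y
    proof -
      have "norm (G \<tau> t y) \<le> \<bar>phi q (cut (snd y))\<bar> + \<bar>F \<tau> t (cut (fst y))\<bar>"
        unfolding G_def using norm_Pair_le[of "phi q (cut (snd y))" "- F \<tau> t (cut (fst y))"] by simp
      also have "\<bar>phi q (cut (snd y))\<bar> \<le> R powr (q - 1)"
        unfolding abs_phi using q cut_le by (intro powr_mono2) auto
      also have "\<bar>F \<tau> t (cut (fst y))\<bar> \<le> C * \<bar>cut (fst y)\<bar> powr (p - 1)"
        using that by (rule F_bound)
      also have "\<dots> \<le> C * R powr (p - 1)"
        using p C cut_le by (intro mult_left_mono powr_mono2) auto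
      finally show ?thesis by simp
    qed
  qed
  have sol: "plane_sol p (F \<tau>) (fst \<circ> y) (snd \<circ> y)" and init: "(fst \<circ> y) 0 = 0" "(snd \<circ> y) 0 = 1"
    if y: "solves \<tau> y" and \<tau>: "\<tau> \<in> {0..1}" for \<tau> y
  proof -
    show init: "(fst \<circ> y) 0 = 0" "(snd \<circ> y) 0 = 1"
      using y by (simp_all add: solves_def)
    have du: "(fst \<circ> y has_real_derivative phi q (cut (snd (y t)))) (at t within {0..1})"
      and dw: "(snd \<circ> y has_real_derivative - F \<tau> t (cut (fst (y t)))) (at t within {0..1})"
      if "t \<in> {0..1}" for t
    proof -
      have "(y has_vector_derivative G \<tau> t (y t)) (at t within {0..1})"
        using y that by (simp add: solves_def)
      from bounded_linear.has_vector_derivative[OF bounded_linear_fst this]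
        bounded_linear.has_vector_derivative[OF bounded_linear_snd this]
      show "(fst \<circ> y has_real_derivative phi q (cut (snd (y t)))) (at t within {0..1})"
        "(snd \<circ> y has_real_derivative - F \<tau> t (cut (fst (y t)))) (at t within {0..1})"
        by (simp_all add: G_def has_real_derivative_iff_has_vector_derivative o_def)
    qed
    have uc: "continuous_on {0..1} (fst \<circ> y)" and wc: "continuous_on {0..1} (snd \<circ> y)"
      by (rule DERIV_continuous_on, erule du dw)+
    have at: "at t within {0..1} = at t" if "t \<in> {0<..<1}" for t :: real
      using at_within_Icc_at[of 0 t 1] that by simp
    have small: "\<bar>fst (y t)\<bar> \<le> R" "\<bar>snd (y t)\<bar> \<le> R" if t: "t \<in> {0..1}" for t
    proof -
      have "energy p ((fst \<circ> y) t) ((snd \<circ> y) t) \<le> energy p ((fst \<circ> y) 0) ((snd \<circ> y) 0) * exp L"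
        unfolding L_def
      proof (rule energy_gronwall(1)[OF p C uc wc _ _ _ _ t])
        fix t :: real assume t: "t \<in> {0<..<1}"
        show "(fst \<circ> y has_real_derivative phi q (cut (snd (y t)))) (at t)"
          "(snd \<circ> y has_real_derivative - F \<tau> t (cut (fst (y t)))) (at t)"
          using du[of t] dw[of t] t at[OF t] by simp_all
        show "\<bar>phi q (cut (snd (y t)))\<bar> \<le> \<bar>(snd \<circ> y) t\<bar> powr (p / (p - 1) - 1)"
          unfolding abs_phi q_def[symmetric] using q cut_le by (intro powr_mono2) auto
        have "\<bar>- F \<tau> t (cut (fst (y t)))\<bar> \<le> C * \<bar>cut (fst (y t))\<bar> powr (p - 1)"
          using t \<tau> F_bound[of \<tau> t] by simp
        also have "\<dots> \<le> C * \<bar>(fst \<circ> y) t\<bar> powr (p - 1)"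
          using p C cut_le by (intro mult_left_mono powr_mono2) auto
        finally show "\<bar>- F \<tau> t (cut (fst (y t)))\<bar> \<le> C * \<bar>(fst \<circ> y) t\<bar> powr (p - 1)" .
      qed
      also have "energy p ((fst \<circ> y) 0) ((snd \<circ> y) 0) \<le> 1"
        using p q unfolding init by (simp add: energy_def q_def[symmetric])
      finally have e: "energy p (fst (y t)) (snd (y t)) \<le> exp L"
        by simp
      have bound: "\<bar>s\<bar> \<le> R" if m: "1 < m" "m \<le> p + q" and "\<bar>s\<bar> powr m / m \<le> exp L" for s m :: real
      \<comment> \<open>where \<open>\<bar>s\<bar> \<ge> 1\<close>, \<open>\<bar>s\<bar>\<close> is at most its \<open>m\<close>-th power\<close>
      proof (cases "1 \<le> \<bar>s\<bar>")
        case True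
        then have "\<bar>s\<bar> \<le> \<bar>s\<bar> powr m"
          using powr_mono[of 1 m "\<bar>s\<bar>"] m by simp
        also have "\<dots> \<le> m * exp L"
          using that by (simp add: divide_le_eq mult.commute)
        also have "\<dots> \<le> R"
          unfolding R_def using m by (intro mult_right_mono) auto
        finally show ?thesis .
      qed (use R1 in simp)
      have nn: "0 \<le> \<bar>fst (y t)\<bar> powr p / p" "0 \<le> \<bar>snd (y t)\<bar> powr q / q"
        using p q by simp_all
      have "\<bar>fst (y t)\<bar> powr p / p \<le> exp L" "\<bar>snd (y t)\<bar> powr q / q \<le> exp L"
        using e nn unfolding energy_def q_def[symmetric] by linarith+
      then show "\<bar>fst (y t)\<bar> \<le> R" "\<bar>snd (y t)\<bar> \<le> R"
        using bound[of p "fst (y t)"] bound[of q "snd (y t)"] p q by simp_all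
    qed
    show "plane_sol p (F \<tau>) (fst \<circ> y) (snd \<circ> y)"
      unfolding plane_sol_def q_def[symmetric]
    proof (intro conjI ballI wc)
      show "(fst \<circ> y has_real_derivative phi q ((snd \<circ> y) t)) (at t within {0..1})" if "t \<in> {0..1}" for t
        using du[OF that] small(2)[OF that] by (simp add: cut_id)
      show "(snd \<circ> y has_real_derivative - F \<tau> t ((fst \<circ> y) t)) (at t)" if "t \<in> {0<..<1}" for t
        using dw[of t] small(1)[of t] that at[OF that] by (simp add: cut_id)
    qed
  qed
  have simple: "(fst \<circ> y) x \<noteq> 0 \<or> (snd \<circ> y) x \<noteq> 0"
    if "solves \<tau> y" "\<tau> \<in> {0..1}" "x \<in> {0..1}" for \<tau> y x
    using init(2)[OF that(1,2)] F_bound[OF that(2)] that(3)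
    by (intro plane_sol_simple[OF p sol[OF that(1,2)]]) auto
  have components: "uniform_limit {0..1} (\<lambda>n. fst \<circ> gs n) (fst \<circ> g) sequentially"
    "uniform_limit {0..1} (\<lambda>n. snd \<circ> gs n) (snd \<circ> g) sequentially"
    if "uniform_limit {0..1} gs g sequentially" for gs :: "nat \<Rightarrow> real \<Rightarrow> real \<times> real" and g
    using bounded_linear.uniform_limit[OF bounded_linear_fst that]
      bounded_linear.uniform_limit[OF bounded_linear_snd that] by (simp_all add: o_def)
  have "\<exists>\<tau>\<in>{0..1}. \<exists>y. solves \<tau> y \<and> \<not> alternates k 1 (fst \<circ> y) \<and> zero_chain k 1 (fst \<circ> y)"
  proof (rule solution_funnel_connected)
    show "limit_closed (\<lambda>y. \<not> alternates k 1 (fst \<circ> y))"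
      unfolding limit_closed_def
    proof (intro allI impI)
      fix gs :: "nat \<Rightarrow> real \<Rightarrow> real \<times> real" and g
      assume na: "\<forall>n. \<not> alternates k 1 (fst \<circ> gs n)"
        and lim: "uniform_limit {0..1} gs g sequentially"
      show "\<not> alternates k 1 (fst \<circ> g)"
        by (rule not_alternates_limit[of k 1 "\<lambda>n. fst \<circ> gs n"])
          (use na tendsto_uniform_limitI[OF components(1)[OF lim]] in auto)
    qed
    show "limit_closed (\<lambda>y. zero_chain k 1 (fst \<circ> y))"
      unfolding limit_closed_def
    proof (intro allI impI)
      fix gs :: "nat \<Rightarrow> real \<Rightarrow> real \<times> real" and g
      assume gs: "\<forall>n. \<exists>\<tau>\<in>{0..1}. solves \<tau> (gs n)" and g: "\<exists>\<tau>\<in>{0..1}. solves \<tau> g"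
        and zc: "\<forall>n. zero_chain k 1 (fst \<circ> gs n)"
        and lim: "uniform_limit {0..1} gs g sequentially"
      have s: "\<exists>\<tau>\<in>{0..1}. plane_sol p (F \<tau>) (fst \<circ> gs n) (snd \<circ> gs n)" for n
        using gs sol by blast
      have gsc: "continuous_on {0..1} (fst \<circ> gs n)" for n
        using s[of n] plane_solD(4) by blast
      have gsd: "(fst \<circ> gs n has_real_derivative phi q ((snd \<circ> gs n) x)) (at x)" if "x \<in> {0<..<1}" for n x
        using s[of n] plane_solD(5)[OF _ that] unfolding q_def by blast
      have gc: "continuous_on {0..1} (fst \<circ> g)" "continuous_on {0..1} (snd \<circ> g)"
        using g sol plane_solD(2,4) by blast+
      have gs: "(fst \<circ> g) x \<noteq> 0 \<or> (snd \<circ> g) x \<noteq> 0" if "x \<in> {0..1}" for x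
        using g simple that by blast
      show "zero_chain k 1 (fst \<circ> g)"
        by (rule zero_chain_limit[OF zc[rule_format] gsc gsd components[OF lim] gc gs])
    qed
    show "\<not> alternates k 1 (fst \<circ> y) \<or> zero_chain k 1 (fst \<circ> y)" if "\<tau> \<in> {0..1}" "solves \<tau> y" for \<tau> y
      using alternates_imp_zero_chain[OF plane_solD(4)[OF sol] init(1)] that by blast
    show "zero_chain k 1 (fst \<circ> y)" if y: "solves 1 y" for y
    proof -
      have 1: "(1::real) \<in> {0..1}" by simp
      show ?thesis
        by (rule alternates_imp_zero_chain[OF plane_solD(4)[OF sol[OF y 1]] init(1)[OF y 1]
              many[OF sol[OF y 1] init[OF y 1]]])
    qed
    show "\<not> alternates k 1 (fst \<circ> y)" if y: "solves 0 y" for y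
    proof -
      have 0: "(0::real) \<in> {0..1}" by simp
      show ?thesis
        using few[OF sol[OF y 0] init[OF y 0]]
          alternates_imp_zero_chain[OF plane_solD(4)[OF sol[OF y 0]] init(1)[OF y 0]] by blast
    qed
  qed
  then show ?thesis
    using sol init by blast
qed

section \<open>Sturm comparison and oscillation\<close>

text \<open>On an interval where $s$ has one sign this is a multiple of $\varphi_p(s)$, with a weight that depends on
  the sign only through $\alpha$ or $-\beta$ (\<open>half_linear_signed\<close>).\<close>

definition half_linear ::
    "real \<Rightarrow> (real \<Rightarrow> real) \<Rightarrow> (real \<Rightarrow> real) \<Rightarrow> (real \<Rightarrow> real) \<Rightarrow> real \<Rightarrow> real \<Rightarrow> real \<Rightarrow> real" where
  "half_linear p a \<alpha> \<beta> lam x s =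
     lam * a x * phi p s + \<alpha> x * phi p (pos_part s) + \<beta> x * phi p (neg_part s)"

lemma half_linear_pos: "0 < s \<Longrightarrow> half_linear p a \<alpha> \<beta> lam x s = (lam * a x + \<alpha> x) * phi p s"
  by (simp add: half_linear_def pos_part_def neg_part_def algebra_simps)

lemma half_linear_neg: "s < 0 \<Longrightarrow> half_linear p a \<alpha> \<beta> lam x s = (lam * a x - \<beta> x) * phi p s"
  by (simp add: half_linear_def pos_part_def neg_part_def algebra_simps)

lemma half_linear_signed:
  assumes "0 < (-1) ^ i * s"
  shows "half_linear p a \<alpha> \<beta> lam x s = (lam * a x + (if even i then \<alpha> x else - \<beta> x)) * phi p s"
  using assms by (cases "even i") (simp_all add: half_linear_pos half_linear_neg)

lemma half_linear_bound:
  assumes "\<bar>lam * a x\<bar> \<le> A" "\<bar>\<alpha> x\<bar> \<le> B" "\<bar>\<beta> x\<bar> \<le> B"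
  shows "\<bar>half_linear p a \<alpha> \<beta> lam x s\<bar> \<le> (A + B) * \<bar>s\<bar> powr (p - 1)"
proof -
  have "\<bar>lam * a x + \<gamma>\<bar> * \<bar>phi p s\<bar> \<le> (A + B) * \<bar>phi p s\<bar>" if "\<bar>\<gamma>\<bar> \<le> B" for \<gamma>
    using assms(1) that by (intro mult_right_mono) auto
  from this[of "\<alpha> x"] this[of "- \<beta> x"] assms(2,3)
  have bounds: "\<bar>lam * a x + \<alpha> x\<bar> * \<bar>phi p s\<bar> \<le> (A + B) * \<bar>phi p s\<bar>"
    "\<bar>lam * a x - \<beta> x\<bar> * \<bar>phi p s\<bar> \<le> (A + B) * \<bar>phi p s\<bar>"
    by simp_all
  consider "0 < s" | "s < 0" | "s = 0" by linarith
  then show ?thesis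
  proof cases
    case 1
    show ?thesis
      unfolding half_linear_pos[OF 1] abs_mult abs_phi[symmetric] by (rule bounds(1))
  next
    case 2
    show ?thesis
      unfolding half_linear_neg[OF 2] abs_mult abs_phi[symmetric] by (rule bounds(2))
  next
    case 3
    then show ?thesis by (simp add: half_linear_def pos_part_def neg_part_def)
  qed
qed

lemma interlacing_signs:
  assumes k: "1 \<le> k" and u: "continuous_on {0..1} u" and u0: "u 0 = 0" and cr: "crosses u"
    and pos: "\<forall>\<^sub>F x in at_right 0. 0 < u x" and zc: "zero_chain k 1 u"
  shows "\<exists>y s. y 0 = (0::real) \<and> (\<forall>i\<le>k. u (y i) = 0) \<and>
    (\<forall>i<k. y i < s i \<and> s i < y (Suc i) \<and> 0 < (-1) ^ i * u (s i)) \<and> y k \<le> 1"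
proof -
  obtain z where z: "z 0 = 0" "\<forall>i<k. z i < z (Suc i)" "\<forall>i\<le>k. u (z i) = 0" "z k \<le> 1"
    using zc by (auto simp: zero_chain_def)
  obtain m where m: "k = Suc m"
    using k by (cases k) auto
  have "alternates m (z k) u"
    by (rule zero_chain_imp_alternates[of u z m, OF cr pos z(1)]) (use z m in auto)
  from alternates_imp_zeros_between[OF u u0 z(4) this] obtain y s where
    y: "y 0 = (0::real)" "\<forall>i\<le>m. u (y i) = 0 \<and> y i < s i \<and> 0 < (-1) ^ i * u (s i)"
    "\<forall>i<m. s i < y (Suc i)" "s m < z k"
    by blast
  show ?thesis
  proof (rule exI[of _ "\<lambda>i. if i \<le> m then y i else z k"], rule exI[of _ s], intro conjI allI impI)
    fix i assume "i < k"
    then show "(if i \<le> m then y i else z k) < s i" "0 < (-1) ^ i * u (s i)"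
      using y(2) m by auto
    show "s i < (if Suc i \<le> m then y (Suc i) else z k)"
      using y(3,4) m \<open>i < k\<close> by (cases "i = m") auto
  qed (use y z m in \<open>auto simp: le_Suc_eq\<close>)
qed

text \<open>If $v$ has the sign opposite to $(-1)^i$ somewhere in the $i$-th interval for each $i$, then these
  points alternate, and a point near $0$ where $v > 0$ comes before them as a further term.\<close>

lemma alternates_of_sign_breaks:
  assumes pos: "\<forall>\<^sub>F x in at_right 0. 0 < v x"
    and k: "1 \<le> k" and y: "0 \<le> y 0" "\<forall>i<k. y i < y (Suc i)" "y k \<le> 1"
    and t: "\<And>i. i < k \<Longrightarrow> \<exists>t. y i < t \<and> t < y (Suc i) \<and> (-1) ^ i * v t < 0"
  shows "alternates k 1 v"
proof -
  obtain t where t: "\<And>i. i < k \<Longrightarrow> y i < t i \<and> t i < y (Suc i) \<and> (-1) ^ i * v (t i) < 0"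
    using t by metis
  have t01: "0 < t i \<and> t i < 1" if "i < k" for i
    using t[OF that] y(1,3) step_mono(1)[OF y(2), of 0 i] step_mono(1)[OF y(2), of "Suc i" k] that by auto
  obtain d where d: "0 < d" "\<And>x. 0 < x \<Longrightarrow> x < d \<Longrightarrow> 0 < v x"
    using pos by (auto simp: eventually_at_right_field)
  define e where "e = min d (t 0) / 2"
  have e: "0 < e" "e < d" "e < t 0"
    using d(1) t01[of 0] k by (auto simp: e_def min_def)
  define s where "s i = (case i of 0 \<Rightarrow> e | Suc j \<Rightarrow> t j)" for i
  have "s i < s (Suc i)" if "i < k" for i
  proof (cases i)
    case (Suc j)
    then show ?thesis using t[of j] t[of i] that by (simp add: s_def)
  qed (use e in \<open>simp add: s_def\<close>)
  moreover have "0 \<le> s i \<and> s i < 1 \<and> 0 < (-1) ^ i * v (s i)" if "i \<le> k" for i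
  proof (cases i)
    case 0
    then show ?thesis using e d(2)[of e] t01[of 0] k by (simp add: s_def)
  next
    case (Suc j)
    then show ?thesis using t[of j] t01[of j] that by (simp add: s_def)
  qed
  ultimately show ?thesis
    unfolding alternates_def by blast
qed

lemma sign_lobe:
  fixes u :: "real \<Rightarrow> real"
  assumes u: "continuous_on {l..r} u" and u0: "u l = 0" "u r = 0" and s: "l < s" "s < r" "u s \<noteq> 0"
  shows "\<exists>c d. l \<le> c \<and> c < s \<and> s < d \<and> d \<le> r \<and> u c = 0 \<and> u d = 0 \<and> (\<forall>x\<in>{c<..<d}. 0 < u x * u s)"
proof -
  have cl: "compact {x \<in> {a..b}. u x = 0}" if "l \<le> a" "b \<le> r" for a b
  proof -
    have "closed ({a..b} \<inter> u -` {0})"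
      using that by (intro continuous_closed_preimage continuous_on_subset[OF u]) auto
    then have "compact ({a..b} \<inter> ({a..b} \<inter> u -` {0}))"
      by (intro compact_Int_closed) auto
    moreover have "{a..b} \<inter> ({a..b} \<inter> u -` {0}) = {x \<in> {a..b}. u x = 0}"
      by auto
    ultimately show ?thesis by simp
  qed
  have "{x \<in> {l..s}. u x = 0} \<noteq> {}" "{x \<in> {s..r}. u x = 0} \<noteq> {}"
    using u0 s by force+
  then obtain c d where c: "c \<in> {x \<in> {l..s}. u x = 0}" "\<forall>x\<in>{x \<in> {l..s}. u x = 0}. x \<le> c"
    and d: "d \<in> {x \<in> {s..r}. u x = 0}" "\<forall>x\<in>{x \<in> {s..r}. u x = 0}. d \<le> x"
    using compact_attains_sup[OF cl[of l s]] compact_attains_inf[OF cl[of s r]] s by auto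
  have cs: "c < s" "s < d"
    using c(1) d(1) s(3) by (auto simp: less_le)
  have nz: "u x \<noteq> 0" if "c < x" "x < d" for x
  proof
    assume "u x = 0"
    then have "x \<le> s \<Longrightarrow> x \<le> c" "s \<le> x \<Longrightarrow> d \<le> x"
      using that c d by auto
    then show False using that by linarith
  qed
  have "0 < u x * u s" if x: "c < x" "x < d" for x
  proof (rule ccontr)
    assume "\<not> 0 < u x * u s"
    then have neg: "u x * u s < 0"
      using nz[OF x] s(3) by (simp add: not_less le_less)
    have sq: "0 < u s * u s"
      using s(3) not_real_square_gt_zero by blast
    have cont: "continuous_on {a..b} (\<lambda>t. u t * u s)" if "c \<le> a" "b \<le> d" for a b
      using that c d by (intro continuous_intros continuous_on_subset[OF u]) auto
    obtain y where "c < y" "y < d" "u y * u s = 0"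
    proof (cases "x \<le> s")
      case True
      then obtain y where "x \<le> y" "y \<le> s" "u y * u s = 0"
        using IVT'[of "\<lambda>t. u t * u s" x 0 s] cont[of x s] neg sq x cs by auto
      with x cs show thesis by (intro that[of y]) auto
    next
      case False
      then obtain y where "s \<le> y" "y \<le> x" "u y * u s = 0"
        using IVT2'[of "\<lambda>t. u t * u s" x 0 s] cont[of s x] neg sq x cs by auto
      with x cs show thesis by (intro that[of y]) auto
    qed
    then show False using nz s(3) by auto
  qed
  then show ?thesis
    using c d cs by (intro exI[of _ c] exI[of _ d]) auto
qed

text \<open>A zero inside an interval of constant sign is a local extremum, hence not simple.\<close>

lemma one_signed_nonzero:
  assumes v: "plane_sol p F v z" and lr: "0 \<le> l" "r \<le> 1"
    and simple: "\<And>x. x \<in> {0..1} \<Longrightarrow> v x \<noteq> 0 \<or> z x \<noteq> 0"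
    and sgn: "\<And>x. l < x \<Longrightarrow> x < r \<Longrightarrow> 0 \<le> \<sigma> * v x" and \<sigma>: "\<sigma> \<noteq> 0" and x: "l < x" "x < r"
  shows "v x \<noteq> 0"
proof
  assume v0: "v x = 0"
  have x01: "x \<in> {0<..<1}"
    using x lr by auto
  have d: "((\<lambda>t. \<sigma> * v t) has_real_derivative \<sigma> * phi (p / (p - 1)) (z x)) (at x)"
    by (rule DERIV_cmult[OF plane_solD(5)[OF v x01]])
  have "\<sigma> * phi (p / (p - 1)) (z x) = 0"
    by (rule DERIV_local_min[OF d, of "min (x - l) (r - x)"])
      (use x v0 in \<open>auto intro!: sgn\<close>)
  then have "z x = 0"
    using \<sigma> by simp
  with simple[of x] v0 x01 show False by auto
qed

text \<open>Choose lobes of $u$ of alternating signs, one after the other. Were $v$ nowhere of the opposite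
  sign on the $i$-th of them, then $u$ and $v$ would have the same sign there, and the weights in front of $\varphi_p(u)$ and
  $\varphi_p(v)$ would be $\lambda a + \gamma$ and $\mu a + \gamma$ with the same $\gamma$, which contradicts
  Picone's inequality. So $v$ breaks
  the sign pattern of $u$ on all of the lobes, and this alone gives the sign changes; no zeros of $v$ are counted.\<close>

lemma sturm_comparison:
  assumes p: "1 < p" and a: "\<And>x. x \<in> {0..1} \<Longrightarrow> 0 < a x" and lam: "lam < mu"
    and u: "plane_sol p (half_linear p a \<alpha> \<beta> lam) u w" and v: "plane_sol p (half_linear p a \<alpha> \<beta> mu) v z"
    and u0: "u 0 = 0" and cr: "crosses u" and upos: "\<forall>\<^sub>F x in at_right 0. 0 < u x"
    and vpos: "\<forall>\<^sub>F x in at_right 0. 0 < v x"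
    and simple: "\<And>x. x \<in> {0..1} \<Longrightarrow> v x \<noteq> 0 \<or> z x \<noteq> 0"
    and k: "1 \<le> k" and zc: "zero_chain k 1 u"
  shows "alternates k 1 v"
proof -
  note uc = plane_solD(4)[OF u]
  obtain y s where y: "y 0 = 0" "\<forall>i\<le>k. u (y i) = 0"
    "\<forall>i<k. y i < s i \<and> s i < y (Suc i) \<and> 0 < (-1) ^ i * u (s i)" "y k \<le> 1"
    using interlacing_signs[OF k uc u0 cr upos zc] by blast
  have ym: "\<forall>i<k. y i < y (Suc i)"
    using y(3) less_trans by blast
  show ?thesis
  proof (rule alternates_of_sign_breaks[OF vpos k _ ym y(4)])
    show "0 \<le> y 0" by (simp add: y(1))
    fix i assume i: "i < k"
    show "\<exists>t. y i < t \<and> t < y (Suc i) \<and> (-1) ^ i * v t < 0"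
    proof (rule ccontr)
      assume "\<not> ?thesis"
      then have sgn: "0 \<le> (-1) ^ i * v t" if "y i < t" "t < y (Suc i)" for t
        using that by force
      have y01: "0 \<le> y i" "y (Suc i) \<le> 1"
        using step_mono(1)[OF ym, of 0 i] step_mono(1)[OF ym, of "Suc i" k] i y(1,4) by auto
      have si: "y i < s i" "s i < y (Suc i)" "0 < (-1) ^ i * u (s i)"
        using y(3) i by auto
      then have "u (s i) \<noteq> 0" by auto
      moreover have "continuous_on {y i..y (Suc i)} u"
        using y01 by (intro continuous_on_subset[OF uc]) auto
      ultimately obtain c d where cd: "y i \<le> c" "c < s i" "s i < d" "d \<le> y (Suc i)" "u c = 0" "u d = 0"
        "\<forall>x\<in>{c<..<d}. 0 < u x * u (s i)"
        using sign_lobe[of "y i" "y (Suc i)" u "s i"] y(2) i si by force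
      \<comment> \<open>the weights on a lobe where both functions have the sign of \<open>(-1) ^ i\<close>\<close>
      define \<gamma> where "\<gamma> x = (if even i then \<alpha> x else - \<beta> x)" for x
      have us: "0 < (-1) ^ i * u x" if "x \<in> {c<..<d}" for x
        using cd(7) that si(3) by (cases "even i") (auto simp: zero_less_mult_iff)
      have vs: "0 < (-1) ^ i * v x" if x: "x \<in> {c<..<d}" for x
      proof -
        have "v x \<noteq> 0"
          by (rule one_signed_nonzero[OF v y01 simple sgn]) (use x cd in auto)
        then have "(-1) ^ i * v x \<noteq> 0" by simp
        moreover have "0 \<le> (-1) ^ i * v x"
          using x cd by (intro sgn) auto
        ultimately show ?thesis by linarith
      qed
      show False
      proof (rule picone_comparison[OF p _ _ _ u v])
        show "0 \<le> c" "c < d" "d \<le> 1"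
          using cd y01 by auto
        fix x assume x: "x \<in> {c<..<d}"
        show "half_linear p a \<alpha> \<beta> lam x (u x) = (lam * a x + \<gamma> x) * phi p (u x)"
          unfolding \<gamma>_def by (rule half_linear_signed[OF us[OF x]])
        show "half_linear p a \<alpha> \<beta> mu x (v x) = (mu * a x + \<gamma> x) * phi p (v x)"
          unfolding \<gamma>_def by (rule half_linear_signed[OF vs[OF x]])
        have "0 < a x"
          using x cd y01 by (intro a) auto
        then show "lam * a x + \<gamma> x < mu * a x + \<gamma> x"
          using lam by simp
        show "u x \<noteq> 0" "v x \<noteq> 0"
          using us[OF x] vs[OF x] by auto
      next
        show "u c = 0" "u d = 0" "v c \<noteq> 0 \<or> z c \<noteq> 0" "v d \<noteq> 0 \<or> z d \<noteq> 0"
          using cd y01 simple[of c] simple[of d] by auto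
      qed
    qed
  qed
qed

lemma phi_le_iff: "1 < p \<Longrightarrow> phi p s \<le> phi p t \<longleftrightarrow> s \<le> t"
  using phi_strict_mono[of p s t] phi_strict_mono[of p t s]
  by (cases s t rule: linorder_cases) auto

text \<open>By the Riccati inequality $\rho = z/\varphi_p(v)$ drops by at least $Kh/3$ over the middle third of the
  interval. So $|v'/v| \ge 4/h$ at an end of the middle third, with $|v|$ growing towards the middle. Because $|v|$ is
  concave, going outwards from that point by $h/4$, which stays inside the interval, brings $|v|$ down to $0$.\<close>

lemma no_long_lobe:
  assumes p: "1 < p" and v: "plane_sol p F v z" and c: "0 \<le> c" and h: "0 < h" "c + h \<le> 1"
    and \<sigma>: "\<sigma> = 1 \<or> \<sigma> = - 1"
    and pos: "\<And>x. c < x \<Longrightarrow> x < c + h \<Longrightarrow> 0 < \<sigma> * v x"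
    and F: "\<And>x. c < x \<Longrightarrow> x < c + h \<Longrightarrow> F x (v x) = Q x * phi p (v x)"
    and Q: "\<And>x. c < x \<Longrightarrow> x < c + h \<Longrightarrow> K \<le> Q x"
    and K: "phi p (4 / h) \<le> K * h / 6"
  shows False
proof -
  define q where "q = p / (p - 1)"
  have q: "1 < q"
    using p by (simp add: q_def)
  have K0: "0 < K"
  proof -
    have "0 < phi p (4 / h)"
      using h by simp
    then have "0 < K * h / 6"
      using K by linarith
    then show ?thesis
      using h by (simp add: zero_less_mult_iff)
  qed
  have x01: "x \<in> {0<..<1}" if "c < x" "x < c + h" for x
    using that c h by auto
  \<comment> \<open>the ends of the middle third\<close>
  define m1 m2 where "m1 = c + h / 3" and "m2 = c + 2 * h / 3"
  have m: "c < m1" "m1 < m2" "m2 < c + h" "m2 - m1 = h / 3"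
    using h by (simp_all add: m1_def m2_def)
  define \<rho> where "\<rho> x = z x / phi p (v x)" for x
  have dv: "((\<lambda>x. \<sigma> * v x) has_real_derivative \<sigma> * phi q (z x)) (at x)" if "c < x" "x < c + h" for x
    unfolding q_def by (rule DERIV_cmult[OF plane_solD(5)[OF v x01[OF that]]])
  have slope: "phi q (\<rho> x) = (\<sigma> * phi q (z x)) / (\<sigma> * v x)" for x
    using \<sigma> p by (auto simp: \<rho>_def phi_divide phi_conj_phi q_def)
  have z_anti: "\<sigma> * z y \<le> \<sigma> * z x" if "c < x" "x \<le> y" "y < c + h" for x y
  proof (rule DERIV_nonpos_imp_nonincreasing[of x y "\<lambda>t. \<sigma> * z t"])
    show "x \<le> y" by fact
    fix t assume t: "x \<le> t" "t \<le> y"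
    then have tc: "c < t" "t < c + h"
      using that by auto
    have "((\<lambda>t. \<sigma> * z t) has_real_derivative \<sigma> * - F t (v t)) (at t)"
      by (rule DERIV_cmult[OF plane_solD(3)[OF v x01[OF tc]]])
    moreover have "\<sigma> * - F t (v t) = - Q t * phi p (\<sigma> * v t)"
      using \<sigma> F[OF tc] by auto
    moreover have "0 \<le> Q t * phi p (\<sigma> * v t)"
      using Q[OF tc] K0 pos[OF tc] by (intro mult_nonneg_nonneg less_imp_le[of 0 "phi p (\<sigma> * v t)"]) auto
    ultimately show "\<exists>y. ((\<lambda>t. \<sigma> * z t) has_real_derivative y) (at t) \<and> y \<le> 0"
      by auto
  qed
  have dv_anti: "\<sigma> * phi q (z y) \<le> \<sigma> * phi q (z x)" if "c < x" "x \<le> y" "y < c + h" for x y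
  proof -
    have "phi q (\<sigma> * z y) \<le> phi q (\<sigma> * z x)"
      using z_anti[OF that] by (simp add: phi_le_iff q)
    then show ?thesis
      using \<sigma> by auto
  qed
  have riccati: "\<exists>D. ((\<lambda>x. - \<rho> x) has_real_derivative D) (at x) \<and> K \<le> D" if x: "c < x" "x < c + h" for x
  proof -
    have "v x \<noteq> 0"
      using pos[OF x] by auto
    moreover have "((\<lambda>x. 1) has_real_derivative phi (p / (p - 1)) 0) (at x)"
      "((\<lambda>x. 0) has_real_derivative - (0 * phi p 1)) (at x)"
      by simp_all
    ultimately obtain D where "((\<lambda>x. 1 * 0 - \<bar>1\<bar> powr p * (z x / phi p (v x))) has_real_derivative D) (at x)"
      "(Q x - 0) * \<bar>1\<bar> powr p \<le> D"
      using picone_inequality[OF p, of v x "\<lambda>_. 1" "\<lambda>_. 0" z 0 "Q x"] plane_solD(5)[OF v x01[OF x]]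
        plane_solD(3)[OF v x01[OF x]] F[OF x] by metis
    then show ?thesis
      using Q[OF x] by (intro exI[of _ D]) (simp add: \<rho>_def[abs_def])
  qed
  have drop: "K * h / 3 \<le> \<rho> m1 - \<rho> m2"
  proof -
    obtain D where D: "\<And>x. c < x \<Longrightarrow> x < c + h \<Longrightarrow> ((\<lambda>x. - \<rho> x) has_real_derivative D x) (at x) \<and> K \<le> D x"
      using riccati by metis
    have "((\<lambda>x. - \<rho> x) has_real_derivative D x) (at x)" if "m1 \<le> x" "x \<le> m2" for x
      using D[of x] that m by auto
    from MVT2[OF m(2) this] obtain \<xi> where \<xi>: "m1 < \<xi>" "\<xi> < m2" "- \<rho> m2 - - \<rho> m1 = (m2 - m1) * D \<xi>"
      by auto
    have "(h / 3) * K \<le> (h / 3) * D \<xi>"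
      using D[of \<xi>] \<xi> m h by (intro mult_left_mono) auto
    with \<xi>(3) m(4) show ?thesis by (simp add: mult.commute)
  qed
  have mvt: "\<exists>\<xi>. x < \<xi> \<and> \<xi> < y \<and> \<sigma> * v y - \<sigma> * v x = (y - x) * (\<sigma> * phi q (z \<xi>))"
    if "c < x" "x < y" "y < c + h" for x y
    by (rule MVT2[OF that(2)]) (use that in \<open>auto intro!: dv\<close>)
  show False
  proof (cases "phi p (4 / h) \<le> \<rho> m1")
    case True
    then have "phi q (phi p (4 / h)) \<le> phi q (\<rho> m1)"
      using q by (simp add: phi_le_iff)
    then have "4 / h \<le> (\<sigma> * phi q (z m1)) / (\<sigma> * v m1)"
      using p by (simp add: q_def phi_conj_phi slope[unfolded q_def])
    moreover have "0 < \<sigma> * v m1"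
      using m by (intro pos) auto
    ultimately have m1: "(4 / h) * (\<sigma> * v m1) \<le> \<sigma> * phi q (z m1)"
      by (simp only: pos_le_divide_eq)
    \<comment> \<open>the step to the left has length \<open>m1 - (c + h / 12) = h / 4\<close>\<close>
    obtain \<xi> where \<xi>: "c + h / 12 < \<xi>" "\<xi> < m1"
      "\<sigma> * v m1 - \<sigma> * v (c + h / 12) = (m1 - (c + h / 12)) * (\<sigma> * phi q (z \<xi>))"
      using mvt[of "c + h / 12" m1] m h by (auto simp: m1_def)
    have "\<sigma> * v m1 = (h / 4) * ((4 / h) * (\<sigma> * v m1))"
      using h by simp
    also have "\<dots> \<le> (h / 4) * (\<sigma> * phi q (z \<xi>))"
      using m1 dv_anti[of \<xi> m1] \<xi> m h by (intro mult_left_mono) auto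
    also have "h / 4 = m1 - (c + h / 12)"
      by (simp add: m1_def)
    finally have "\<sigma> * v (c + h / 12) \<le> 0"
      using \<xi>(3) by linarith
    with pos[of "c + h / 12"] h show False by simp
  next
    case False
    then have "\<rho> m2 \<le> - phi p (4 / h)"
      using drop K by linarith
    then have "\<rho> m2 \<le> phi p (- (4 / h))"
      by (simp only: phi_minus)
    then have "phi q (\<rho> m2) \<le> phi q (phi p (- (4 / h)))"
      by (simp only: phi_le_iff[OF q])
    then have "phi q (\<rho> m2) \<le> - (4 / h)"
      by (simp only: q_def phi_conj_phi[OF p])
    then have "(\<sigma> * phi q (z m2)) / (\<sigma> * v m2) \<le> - (4 / h)"
      by (simp only: slope)
    moreover have "0 < \<sigma> * v m2"
      using m by (intro pos) auto
    ultimately have m2: "\<sigma> * phi q (z m2) \<le> - (4 / h) * (\<sigma> * v m2)"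
      by (simp only: pos_divide_le_eq)
    \<comment> \<open>the step to the right has length \<open>c + 11 * h / 12 - m2 = h / 4\<close>\<close>
    obtain \<xi> where \<xi>: "m2 < \<xi>" "\<xi> < c + 11 * h / 12"
      "\<sigma> * v (c + 11 * h / 12) - \<sigma> * v m2 = (c + 11 * h / 12 - m2) * (\<sigma> * phi q (z \<xi>))"
      using mvt[of m2 "c + 11 * h / 12"] m h by (auto simp: m2_def)
    have "c + 11 * h / 12 - m2 = h / 4"
      by (simp add: m2_def)
    then have "\<sigma> * v (c + 11 * h / 12) - \<sigma> * v m2 = (h / 4) * (\<sigma> * phi q (z \<xi>))"
      using \<xi>(3) by simp
    also have "\<dots> \<le> (h / 4) * (- (4 / h) * (\<sigma> * v m2))"
      using m2 dv_anti[of m2 \<xi>] \<xi> m h by (intro mult_left_mono) auto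
    also have "\<dots> = - (\<sigma> * v m2)"
      using h by simp
    finally have "\<sigma> * v (c + 11 * h / 12) \<le> 0"
      by simp
    with pos[of "c + 11 * h / 12"] h show False by simp
  qed
qed

section \<open>Half-eigenvalues\<close>

lemma plane_sol_deriv01:
  assumes "plane_sol p F u w" "x \<in> {0..1}"
  shows "deriv01 u x = phi (p / (p - 1)) (w x)"
  using plane_solD(1)[OF assms] assms(2) unfolding deriv01_def
  by (intro vector_derivative_within_closed_interval) (auto simp: has_real_derivative_iff_has_vector_derivative)

lemma dirichlet_of_plane_sol:
  assumes p: "1 < p" and sol: "plane_sol p F u w" and b: "u 0 = 0" "u 1 = 0"
  shows "dirichlet_solution p F u"
proof -
  have w: "phi p (deriv01 u x) = w x" if "x \<in> {0..1}" for x
    by (simp add: plane_sol_deriv01[OF sol that] phi_phi_conj p)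
  have "u differentiable_on {0..1}"
    unfolding differentiable_on_def
    using plane_solD(1)[OF sol] has_field_derivative_imp_has_derivative differentiableI by blast
  moreover have "continuous_on {0..1} (deriv01 u)"
  proof (rule continuous_on_eq)
    show "continuous_on {0..1} (\<lambda>x. phi (p / (p - 1)) (w x))"
      using p by (intro continuous_intros plane_solD(2)[OF sol]) simp
  qed (simp add: plane_sol_deriv01[OF sol])
  moreover have "((\<lambda>t. phi p (deriv01 u t)) has_real_derivative - F x (u x)) (at x)" if x: "x \<in> {0<..<1}" for x
    by (rule has_field_derivative_transform_within_open[OF plane_solD(3)[OF sol x] _ x]) (auto simp: w)
  ultimately show ?thesis
    using b by (simp add: dirichlet_solution_def E_def)
qed

lemma plane_sol_of_dirichlet:
  assumes p: "1 < p" and u: "dirichlet_solution p F u"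
  shows "plane_sol p F u (\<lambda>x. phi p (deriv01 u x))" "u 0 = 0" "u 1 = 0"
proof -
  have uE: "u differentiable_on {0..1}" "continuous_on {0..1} (deriv01 u)" "u 0 = 0" "u 1 = 0"
    using u by (auto simp: dirichlet_solution_def E_def)
  then show "u 0 = 0" "u 1 = 0" by simp_all
  have "(u has_real_derivative deriv01 u x) (at x within {0..1})" if "x \<in> {0..1}" for x
    using uE(1) that unfolding differentiable_on_def deriv01_def has_real_derivative_iff_has_vector_derivative
    by (subst vector_derivative_works[symmetric]) blast
  then show "plane_sol p F u (\<lambda>x. phi p (deriv01 u x))"
    using u p unfolding plane_sol_def
    by (auto simp: phi_conj_phi dirichlet_solution_def intro!: continuous_intros uE)
qed

lemma plane_sol_minus:
  assumes "plane_sol p F u w"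
  shows "plane_sol p (\<lambda>x s. - F x (- s)) (\<lambda>x. - u x) (\<lambda>x. - w x)"
  using assms unfolding plane_sol_def
  by (auto intro!: continuous_intros DERIV_minus[THEN DERIV_cong])

lemma dirichlet_minus:
  assumes p: "1 < p" and u: "dirichlet_solution p F u"
  shows "dirichlet_solution p (\<lambda>x s. - F x (- s)) (\<lambda>x. - u x)"
  by (rule dirichlet_of_plane_sol[OF p plane_sol_minus[OF plane_sol_of_dirichlet(1)[OF p u]]])
    (simp_all add: plane_sol_of_dirichlet(2,3)[OF p u])

lemma S_plus_nodal:
  assumes p: "1 < p" and k: "1 \<le> k" and u: "u \<in> S_plus k" "dirichlet_solution p F u"
  shows "\<And>x. x \<in> {0..1} \<Longrightarrow> u x \<noteq> 0 \<or> phi p (deriv01 u x) \<noteq> 0"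
    and "\<forall>\<^sub>F x in at_right 0. 0 < u x" and "crosses u" and "zero_chain k 1 u" and "\<not> alternates k 1 u"
proof -
  note sol = plane_sol_of_dirichlet[OF p u(2)]
  have fin: "finite (interior_zeros u)" and card: "card (interior_zeros u) = k - 1"
    using u(1) by (simp_all add: S_plus_def)
  show simple: "u x \<noteq> 0 \<or> phi p (deriv01 u x) \<noteq> 0" if "x \<in> {0..1}" for x
    using u(1) that by (auto simp: S_plus_def)
  show "\<forall>\<^sub>F x in at_right 0. 0 < u x"
    using u(1) by (simp add: S_plus_def)
  show "crosses u"
    by (rule plane_sol_crosses[OF p sol(1)]) (use simple in auto)
  show "\<not> alternates k 1 u"
    using alternates_imp_many_zeros[OF plane_solD(4)[OF sol(1)] sol(2) k _ fin] card by blast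
  obtain z where z: "z 0 = (0::real)" "\<forall>i<k - 1. z i < z (Suc i)" "\<forall>i\<le>k - 1. u (z i) = 0" "z (k - 1) < 1"
    using enumerate_zeros[OF sol(2) fin card order_refl] by blast
  show "zero_chain k 1 u"
    unfolding zero_chain_def
  proof (rule exI[of _ "z(k := 1)"], intro conjI allI impI)
    fix i assume "i < k"
    then consider "i < k - 1" | "i = k - 1" by linarith
    then show "(z(k := 1)) i < (z(k := 1)) (Suc i)"
      using z k by cases auto
  qed (use z k sol in auto)
qed

lemma S_plus_of_plane_sol:
  assumes p: "1 < p" and k: "1 \<le> k" and sol: "plane_sol p F u w" and init: "u 0 = 0" "0 < w 0"
    and simple: "\<And>x. x \<in> {0..1} \<Longrightarrow> u x \<noteq> 0 \<or> w x \<noteq> 0"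
    and zc: "zero_chain k 1 u" and na: "\<not> alternates k 1 u"
  shows "u \<in> S_plus k" "dirichlet_solution p F u"
proof -
  note pos = plane_sol_pos_near_0[OF sol init]
  have cr: "crosses u"
    by (rule plane_sol_crosses[OF p sol]) (use simple in auto)
  note ex = exact_zeros[OF init(1) cr pos k zc na]
  show d: "dirichlet_solution p F u"
    by (rule dirichlet_of_plane_sol[OF p sol init(1) ex(1)])
  have "deriv01 u x \<noteq> 0" if "x \<in> {0..1}" "u x = 0" for x
    using simple[OF that(1)] that(2) by (simp add: plane_sol_deriv01[OF sol that(1)])
  then show "u \<in> S_plus k"
    using d ex pos by (auto simp: S_plus_def dirichlet_solution_def)
qed

locale half_linear_problem =
  fixes p :: real and a \<alpha> \<beta> :: "real \<Rightarrow> real"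
  assumes p: "1 < p"
    and a_cont: "continuous_on {0..1} a" and a_pos: "\<And>x. x \<in> {0..1} \<Longrightarrow> 0 < a x"
    and \<alpha>_cont: "continuous_on {0..1} \<alpha>" and \<beta>_cont: "continuous_on {0..1} \<beta>"
begin

abbreviation F :: "real \<Rightarrow> real \<Rightarrow> real \<Rightarrow> real" where
  "F \<equiv> half_linear p a \<alpha> \<beta>"

lemma weight_bound:
  assumes "continuous_on {0..1} (g :: real \<Rightarrow> real)"
  obtains B where "0 \<le> B" "\<And>x. x \<in> {0..1} \<Longrightarrow> \<bar>g x\<bar> \<le> B"
proof -
  have "bounded (g ` {0..1})"
    by (intro compact_imp_bounded compact_continuous_image assms compact_Icc)
  then obtain B where "0 < B" "\<And>x. x \<in> {0..1} \<Longrightarrow> \<bar>g x\<bar> \<le> B"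
    by (auto simp: bounded_pos)
  then show thesis by (intro that[of B]) auto
qed

lemma coefficient_bounds:
  obtains A B where "0 \<le> A" "0 \<le> B" "\<And>x. x \<in> {0..1} \<Longrightarrow> \<bar>a x\<bar> \<le> A"
    "\<And>x. x \<in> {0..1} \<Longrightarrow> \<bar>\<alpha> x\<bar> \<le> B" "\<And>x. x \<in> {0..1} \<Longrightarrow> \<bar>\<beta> x\<bar> \<le> B"
proof -
  obtain A B1 B2 where "0 \<le> A" "\<And>x. x \<in> {0..1} \<Longrightarrow> \<bar>a x\<bar> \<le> A"
    "0 \<le> B1" "\<And>x. x \<in> {0..1} \<Longrightarrow> \<bar>\<alpha> x\<bar> \<le> B1" "0 \<le> B2" "\<And>x. x \<in> {0..1} \<Longrightarrow> \<bar>\<beta> x\<bar> \<le> B2"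
    using weight_bound[OF a_cont] weight_bound[OF \<alpha>_cont] weight_bound[OF \<beta>_cont] by metis
  then show thesis
    by (intro that[of A "max B1 B2"]) (auto simp: le_max_iff_disj)
qed

lemma growth_bound:
  assumes "0 \<le> \<Lambda>"
  obtains C where "\<And>lam x s. \<bar>lam\<bar> \<le> \<Lambda> \<Longrightarrow> x \<in> {0..1} \<Longrightarrow> \<bar>F lam x s\<bar> \<le> C * \<bar>s\<bar> powr (p - 1)"
proof -
  obtain A B where AB: "0 \<le> A" "0 \<le> B" "\<And>x. x \<in> {0..1} \<Longrightarrow> \<bar>a x\<bar> \<le> A"
    "\<And>x. x \<in> {0..1} \<Longrightarrow> \<bar>\<alpha> x\<bar> \<le> B" "\<And>x. x \<in> {0..1} \<Longrightarrow> \<bar>\<beta> x\<bar> \<le> B"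
    using coefficient_bounds by blast
  have "\<bar>F lam x s\<bar> \<le> (\<Lambda> * A + B) * \<bar>s\<bar> powr (p - 1)" if "\<bar>lam\<bar> \<le> \<Lambda>" "x \<in> {0..1}" for lam x s
    using that AB assms by (intro half_linear_bound) (auto simp: abs_mult intro!: mult_mono)
  then show thesis by (rule that)
qed

lemma F_simple:
  assumes "plane_sol p (F lam) u w" "w 0 \<noteq> 0" "x \<in> {0..1}"
  shows "u x \<noteq> 0 \<or> w x \<noteq> 0"
proof -
  obtain C where "\<And>x s. x \<in> {0..1} \<Longrightarrow> \<bar>F lam x s\<bar> \<le> C * \<bar>s\<bar> powr (p - 1)"
    using growth_bound[of "\<bar>lam\<bar>"] by (metis abs_ge_zero order_refl)
  then show ?thesis
    by (rule plane_sol_simple[OF p assms(1) _ assms(2,3)])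
qed

text \<open>On a positive lobe $w$ would be increasing, so after the critical point that Rolle's theorem
  provides $u$ could not return to $0$.\<close>

lemma no_zero_chain_of_negative:
  assumes k: "1 \<le> k" and u: "plane_sol p (F lam) u w" and init: "u 0 = 0" "0 < w 0"
    and neg: "\<And>x. x \<in> {0..1} \<Longrightarrow> lam * a x + \<alpha> x < 0"
  shows "\<not> zero_chain k 1 u"
proof
  assume zc: "zero_chain k 1 u"
  note uc = plane_solD(4)[OF u]
  have simple: "u x \<noteq> 0 \<or> w x \<noteq> 0" if "x \<in> {0..1}" for x
    using F_simple[OF u _ that] init by simp
  have cr: "crosses u"
    by (rule plane_sol_crosses[OF p u]) (use simple in auto)
  obtain y s where y: "y 0 = 0" "\<forall>i\<le>k. u (y i) = 0"
    "\<forall>i<k. y i < s i \<and> s i < y (Suc i) \<and> 0 < (-1) ^ i * u (s i)" "y k \<le> 1"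
    using interlacing_signs[OF k uc init(1) cr plane_sol_pos_near_0[OF u init] zc] by blast
  have ym: "\<forall>i<k. y i < y (Suc i)"
    using y(3) less_trans by blast
  have y1: "y (Suc 0) \<le> 1"
    using step_mono(1)[OF ym, of "Suc 0" k] k y(4) by simp
  have s0: "0 < s 0" "s 0 < y (Suc 0)" "0 < u (s 0)"
    using y(1,3) k by auto
  then obtain c d where cd: "0 \<le> c" "c < s 0" "s 0 < d" "d \<le> y (Suc 0)" "u c = 0" "u d = 0"
    "\<forall>x\<in>{c<..<d}. 0 < u x * u (s 0)"
    using sign_lobe[of 0 "y (Suc 0)" u "s 0"] y1 y(2) k init(1) continuous_on_subset[OF uc, of "{0..y (Suc 0)}"]
    by force
  have pos: "0 < u x" if "c < x" "x < d" for x
    using cd(7) that s0(3) by (auto simp: zero_less_mult_iff)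
  have x01: "x \<in> {0<..<1}" if "c < x" "x < d" for x
    using that cd y1 by auto
  have cu: "continuous_on {c..d} u"
    using cd y1 by (intro continuous_on_subset[OF uc]) auto
  obtain \<xi> where \<xi>: "c < \<xi>" "\<xi> < d" "(u has_real_derivative 0) (at \<xi>)"
    using Rolle[of c d u] cd cu plane_solD(5)[OF u x01] by (metis less_trans real_differentiable_def)
  have "phi (p / (p - 1)) (w \<xi>) = 0"
    using DERIV_unique[OF plane_solD(5)[OF u x01[OF \<xi>(1,2)]] \<xi>(3)] .
  then have w\<xi>: "w \<xi> = 0" by simp
  have w_mono: "w \<xi> \<le> w x" if x: "\<xi> \<le> x" "x < d" for x
  proof (rule DERIV_nonneg_imp_nondecreasing[OF x(1)])
    fix t assume "\<xi> \<le> t" "t \<le> x"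
    then have t: "c < t" "t < d" using \<xi> x by auto
    have "- F lam t (u t) = - (lam * a t + \<alpha> t) * phi p (u t)"
      unfolding half_linear_pos[OF pos[OF t]] by (rule minus_mult_left)
    moreover have "0 \<le> - (lam * a t + \<alpha> t) * phi p (u t)"
      using neg[of t] x01[OF t] pos[OF t] by (intro mult_nonneg_nonneg) (auto intro: less_imp_le)
    ultimately show "\<exists>y. (w has_real_derivative y) (at t) \<and> 0 \<le> y"
      using plane_solD(3)[OF u x01[OF t]] by metis
  qed
  have "u \<xi> \<le> u d"
  proof (rule DERIV_nonneg_imp_increasing_open[of \<xi> d u])
    fix x assume x: "\<xi> < x" "x < d"
    have "\<not> w x < 0"
      using w_mono[of x] x w\<xi> by simp
    then have "\<not> phi (p / (p - 1)) (w x) < 0"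
      by (simp only: phi_neg_iff not_False_eq_True)
    then have "0 \<le> phi (p / (p - 1)) (w x)"
      by (simp only: not_less)
    moreover have "(u has_real_derivative phi (p / (p - 1)) (w x)) (at x)"
      using x \<xi> by (intro plane_solD(5)[OF u] x01) auto
    ultimately show "\<exists>y. (u has_real_derivative y) (at x) \<and> 0 \<le> y"
      by blast
  qed (use \<xi> in \<open>auto intro: continuous_on_subset[OF cu]\<close>)
  then show False
    using pos[OF \<xi>(1,2)] cd(6) by simp
qed

text \<open>By \<open>no_long_lobe\<close> the solution cannot keep one sign on any of the intervals $(i/k, (i+1)/k)$.\<close>

lemma alternates_of_large:
  assumes k: "1 \<le> k" and v: "plane_sol p (F lam) v z" and init: "v 0 = 0" "0 < z 0"
    and large: "\<And>x. x \<in> {0..1} \<Longrightarrow> K \<le> lam * a x + \<alpha> x" "\<And>x. x \<in> {0..1} \<Longrightarrow> K \<le> lam * a x - \<beta> x"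
    and K: "phi p (4 * real k) \<le> K / (6 * real k)"
  shows "alternates k 1 v"
proof -
  define y where "y i = real i / real k" for i
  have k0: "0 < real k"
    using k by simp
  have y_step: "y (Suc i) = y i + 1 / real k" for i
    by (simp add: y_def add_divide_distrib)
  have ym: "\<forall>i<k. y i < y (Suc i)"
    using k0 by (simp add: y_step)
  have y1: "y k = 1"
    using k0 by (simp add: y_def)
  have simple: "v x \<noteq> 0 \<or> z x \<noteq> 0" if "x \<in> {0..1}" for x
    using F_simple[OF v _ that] init by simp
  show ?thesis
  proof (rule alternates_of_sign_breaks[OF plane_sol_pos_near_0[OF v init] k _ ym])
    show "0 \<le> y 0" "y k \<le> 1"
      by (simp_all add: y1) (simp add: y_def)
    fix i assume i: "i < k"
    have y01: "0 \<le> y i" "y (Suc i) \<le> 1"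
      using k0 step_mono(1)[OF ym, of "Suc i" k] i y1 by (simp_all add: y_def)
    show "\<exists>t. y i < t \<and> t < y (Suc i) \<and> (-1) ^ i * v t < 0"
    proof (rule ccontr)
      assume "\<not> ?thesis"
      then have sgn: "0 \<le> (-1) ^ i * v t" if "y i < t" "t < y (Suc i)" for t
        using that by force
      have vs: "0 < (-1) ^ i * v x" if x: "y i < x" "x < y i + 1 / real k" for x
      proof -
        have "v x \<noteq> 0"
          by (rule one_signed_nonzero[OF v y01 simple sgn]) (use x y_step in auto)
        then have "(-1) ^ i * v x \<noteq> 0" by simp
        moreover have "0 \<le> (-1) ^ i * v x"
          using x y_step by (intro sgn) auto
        ultimately show ?thesis by linarith
      qed
      show False
      proof (rule no_long_lobe[OF p v y01(1), of "1 / real k" "(-1) ^ i"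
            "\<lambda>x. lam * a x + (if even i then \<alpha> x else - \<beta> x)" K])
        show "0 < 1 / real k" "y i + 1 / real k \<le> 1"
          using k0 y01 y_step by auto
        show "(-1) ^ i = (1::real) \<or> (-1) ^ i = (- 1 :: real)"
          by (cases "even i") auto
        show "phi p (4 / (1 / real k)) \<le> K * (1 / real k) / 6"
          using K by (simp add: mult.commute)
        fix x assume x: "y i < x" "x < y i + 1 / real k"
        show "0 < (-1) ^ i * v x"
          by (rule vs[OF x])
        show "F lam x (v x) = (lam * a x + (if even i then \<alpha> x else - \<beta> x)) * phi p (v x)"
          by (rule half_linear_signed[OF vs[OF x]])
        have "x \<in> {0..1}"
          using x y01 y_step[of i] by auto
        then show "K \<le> lam * a x + (if even i then \<alpha> x else - \<beta> x)"
          using large by simp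
      qed
    qed
  qed
qed

lemma F_continuous:
  assumes l: "continuous_on T l" and T: "\<And>z. z \<in> T \<Longrightarrow> x z \<in> {0..1}" and x: "continuous_on T x" and s: "continuous_on T s"
  shows "continuous_on T (\<lambda>z. F (l z) (x z) (s z))"
proof -
  have c: "continuous_on T (\<lambda>z. g (x z))" if "continuous_on {0..1} g" for g :: "real \<Rightarrow> real"
    by (rule continuous_on_compose2[OF that x]) (use T in auto)
  show ?thesis
    unfolding half_linear_def pos_part_def neg_part_def
    by (intro continuous_intros l s c a_cont \<alpha>_cont \<beta>_cont p)
qed

text \<open>Shooting with the spectral parameter running from $-\Lambda$ to $\Lambda$, where $\Lambda a$
  dominates $\alpha$ and $\beta$ so much that there are no zeros at the lower end and $k$ sign changes at the upper
  end.\<close>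

lemma half_eigenvalue_exists:
  assumes k: "1 \<le> k"
  shows "\<exists>lam. \<exists>u\<in>S_plus k. dirichlet_solution p (F lam) u"
proof -
  obtain A B where AB: "0 \<le> A" "0 \<le> B" "\<And>x. x \<in> {0..1} \<Longrightarrow> \<bar>a x\<bar> \<le> A"
    "\<And>x. x \<in> {0..1} \<Longrightarrow> \<bar>\<alpha> x\<bar> \<le> B" "\<And>x. x \<in> {0..1} \<Longrightarrow> \<bar>\<beta> x\<bar> \<le> B"
    using coefficient_bounds by blast
  obtain x0 where x0: "x0 \<in> {0..1}" "\<And>x. x \<in> {0..1} \<Longrightarrow> a x0 \<le> a x"
    using continuous_attains_inf[OF compact_Icc _ a_cont] by auto
  have a0: "0 < a x0"
    using a_pos x0(1) .
  \<comment> \<open>the bound that \<open>alternates_of_large\<close> asks for\<close>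
  define K where "K = 6 * real k * phi p (4 * real k)"
  have K: "0 \<le> K"
    using k by (auto simp: K_def intro!: mult_nonneg_nonneg less_imp_le)
  define \<Lambda> where "\<Lambda> = (K + B + 1) / a x0"
  have \<Lambda>: "0 \<le> \<Lambda>" "\<Lambda> * a x0 = K + B + 1"
    using a0 K AB by (simp_all add: \<Lambda>_def)
  have \<Lambda>a: "K + B + 1 \<le> \<Lambda> * a x" if "x \<in> {0..1}" for x
    using mult_left_mono[OF x0(2)[OF that] \<Lambda>(1)] \<Lambda>(2) by simp
  obtain C where C: "\<And>lam x s. \<bar>lam\<bar> \<le> \<Lambda> \<Longrightarrow> x \<in> {0..1} \<Longrightarrow> \<bar>F lam x s\<bar> \<le> C * \<bar>s\<bar> powr (p - 1)"
    using growth_bound[OF \<Lambda>(1)] by blast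
  have "\<exists>\<tau>\<in>{0..1}. \<exists>u w. plane_sol p (F ((2 * \<tau> - 1) * \<Lambda>)) u w \<and> u 0 = 0 \<and> w 0 = 1 \<and>
    zero_chain k 1 u \<and> \<not> alternates k 1 u"
  proof (rule shooting[OF p])
    show "continuous_on ({0..1} \<times> {0..1} \<times> UNIV) (\<lambda>(\<tau>, x, s). F ((2 * \<tau> - 1) * \<Lambda>) x s)"
      unfolding case_prod_beta by (intro F_continuous continuous_intros) auto
    show "\<bar>F ((2 * \<tau> - 1) * \<Lambda>) x s\<bar> \<le> C * \<bar>s\<bar> powr (p - 1)" if "\<tau> \<in> {0..1}" "x \<in> {0..1}" for \<tau> x s
    proof (rule C[OF _ that(2)])
      have "\<bar>2 * \<tau> - 1\<bar> * \<Lambda> \<le> 1 * \<Lambda>"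
        using that \<Lambda>(1) by (intro mult_right_mono) auto
      then show "\<bar>(2 * \<tau> - 1) * \<Lambda>\<bar> \<le> \<Lambda>"
        using \<Lambda>(1) by (simp add: abs_mult)
    qed
    fix u w :: "real \<Rightarrow> real" assume init: "u 0 = 0" "w 0 = 1"
    show "\<not> zero_chain k 1 u" if "plane_sol p (F ((2 * 0 - 1) * \<Lambda>)) u w"
    proof (rule no_zero_chain_of_negative[OF k that init(1)])
      fix x :: real assume x: "x \<in> {0..1}"
      have "\<alpha> x \<le> B"
        using AB(4)[OF x] by simp
      then show "(2 * 0 - 1) * \<Lambda> * a x + \<alpha> x < 0"
        using \<Lambda>a[OF x] K by simp
    qed (simp add: init)
    show "alternates k 1 u" if "plane_sol p (F ((2 * 1 - 1) * \<Lambda>)) u w"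
    proof (rule alternates_of_large[OF k that init(1)])
      fix x :: real assume x: "x \<in> {0..1}"
      show "K \<le> (2 * 1 - 1) * \<Lambda> * a x + \<alpha> x" "K \<le> (2 * 1 - 1) * \<Lambda> * a x - \<beta> x"
        using \<Lambda>a[OF x] AB(4,5)[OF x] by auto
    qed (use k init in \<open>simp_all add: K_def\<close>)
  qed
  then obtain lam u w where u: "plane_sol p (F lam) u w" "u 0 = 0" "w 0 = 1" "zero_chain k 1 u" "\<not> alternates k 1 u"
    by blast
  have "u \<in> S_plus k" "dirichlet_solution p (F lam) u"
    by (rule S_plus_of_plane_sol[OF p k u(1,2) _ _ u(4,5)]; use F_simple[OF u(1)] u(3) in simp)+
  then show ?thesis by blast
qed

lemma eigenfunction_alternates:
  assumes k: "1 \<le> k" and u: "u \<in> S_plus k" "dirichlet_solution p (F lam) u" and mu: "lam < mu"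
    and v: "plane_sol p (F mu) v z" and init: "v 0 = 0" "0 < z 0"
  shows "alternates k 1 v"
proof -
  note U = S_plus_nodal[OF p k u] and sol = plane_sol_of_dirichlet[OF p u(2)]
  show ?thesis
    by (rule sturm_comparison[OF p a_pos mu sol(1) v sol(2) U(3,2) plane_sol_pos_near_0[OF v init] _ k U(4)])
      (use F_simple[OF v] init in auto)
qed

lemma eigenfunction_no_zero_chain:
  assumes k: "1 \<le> k" and u: "u \<in> S_plus k" "dirichlet_solution p (F lam) u" and mu: "mu < lam"
    and v: "plane_sol p (F mu) v z" and init: "v 0 = 0" "0 < z 0"
  shows "\<not> zero_chain k 1 v"
proof
  assume zc: "zero_chain k 1 v"
  note U = S_plus_nodal[OF p k u] and sol = plane_sol_of_dirichlet[OF p u(2)]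
  have "crosses v"
    by (rule plane_sol_crosses[OF p v]) (use F_simple[OF v] init in auto)
  from sturm_comparison[OF p a_pos mu v sol(1) init(1) this plane_sol_pos_near_0[OF v init] U(2,1) k zc]
  show False using U(5) by blast
qed

text \<open>By comparison the eigenfunction for the larger of two eigenvalues would change sign $k$ times, but
  it has only $k - 1$ interior zeros.\<close>

lemma half_eigenvalue_unique:
  assumes k: "1 \<le> k" and u: "u \<in> S_plus k" "dirichlet_solution p (F lam) u"
    and v: "v \<in> S_plus k" "dirichlet_solution p (F mu) v"
  shows "lam = mu"
proof -
  have *: "\<not> lam < mu" if u: "u \<in> S_plus k" "dirichlet_solution p (F lam) u"
    and v: "v \<in> S_plus k" "dirichlet_solution p (F mu) v" for lam mu u v
  proof
    assume lt: "lam < mu"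
    note U = S_plus_nodal[OF p k u] and solu = plane_sol_of_dirichlet[OF p u(2)]
    note V = S_plus_nodal[OF p k v] and solv = plane_sol_of_dirichlet[OF p v(2)]
    from sturm_comparison[OF p a_pos lt solu(1) solv(1) solu(2) U(3,2) V(2,1) k U(4)] V(5)
    show False by blast
  qed
  show ?thesis
    using *[OF u v] *[OF v u] by linarith
qed

lemma half_eigenvalue_plus:
  assumes k: "1 \<le> k"
  shows "\<exists>u\<in>S_plus k. dirichlet_solution p (F (half_eigenvalue p a \<alpha> \<beta> 1 k)) u"
proof -
  have S1: "S 1 k = S_plus k"
    by (simp add: S_def)
  have "\<exists>!lam. \<exists>u\<in>S_plus k. dirichlet_solution p (F lam) u"
    using half_eigenvalue_exists[OF k] half_eigenvalue_unique[OF k] by blast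
  from theI'[OF this] show ?thesis
    by (simp add: half_eigenvalue_def S1 half_linear_def[abs_def])
qed

end

section \<open>The nonlinear problem\<close>

lemma bounded_of_limit_at_infinity:
  fixes h :: "real \<Rightarrow> real"
  assumes h: "continuous_on UNIV h" and lim: "(h \<longlongrightarrow> l) at_infinity"
  obtains B where "\<And>s. \<bar>h s\<bar> \<le> B"
proof -
  obtain b where b: "\<And>s. b \<le> norm s \<Longrightarrow> dist (h s) l < 1"
    using lim unfolding Lim_at_infinity by (meson zero_less_one)
  have "bounded (h ` cball 0 b)"
    by (intro compact_imp_bounded compact_continuous_image continuous_on_subset[OF h]) auto
  then obtain c where "\<forall>x\<in>cball 0 b. \<bar>h x\<bar> \<le> c"
    by (auto simp: bounded_iff)
  then have c: "\<And>s. \<bar>s\<bar> \<le> b \<Longrightarrow> \<bar>h s\<bar> \<le> c"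
    by simp
  have "\<bar>h s\<bar> \<le> max c (\<bar>l\<bar> + 1)" for s
    using b[of s] c[of s] by (cases "\<bar>s\<bar> \<le> b") (auto simp: dist_real_def)
  then show thesis by (rule that)
qed

text \<open>For $h = f/\varphi_p$ and $\tau = \delta/(1 + \delta)$ this is $f(\delta s)/\varphi_p(\delta)$, the
  nonlinearity seen by $v$ when $u = \delta v$. The value at $\tau = 1$, that is $\delta = \infty$, uses the limit $l$
  of $h$ at infinity.\<close>

definition rescaled :: "real \<Rightarrow> (real \<Rightarrow> real) \<Rightarrow> real \<Rightarrow> real \<Rightarrow> real \<Rightarrow> real" where
  "rescaled p h l \<tau> s = (if \<tau> = 1 then l else h (\<tau> * s / (1 - \<tau>))) * phi p s"

text \<open>The first factor has no limit at $(\tau,s) = (1,0)$, but it is bounded and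
  $\varphi_p(s) \to 0$ there. At the other points with $\tau = 1$ the argument of $h$ tends to infinity.\<close>

lemma rescaled_continuous:
  assumes p: "1 < p" and h: "continuous_on UNIV h" and lim: "(h \<longlongrightarrow> l) at_infinity"
  shows "continuous_on ({0..1} \<times> UNIV) (\<lambda>(\<tau>, s). rescaled p h l \<tau> s)"
proof -
  obtain B where "\<And>s. \<bar>h s\<bar> \<le> B"
    using bounded_of_limit_at_infinity[OF h lim] by blast
  define c where "c z = (if fst z = 1 then l else h (fst z * snd z / (1 - fst z)))" for z :: "real \<times> real"
  have c_bound: "\<bar>c z\<bar> \<le> max \<bar>l\<bar> B" for z
    using \<open>\<And>s. \<bar>h s\<bar> \<le> B\<close> by (auto simp: c_def le_max_iff_disj)
  have hc: "isCont h x" for x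
    using h by (simp add: continuous_on_eq_continuous_at)
  have "((\<lambda>z. c z * phi p (snd z)) \<longlongrightarrow> c z0 * phi p (snd z0)) (at z0 within {0..1} \<times> UNIV)"
    if z0: "z0 \<in> {0..1} \<times> UNIV" for z0
  proof -
    obtain t s where z0_eq: "z0 = (t, s)" by (cases z0)
    have t01: "0 \<le> t" "t \<le> 1" using z0 z0_eq by auto
    let ?F = "at (t, s) within {0..1} \<times> UNIV"
    have fst: "(fst \<longlongrightarrow> t) ?F" and snd: "(snd \<longlongrightarrow> s) ?F"
      using tendsto_fst[OF tendsto_ident_at, of "(t, s)" "{0..1} \<times> UNIV"]
        tendsto_snd[OF tendsto_ident_at, of "(t, s)" "{0..1} \<times> UNIV"] by (simp_all add: id_def)
    consider "t < 1" | "t = 1" "s = 0" | "t = 1" "s \<noteq> 0"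
      using t01 by linarith
    then have "((\<lambda>z. c z * phi p (snd z)) \<longlongrightarrow> c (t, s) * phi p s) ?F"
    proof cases
      case 1
      have "((\<lambda>z. fst z * snd z / (1 - fst z)) \<longlongrightarrow> t * s / (1 - t)) ?F"
        using 1 by (intro tendsto_intros fst snd) simp
      then have "((\<lambda>z. h (fst z * snd z / (1 - fst z))) \<longlongrightarrow> h (t * s / (1 - t))) ?F"
        by (rule isCont_tendsto_compose[OF hc])
      moreover have "\<forall>\<^sub>F z in ?F. h (fst z * snd z / (1 - fst z)) = c z"
        using order_tendstoD(2)[OF fst 1] by eventually_elim (simp add: c_def)
      ultimately have "(c \<longlongrightarrow> c (t, s)) ?F"
        using 1 by (simp add: c_def[of "(t, s)"] Lim_transform_eventually)
      then show ?thesis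
        by (intro tendsto_intros snd p)
    next
      case 2
      have "((\<lambda>z. max \<bar>l\<bar> B * \<bar>phi p (snd z)\<bar>) \<longlongrightarrow> max \<bar>l\<bar> B * \<bar>phi p s\<bar>) ?F"
        by (intro tendsto_intros snd p)
      then have "((\<lambda>z. max \<bar>l\<bar> B * \<bar>phi p (snd z)\<bar>) \<longlongrightarrow> 0) ?F"
        using 2 by simp
      moreover have "\<forall>\<^sub>F z in ?F. norm (c z * phi p (snd z)) \<le> max \<bar>l\<bar> B * \<bar>phi p (snd z)\<bar>"
        using c_bound by (intro always_eventually) (auto simp: abs_mult intro!: mult_right_mono)
      ultimately have "((\<lambda>z. c z * phi p (snd z)) \<longlongrightarrow> 0) ?F"
        by (rule Lim_null_comparison[rotated])
      then show ?thesis using 2 by simp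
    next
      case 3
      have "(c \<longlongrightarrow> l) ?F"
      proof (rule tendstoI)
        fix e :: real assume "0 < e"
        then obtain b where b: "\<And>x. b \<le> norm x \<Longrightarrow> dist (h x) l < e"
          using lim unfolding Lim_at_infinity by blast
        have "((\<lambda>z. fst z * \<bar>snd z\<bar> - (1 - fst z) * b) \<longlongrightarrow> t * \<bar>s\<bar> - (1 - t) * b) ?F"
          by (intro tendsto_intros fst snd)
        moreover have "0 < t * \<bar>s\<bar> - (1 - t) * b"
          using 3 by simp
        ultimately have "\<forall>\<^sub>F z in ?F. 0 < fst z * \<bar>snd z\<bar> - (1 - fst z) * b"
          by (rule order_tendstoD(1))
        moreover have "\<forall>\<^sub>F z in ?F. z \<in> {0..1} \<times> UNIV"
          by (simp add: eventually_at_filter)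
        ultimately show "\<forall>\<^sub>F z in ?F. dist (c z) l < e"
        proof eventually_elim
          case (elim z)
          show ?case
          proof (cases "fst z = 1")
            case False
            then have lt: "0 \<le> fst z" "0 < 1 - fst z"
              using elim by auto
            have "b \<le> fst z * \<bar>snd z\<bar> / (1 - fst z)"
              using elim lt by (simp add: pos_le_divide_eq mult.commute)
            also have "\<dots> = norm (fst z * snd z / (1 - fst z))"
              using lt by (simp add: abs_mult)
            finally have "dist (h (fst z * snd z / (1 - fst z))) l < e"
              by (rule b)
            then show ?thesis using False by (simp add: c_def)
          qed (use \<open>0 < e\<close> in \<open>simp add: c_def\<close>)
        qed
      qed
      then have "((\<lambda>z. c z * phi p (snd z)) \<longlongrightarrow> l * phi p s) ?F"
        by (intro tendsto_intros snd p)
      then show ?thesis using 3 by (simp add: c_def)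
    qed
    then show ?thesis by (simp add: z0_eq)
  qed
  then have "continuous_on ({0..1} \<times> UNIV) (\<lambda>z. c z * phi p (snd z))"
    by (simp add: continuous_on_def)
  then show ?thesis
    by (simp add: rescaled_def[abs_def] c_def[abs_def] case_prod_beta)
qed

context half_linear_problem
begin

definition nonlin :: "real \<Rightarrow> (real \<Rightarrow> real) \<Rightarrow> real \<Rightarrow> real \<Rightarrow> real" where
  "nonlin r g x s = r * a x * g s + \<alpha> x * phi p (pos_part s) + \<beta> x * phi p (neg_part s)"

lemma nonlin_phi: "nonlin r (\<lambda>s. c * phi p s) = F (r * c)"
  by (intro ext) (simp add: nonlin_def half_linear_def)

lemma signed_part_scale: "0 < \<delta> \<Longrightarrow> pos_part (\<delta> * s) = \<delta> * pos_part s"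
  "0 < \<delta> \<Longrightarrow> neg_part (\<delta> * s) = \<delta> * neg_part s"
  by (auto simp: pos_part_def neg_part_def max_def min_def zero_le_mult_iff mult_le_0_iff)

text \<open>The terms with $\alpha$ and $\beta$ are positively homogeneous of degree $p - 1$, so scaling only
  affects the nonlinearity.\<close>

lemma plane_sol_scale:
  assumes \<delta>: "0 < \<delta>" and v: "plane_sol p (nonlin r g) v z" and g: "\<And>s. phi p \<delta> * g s = f (\<delta> * s)"
  shows "plane_sol p (nonlin r f) (\<lambda>x. \<delta> * v x) (\<lambda>x. phi p \<delta> * z x)"
proof -
  have "phi (p / (p - 1)) (phi p \<delta> * z x) = \<delta> * phi (p / (p - 1)) (z x)" for x
    by (simp add: phi_mult phi_conj_phi p)
  then have "((\<lambda>x. \<delta> * v x) has_real_derivative phi (p / (p - 1)) (phi p \<delta> * z x)) (at x within {0..1})"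
    if "x \<in> {0..1}" for x
    using DERIV_cmult[OF plane_solD(1)[OF v that], of \<delta>] by simp
  moreover have "- nonlin r f x (\<delta> * s) = phi p \<delta> * - nonlin r g x s" for x s
    unfolding nonlin_def signed_part_scale[OF \<delta>] phi_mult g[symmetric] by (simp add: algebra_simps)
  then have "((\<lambda>x. phi p \<delta> * z x) has_real_derivative - nonlin r f x (\<delta> * v x)) (at x)" if "x \<in> {0<..<1}" for x
    using DERIV_cmult[OF plane_solD(3)[OF v that], of "phi p \<delta>"] by metis
  ultimately show ?thesis
    using plane_solD(2)[OF v] unfolding plane_sol_def by (auto intro!: continuous_intros)
qed

text \<open>Shooting along the rescaled family. At its ends the equation is half-linear with the
  parameters \<open>r * f0\<close> and \<open>r * finf\<close>, and comparison with the eigenfunction \<open>e\<close> shows that the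
  solutions there have too few zeros or too many. So the parameter $\tau$ that is found lies strictly between 0 and 1 and
  belongs to an amplitude $\delta = \tau/(1-\tau)$ in $(0,\infty)$.\<close>

lemma nodal_solution_plus:
  assumes f: "continuous_on UNIV f"
    and f0: "((\<lambda>s. f s / phi p s) \<longlongrightarrow> f0) (at 0)"
    and finf: "((\<lambda>s. f s / phi p s) \<longlongrightarrow> finf) at_infinity"
    and k: "1 \<le> k" and e: "e \<in> S_plus k" "dirichlet_solution p (F lam) e"
    and r: "r * f0 < lam \<and> lam < r * finf \<or> r * finf < lam \<and> lam < r * f0"
  shows "\<exists>u\<in>S_plus k. dirichlet_solution p (nonlin r f) u"
proof -
  define h where "h s = (if s = 0 then f0 else f s / phi p s)" for s
  have fc: "isCont f x" for x
    using f by (simp add: continuous_on_eq_continuous_at)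
  have h_cont: "continuous_on UNIV h"
  proof (rule continuous_at_imp_continuous_on, rule ballI)
    fix x :: real
    show "isCont h x"
    proof (cases "x = 0")
      case True
      have "(h \<longlongrightarrow> f0) (at 0)"
        by (rule Lim_transform_eventually[OF f0]) (auto simp: eventually_at_filter h_def)
      then show ?thesis by (simp add: True isCont_def h_def)
    next
      case False
      have "((\<lambda>s. f s / phi p s) \<longlongrightarrow> f x / phi p x) (at x)"
        using False p by (intro tendsto_intros isContD[OF fc]) simp_all
      moreover have "\<forall>\<^sub>F s in at x. f s / phi p s = h s"
        using eventually_neq_at_within[of 0 x UNIV] by eventually_elim (simp add: h_def)
      ultimately show ?thesis
        using False by (simp add: isCont_def h_def[of x] Lim_transform_eventually)
    qed
  qed
  have h_lim: "(h \<longlongrightarrow> finf) at_infinity"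
  proof (rule Lim_transform_eventually[OF finf])
    show "\<forall>\<^sub>F s in at_infinity. f s / phi p s = h s"
      unfolding eventually_at_infinity by (rule exI[of _ 1]) (auto simp: h_def)
  qed
  \<comment> \<open>\<open>f = h * phi p\<close> holds at 0 as well because \<open>f\<close> is continuous\<close>
  have "f 0 = 0"
  proof -
    have "((\<lambda>s. f s / phi p s * phi p s) \<longlongrightarrow> f0 * phi p 0) (at 0)"
      using p by (intro tendsto_intros f0)
    moreover have "\<forall>\<^sub>F s in at 0. f s / phi p s * phi p s = f s"
      by (simp add: eventually_at_filter)
    ultimately have "(f \<longlongrightarrow> 0) (at 0)"
      by (simp add: Lim_transform_eventually)
    then show ?thesis
      using LIM_unique isContD[OF fc[of 0]] by blast
  qed
  then have f_eq: "f s = h s * phi p s" for s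
    by (simp add: h_def)
  define g where "g = rescaled p h finf"
  have ends: "nonlin r (g 0) = F (r * f0)" "nonlin r (g 1) = F (r * finf)"
    by (simp_all add: g_def rescaled_def[abs_def] h_def nonlin_phi)
  obtain B where B: "\<And>s. \<bar>h s\<bar> \<le> B"
    using bounded_of_limit_at_infinity[OF h_cont h_lim] by blast
  obtain A D where AD: "0 \<le> A" "0 \<le> D" "\<And>x. x \<in> {0..1} \<Longrightarrow> \<bar>a x\<bar> \<le> A"
    "\<And>x. x \<in> {0..1} \<Longrightarrow> \<bar>\<alpha> x\<bar> \<le> D" "\<And>x. x \<in> {0..1} \<Longrightarrow> \<bar>\<beta> x\<bar> \<le> D"
    using coefficient_bounds by blast
  \<comment> \<open>\<open>H\<close> bounds the factor of \<open>phi p s\<close> in \<open>g \<tau> s\<close> for all \<open>\<tau>\<close>\<close>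
  define H where "H = max \<bar>finf\<bar> B"
  define C where "C = \<bar>r\<bar> * H * A + D"
  have nonlin_bound: "\<bar>nonlin r (g \<tau>) x s\<bar> \<le> C * \<bar>s\<bar> powr (p - 1)" if x: "x \<in> {0..1}" for \<tau> x s
  proof -
    define c where "c = (if \<tau> = 1 then finf else h (\<tau> * s / (1 - \<tau>)))"
    have c: "\<bar>c\<bar> \<le> H"
      using B by (auto simp: c_def H_def le_max_iff_disj)
    have "nonlin r (g \<tau>) x s = F (r * c) x s"
      by (simp add: nonlin_def g_def rescaled_def c_def half_linear_def)
    also have "\<bar>\<dots>\<bar> \<le> C * \<bar>s\<bar> powr (p - 1)"
      unfolding C_def
    proof (rule half_linear_bound)
      show "\<bar>r * c * a x\<bar> \<le> \<bar>r\<bar> * H * A"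
        unfolding abs_mult using c AD(3)[OF x] by (intro mult_mono mult_nonneg_nonneg) auto
    qed (use AD x in auto)
    finally show ?thesis .
  qed
  have nonlin_cont: "continuous_on ({0..1} \<times> {0..1} \<times> UNIV) (\<lambda>z. nonlin r (g (D' (fst z))) (fst (snd z)) (snd (snd z)))"
    if D': "continuous_on {0..1} D'" "\<And>\<tau>. \<tau> \<in> {0..1} \<Longrightarrow> D' \<tau> \<in> {0..1}" for D' :: "real \<Rightarrow> real"
  proof -
    have w: "continuous_on ({0..1} \<times> {0..1} \<times> UNIV) (\<lambda>z :: real \<times> real \<times> real. b (fst (snd z)))"
      if "continuous_on {0..1} b" for b :: "real \<Rightarrow> real"
      by (rule continuous_on_compose2[OF that]) (auto intro!: continuous_intros)
    have "continuous_on ({0..1} \<times> {0..1} \<times> UNIV)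
        (\<lambda>z :: real \<times> real \<times> real. (\<lambda>(\<tau>, s). rescaled p h finf \<tau> s) (D' (fst z), snd (snd z)))"
      by (rule continuous_on_compose2[OF rescaled_continuous[OF p h_cont h_lim]])
        (use D' in \<open>auto intro!: continuous_intros continuous_on_compose2[OF D'(1)]\<close>)
    then have "continuous_on ({0..1} \<times> {0..1} \<times> UNIV) (\<lambda>z :: real \<times> real \<times> real. g (D' (fst z)) (snd (snd z)))"
      by (simp add: g_def)
    then show ?thesis
      unfolding nonlin_def pos_part_def neg_part_def
      by (intro continuous_intros w a_cont \<alpha>_cont \<beta>_cont p)
  qed
  have "\<exists>\<tau>\<in>{0..1}. \<exists>v z. plane_sol p (nonlin r (g \<tau>)) v z \<and> v 0 = 0 \<and> z 0 = 1 \<and>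
      zero_chain k 1 v \<and> \<not> alternates k 1 v"
    using r
  proof
    assume r: "r * f0 < lam \<and> lam < r * finf"
    show ?thesis
    proof (rule shooting[OF p])
      show "continuous_on ({0..1} \<times> {0..1} \<times> UNIV) (\<lambda>(\<tau>, x, s). nonlin r (g \<tau>) x s)"
        using nonlin_cont[of "\<lambda>\<tau>. \<tau>"] by (simp add: case_prod_beta)
      show "\<And>\<tau> x s. \<tau> \<in> {0..1} \<Longrightarrow> x \<in> {0..1} \<Longrightarrow> \<bar>nonlin r (g \<tau>) x s\<bar> \<le> C * \<bar>s\<bar> powr (p - 1)"
        by (rule nonlin_bound)
      fix v z :: "real \<Rightarrow> real" assume init: "v 0 = 0" "z 0 = 1"
      show "\<not> zero_chain k 1 v" if "plane_sol p (nonlin r (g 0)) v z"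
        using eigenfunction_no_zero_chain[OF k e _ that[unfolded ends]] init r by simp
      show "alternates k 1 v" if "plane_sol p (nonlin r (g 1)) v z"
        using eigenfunction_alternates[OF k e _ that[unfolded ends]] init r by simp
    qed
  next
    assume r: "r * finf < lam \<and> lam < r * f0"
    \<comment> \<open>here the solutions for \<open>\<tau> = 1\<close> have too few zeros, so the family is run backwards\<close>
    have "\<exists>\<tau>\<in>{0..1}. \<exists>v z. plane_sol p (nonlin r (g (1 - \<tau>))) v z \<and> v 0 = 0 \<and> z 0 = 1 \<and>
        zero_chain k 1 v \<and> \<not> alternates k 1 v"
    proof (rule shooting[OF p])
      show "continuous_on ({0..1} \<times> {0..1} \<times> UNIV) (\<lambda>(\<tau>, x, s). nonlin r (g (1 - \<tau>)) x s)"
        using nonlin_cont[of "\<lambda>\<tau>. 1 - \<tau>"] by (simp add: case_prod_beta continuous_intros)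
      show "\<And>\<tau> x s. \<tau> \<in> {0..1} \<Longrightarrow> x \<in> {0..1} \<Longrightarrow> \<bar>nonlin r (g (1 - \<tau>)) x s\<bar> \<le> C * \<bar>s\<bar> powr (p - 1)"
        by (rule nonlin_bound)
      fix v z :: "real \<Rightarrow> real" assume init: "v 0 = 0" "z 0 = 1"
      show "\<not> zero_chain k 1 v" if "plane_sol p (nonlin r (g (1 - 0))) v z"
        using eigenfunction_no_zero_chain[OF k e _ that[unfolded diff_zero ends]] init r by simp
      show "alternates k 1 v" if "plane_sol p (nonlin r (g (1 - 1))) v z"
        using eigenfunction_alternates[OF k e _ that[unfolded diff_self ends]] init r by simp
    qed
    then obtain \<tau> where "\<tau> \<in> {0..1}" "\<exists>v z. plane_sol p (nonlin r (g (1 - \<tau>))) v z \<and> v 0 = 0 \<and> z 0 = 1 \<and>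
        zero_chain k 1 v \<and> \<not> alternates k 1 v"
      by blast
    then show ?thesis
      by (intro bexI[of _ "1 - \<tau>"]) auto
  qed
  then obtain \<tau> v z where \<tau>: "\<tau> \<in> {0..1}" and v: "plane_sol p (nonlin r (g \<tau>)) v z" "v 0 = 0" "z 0 = 1"
    and zc: "zero_chain k 1 v" and na: "\<not> alternates k 1 v"
    by blast
  have not_end: "nonlin r (g \<tau>) \<noteq> F (r * c)" if "r * c \<noteq> lam" for c
  proof
    assume eq: "nonlin r (g \<tau>) = F (r * c)"
    note v' = v(1)[unfolded eq]
    show False
    proof (cases "r * c < lam")
      case True
      with eigenfunction_no_zero_chain[OF k e _ v'] v(2,3) zc show False by simp
    next
      case False
      with eigenfunction_alternates[OF k e _ v'] v(2,3) na that show False by simp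
    qed
  qed
  have "\<tau> \<noteq> 0" "\<tau> \<noteq> 1"
    using not_end[of f0] not_end[of finf] ends r by auto
  then have \<tau>: "0 < \<tau>" "\<tau> < 1"
    using \<tau> by auto
  define \<delta> where "\<delta> = \<tau> / (1 - \<tau>)"
  have \<delta>: "0 < \<delta>"
    using \<tau> by (simp add: \<delta>_def)
  have sol: "plane_sol p (nonlin r f) (\<lambda>x. \<delta> * v x) (\<lambda>x. phi p \<delta> * z x)"
  proof (rule plane_sol_scale[OF \<delta> v(1)])
    fix s
    have "g \<tau> s = h (\<delta> * s) * phi p s"
      using \<tau> by (simp add: g_def rescaled_def \<delta>_def)
    then show "phi p \<delta> * g \<tau> s = f (\<delta> * s)"
      by (simp only: f_eq phi_mult mult_ac)
  qed
  have simple: "v x \<noteq> 0 \<or> z x \<noteq> 0" if "x \<in> {0..1}" for x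
    by (rule plane_sol_simple[OF p v(1) nonlin_bound _ that]) (use v in simp_all)
  have "zero_chain k 1 (\<lambda>x. \<delta> * v x)"
    using zc \<delta> by (simp add: zero_chain_def)
  moreover have "\<not> alternates k 1 (\<lambda>x. \<delta> * v x)"
  proof -
    have "0 < (-1) ^ i * (\<delta> * v x) \<longleftrightarrow> 0 < (-1) ^ i * v x" for i :: nat and x
      using \<delta> by (simp add: mult.left_commute[of _ \<delta>] zero_less_mult_iff)
    then show ?thesis
      using na by (simp add: alternates_def)
  qed
  ultimately have "(\<lambda>x. \<delta> * v x) \<in> S_plus k" "dirichlet_solution p (nonlin r f) (\<lambda>x. \<delta> * v x)"
    using S_plus_of_plane_sol[OF p k sol] simple \<delta> v(2,3) by simp_all
  then show ?thesis by blast
qed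

end

lemma S_minus_iff: "u \<in> S (- 1) k \<longleftrightarrow> (\<lambda>x. - u x) \<in> S_plus k"
proof
  assume "(\<lambda>x. - u x) \<in> S_plus k"
  then have "(\<lambda>x. - 1 * - u x) \<in> S (- 1) k"
    unfolding S_def by (rule imageI)
  then show "u \<in> S (- 1) k" by simp
qed (auto simp: S_def)

lemma half_linear_reflect:
  "(\<lambda>x s. - half_linear p a \<alpha> \<beta> lam x (- s)) = half_linear p a (\<lambda>x. - \<beta> x) (\<lambda>x. - \<alpha> x) lam"
  by (intro ext) (simp add: half_linear_def pos_part_def neg_part_def max_def min_def)

text \<open>The reflection $u \mapsto -u$ maps solutions with $(\alpha,\beta)$ to solutions with
  $(-\beta,-\alpha)$.\<close>

lemma half_eigenvalue_minus:
  assumes p: "1 < p"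
  shows "half_eigenvalue p a \<alpha> \<beta> (- 1) k = half_eigenvalue p a (\<lambda>x. - \<beta> x) (\<lambda>x. - \<alpha> x) 1 k"
proof -
  have "(\<exists>u\<in>S (- 1) k. dirichlet_solution p (half_linear p a \<alpha> \<beta> lam) u) \<longleftrightarrow>
      (\<exists>u\<in>S_plus k. dirichlet_solution p (half_linear p a (\<lambda>x. - \<beta> x) (\<lambda>x. - \<alpha> x) lam) u)" for lam
  proof
    assume "\<exists>u\<in>S (- 1) k. dirichlet_solution p (half_linear p a \<alpha> \<beta> lam) u"
    then obtain u where "u \<in> S (- 1) k" "dirichlet_solution p (half_linear p a \<alpha> \<beta> lam) u" by blast
    then show "\<exists>u\<in>S_plus k. dirichlet_solution p (half_linear p a (\<lambda>x. - \<beta> x) (\<lambda>x. - \<alpha> x) lam) u"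
      using dirichlet_minus[OF p] unfolding half_linear_reflect[symmetric] S_minus_iff by blast
  next
    assume "\<exists>u\<in>S_plus k. dirichlet_solution p (half_linear p a (\<lambda>x. - \<beta> x) (\<lambda>x. - \<alpha> x) lam) u"
    then obtain u where u: "u \<in> S_plus k"
      "dirichlet_solution p (half_linear p a (\<lambda>x. - \<beta> x) (\<lambda>x. - \<alpha> x) lam) u" by blast
    from dirichlet_minus[OF p u(2)] have "dirichlet_solution p (half_linear p a \<alpha> \<beta> lam) (\<lambda>x. - u x)"
      by (simp add: half_linear_reflect)
    moreover have "(\<lambda>x. - u x) \<in> S (- 1) k"
      using u(1) by (simp add: S_minus_iff)
    ultimately show "\<exists>u\<in>S (- 1) k. dirichlet_solution p (half_linear p a \<alpha> \<beta> lam) u" by blast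
  qed
  moreover have "S 1 k = S_plus k"
    by (simp add: S_def)
  ultimately show ?thesis
    by (simp add: half_eigenvalue_def half_linear_def[abs_def])
qed

theorem theorem1p3:
  fixes p r f0 finf \<nu> :: real and a \<alpha> \<beta> f :: "real \<Rightarrow> real" and k :: nat
  assumes "1 < p"
    and "continuous_on {0..1} a" and "\<And>x. x \<in> {0..1} \<Longrightarrow> a x > 0"
    and "continuous_on {0..1} \<alpha>" and "continuous_on {0..1} \<beta>"
    and "continuous_on UNIV f" and "\<And>s. s \<noteq> 0 \<Longrightarrow> s * f s > 0"
    and "f0 > 0" and "((\<lambda>s. f s / phi p s) \<longlongrightarrow> f0) (at 0)"
    and "finf > 0" and "((\<lambda>s. f s / phi p s) \<longlongrightarrow> finf) at_infinity"
    and "k \<ge> 1" and "\<nu> \<in> {1, -1}"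
    and "(half_eigenvalue p a \<alpha> \<beta> \<nu> k / finf < r \<and> r < half_eigenvalue p a \<alpha> \<beta> \<nu> k / f0) \<or>
         (half_eigenvalue p a \<alpha> \<beta> \<nu> k / f0 < r \<and> r < half_eigenvalue p a \<alpha> \<beta> \<nu> k / finf)"
  shows "\<exists>u. dirichlet_solution p
           (\<lambda>x s. r * a x * f s + \<alpha> x * phi p (pos_part s) + \<beta> x * phi p (neg_part s)) u \<and>
         finite (interior_zeros u) \<and> card (interior_zeros u) = k - 1 \<and>
         (\<forall>\<^sub>F x in at_right 0. \<nu> * u x > 0)"
proof -
  define lam where "lam = half_eigenvalue p a \<alpha> \<beta> \<nu> k"
  have r: "r * f0 < lam \<and> lam < r * finf \<or> r * finf < lam \<and> lam < r * f0"
    using assms(14) \<open>0 < f0\<close> \<open>0 < finf\<close> unfolding lam_def[symmetric]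
    by (auto simp: pos_divide_less_eq pos_less_divide_eq)
  from \<open>\<nu> \<in> {1, -1}\<close> consider "\<nu> = 1" | "\<nu> = - 1" by auto
  then show ?thesis
  proof cases
    case 1
    interpret half_linear_problem p a \<alpha> \<beta>
      by unfold_locales (use assms in auto)
    obtain e where e: "e \<in> S_plus k" "dirichlet_solution p (F lam) e"
      using half_eigenvalue_plus[OF \<open>1 \<le> k\<close>] by (auto simp: lam_def 1)
    obtain u where "u \<in> S_plus k" "dirichlet_solution p (nonlin r f) u"
      using nodal_solution_plus[OF assms(6,9,11) \<open>1 \<le> k\<close> e r] by blast
    then show ?thesis
      by (intro exI[of _ u]) (simp add: 1 S_plus_def nonlin_def[abs_def])
  next
    case 2
    interpret half_linear_problem p a "\<lambda>x. - \<beta> x" "\<lambda>x. - \<alpha> x"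
      by unfold_locales (use assms in \<open>auto intro!: continuous_intros\<close>)
    obtain e where e: "e \<in> S_plus k" "dirichlet_solution p (F lam) e"
      using half_eigenvalue_plus[OF \<open>1 \<le> k\<close>] by (auto simp: lam_def 2 half_eigenvalue_minus[OF p])
    define g where "g s = - f (- s)" for s
    have ratio: "g s / phi p s = f (- s) / phi p (- s)" for s
      by (simp add: g_def)
    have "continuous_on UNIV g"
      unfolding g_def by (intro continuous_intros continuous_on_compose2[OF assms(6)]) auto
    moreover have "((\<lambda>s. g s / phi p s) \<longlongrightarrow> f0) (at 0)"
    proof -
      have "filterlim uminus (at 0) (at (0::real))"
        by (auto simp: filterlim_at eventually_at_filter intro!: tendsto_eq_intros)
      from filterlim_compose[OF assms(9) this] show ?thesis
        by (simp add: ratio)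
    qed
    moreover have "((\<lambda>s. g s / phi p s) \<longlongrightarrow> finf) at_infinity"
      using assms(11) unfolding ratio Lim_at_infinity by (metis norm_minus_cancel)
    ultimately obtain u where u: "u \<in> S_plus k" "dirichlet_solution p (nonlin r g) u"
      using nodal_solution_plus[of g f0 finf k e lam r, OF _ _ _ \<open>1 \<le> k\<close> e r] by blast
    have nonlin_eq: "(\<lambda>x s. - nonlin r g x (- s)) =
        (\<lambda>x s. r * a x * f s + \<alpha> x * phi p (pos_part s) + \<beta> x * phi p (neg_part s))"
      by (intro ext) (simp add: nonlin_def g_def pos_part_def neg_part_def max_def min_def)
    have "dirichlet_solution p
        (\<lambda>x s. r * a x * f s + \<alpha> x * phi p (pos_part s) + \<beta> x * phi p (neg_part s)) (\<lambda>x. - u x)"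
      using dirichlet_minus[OF p u(2)] unfolding nonlin_eq .
    moreover have "interior_zeros (\<lambda>x. - u x) = interior_zeros u"
      by (simp add: interior_zeros_def)
    ultimately show ?thesis
      using u(1) by (intro exI[of _ "\<lambda>x. - u x"]) (simp add: 2 S_plus_def)
  qed
qed

end
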